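(* Suppose there is a static deterministic distributed algorithm that computes a maximal independent set (MIS) of any $n$-vertex distributed network within $T(n)$ rounds (in the CONGEST model). Then, using this algorithm as a black box, an MIS can be maintained deterministically in the local wakeup model over any sequence of edge insertions and deletions that starts from the empty network on $n$ vertices, with $O(T(n))$ amortized round complexity and $O(m^{2/3}\cdot T(n))$ amortized message complexity, where $m$ denotes the dynamic number of edges.
   Context: A maximal independent set (MIS) of a graph is an independent set not contained in any larger independent set. In the CONGEST model, computation proceeds in synchronous fault-free rounds in which every processor (vertex) may send an $O(\log n)$-bit message to each of its neighbors; vertices know the IDs of their neighbors. Local wakeup model (distributed dynamic setting): the graph on the fixed vertex set $V$, $|V|=n$, starts empty and undergoes a sequence of edge insertions/deletions; after an update of edge $(u,v)$, only $u$ and $v$ wake up, and any other vertex participates in the update procedure only after receiving a message (propagated from $u$ or $v$); communication is synchronous CONGEST among awake vertices, and messages are unicast (a vertex may send different messages, or none, to different neighbors). After each update the maintained set must be an MIS of the current graph. Amortized round (resp. message) complexity is the average, over a worst-case update sequence, of the number of communication rounds (resp. $O(\log n)$-bit messages) used per update. The dynamic number of edges $m$ may be taken as the maximum number of edges present at any time during the update sequence, or as the average number of edges over all graphs in the sequence. *)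

theory Defs
  imports Complex_Main
begin

text \<open>A vertex is identified with its ID, a natural number; an edge is a two-element set.\<close>

type_synonym graph = "nat set set"

definition graph_on :: "nat set \<Rightarrow> graph \<Rightarrow> bool" where
  "graph_on V E \<longleftrightarrow> (\<forall>e\<in>E. e \<subseteq> V \<and> card e = 2)"

definition neighbors :: "graph \<Rightarrow> nat \<Rightarrow> nat set" where
  "neighbors E v = {u. {u, v} \<in> E}"

definition independent_set :: "nat set \<Rightarrow> graph \<Rightarrow> nat set \<Rightarrow> bool" where
  "independent_set V E S \<longleftrightarrow> S \<subseteq> V \<and> (\<forall>u\<in>S. \<forall>v\<in>S. {u, v} \<notin> E)"

definition is_mis :: "nat set \<Rightarrow> graph \<Rightarrow> nat set \<Rightarrow> bool" where
  "is_mis V E S \<longleftrightarrow> independent_set V E S \<and> (\<forall>S'. independent_set V E S' \<longrightarrow> \<not> S \<subset> S')"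

text \<open>The vertices carry distinct IDs below \<open>n ^ c\<close>, i.e. of \<open>O(log n)\<close> bits.\<close>

definition vertex_set :: "nat \<Rightarrow> nat \<Rightarrow> nat set \<Rightarrow> bool" where
  "vertex_set c n V \<longleftrightarrow> finite V \<and> card V = n \<and> V \<subseteq> {..<n ^ c}"

text \<open>
  Messages are bit strings of length at most \<open>b * log 2 n\<close>. An inbox maps each vertex to the
  message received from it in one round; \<open>None\<close> means that nothing was sent.
\<close>

type_synonym msg = "bool list"
type_synonym inbox = "nat \<Rightarrow> msg option"

definition fits :: "nat \<Rightarrow> nat \<Rightarrow> msg \<Rightarrow> bool" where
  "fits b n m \<longleftrightarrow> real (length m) \<le> real b * log 2 (real n)"

text \<open>
  Local computation and local memory are unrestricted, so what a vertex does is an arbitrary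
  function of what it has observed so far; no separate type of local states is needed.
  In the static model a vertex has observed \<open>n\<close>, its own ID, the IDs of its neighbors, and its
  inboxes of the previous rounds. The last argument of \<open>s_send\<close> is the addressee.
\<close>

record static_alg =
  s_send :: "nat \<Rightarrow> nat \<Rightarrow> nat set \<Rightarrow> inbox list \<Rightarrow> nat \<Rightarrow> msg option"
  s_out :: "nat \<Rightarrow> nat \<Rightarrow> nat set \<Rightarrow> inbox list \<Rightarrow> bool"

definition s_inbox ::
  "static_alg \<Rightarrow> nat \<Rightarrow> graph \<Rightarrow> (nat \<Rightarrow> inbox list) \<Rightarrow> nat \<Rightarrow> inbox" where
  "s_inbox A n E h v =
     (\<lambda>u. if u \<in> neighbors E v then s_send A n u (neighbors E u) (h u) v else None)"

primrec s_hist :: "static_alg \<Rightarrow> nat \<Rightarrow> graph \<Rightarrow> nat \<Rightarrow> nat \<Rightarrow> inbox list" where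
  "s_hist A n E 0 = (\<lambda>v. [])"
| "s_hist A n E (Suc r) = (\<lambda>v. s_hist A n E r v @ [s_inbox A n E (s_hist A n E r) v])"

definition s_result :: "static_alg \<Rightarrow> nat \<Rightarrow> nat set \<Rightarrow> graph \<Rightarrow> nat \<Rightarrow> nat set" where
  "s_result A n V E r = {v \<in> V. s_out A n v (neighbors E v) (s_hist A n E r v)}"

definition static_mis :: "nat \<Rightarrow> nat \<Rightarrow> static_alg \<Rightarrow> (nat \<Rightarrow> nat) \<Rightarrow> bool" where
  "static_mis c b A T \<longleftrightarrow>
     (\<forall>n V E. vertex_set c n V \<and> graph_on V E \<longrightarrow>
        is_mis V E (s_result A n V E (T n)) \<and>
        (\<forall>r<T n. \<forall>u v m. s_inbox A n E (s_hist A n E r) v u = Some m \<longrightarrow> fits b n m))"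

text \<open>Update sequences, starting from the empty graph.\<close>

datatype update = Ins nat nat | Del nat nat

fun apply_update :: "update \<Rightarrow> graph \<Rightarrow> graph" where
  "apply_update (Ins u v) E = insert {u, v} E"
| "apply_update (Del u v) E = E - {{u, v}}"

fun valid_update :: "nat set \<Rightarrow> graph \<Rightarrow> update \<Rightarrow> bool" where
  "valid_update V E (Ins u v) \<longleftrightarrow> u \<in> V \<and> v \<in> V \<and> u \<noteq> v \<and> {u, v} \<notin> E"
| "valid_update V E (Del u v) \<longleftrightarrow> {u, v} \<in> E"

definition graph_at :: "update list \<Rightarrow> nat \<Rightarrow> graph" where
  "graph_at us i = fold apply_update (take i us) {}"

definition update_seq :: "nat set \<Rightarrow> update list \<Rightarrow> bool" where
  "update_seq V us \<longleftrightarrow> (\<forall>i<length us. valid_update V (graph_at us i) (us ! i))"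

definition max_edges :: "update list \<Rightarrow> real" where
  "max_edges us = real (Max ((\<lambda>i. card (graph_at us i)) ` {..length us}))"

definition avg_edges :: "update list \<Rightarrow> real" where
  "avg_edges us = real (\<Sum>i\<le>length us. card (graph_at us i)) / real (length us + 1)"

text \<open>
  In the local wakeup model a vertex observes \<open>n\<close>, its own ID and a list of events: the insertions
  and deletions of its incident edges (with the ID of the other endpoint), and one inbox for each
  round in which it was awake or received a message. A sleeping vertex observes nothing, not even
  the passing of rounds. After each event the vertex decides by \<open>d_sleep\<close> whether to fall asleep;
  it sends messages in a round only if it is awake.
\<close>

datatype event = Inserted nat | Deleted nat | Received inbox

record dyn_alg =
  d_send :: "nat \<Rightarrow> nat \<Rightarrow> event list \<Rightarrow> nat \<Rightarrow> msg option"
  d_sleep :: "nat \<Rightarrow> nat \<Rightarrow> event list \<Rightarrow> bool"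
  d_out :: "nat \<Rightarrow> nat \<Rightarrow> event list \<Rightarrow> bool"

text \<open>A configuration consists of the histories of all vertices and the set of awake vertices.\<close>

type_synonym config = "(nat \<Rightarrow> event list) \<times> nat set"

definition observe ::
  "dyn_alg \<Rightarrow> nat \<Rightarrow> (nat \<Rightarrow> event list) \<Rightarrow> (nat \<Rightarrow> event) \<Rightarrow> nat set \<Rightarrow> config" where
  "observe D n h ev P =
     (let h' = (\<lambda>v. if v \<in> P then h v @ [ev v] else h v)
      in (h', {v \<in> P. \<not> d_sleep D n v (h' v)}))"

fun wakeup :: "dyn_alg \<Rightarrow> nat \<Rightarrow> (nat \<Rightarrow> event list) \<Rightarrow> update \<Rightarrow> config" where
  "wakeup D n h (Ins u v) = observe D n h (\<lambda>x. Inserted (if x = u then v else u)) {u, v}"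
| "wakeup D n h (Del u v) = observe D n h (\<lambda>x. Deleted (if x = u then v else u)) {u, v}"

fun d_inbox :: "dyn_alg \<Rightarrow> nat \<Rightarrow> graph \<Rightarrow> config \<Rightarrow> nat \<Rightarrow> inbox" where
  "d_inbox D n E (h, W) v =
     (\<lambda>u. if u \<in> neighbors E v \<and> u \<in> W then d_send D n u (h u) v else None)"

fun d_round :: "dyn_alg \<Rightarrow> nat \<Rightarrow> graph \<Rightarrow> config \<Rightarrow> config" where
  "d_round D n E (h, W) =
     observe D n h (\<lambda>v. Received (d_inbox D n E (h, W) v))
       (W \<union> {v. \<exists>u. d_inbox D n E (h, W) v u \<noteq> None})"

definition d_config ::
  "dyn_alg \<Rightarrow> nat \<Rightarrow> graph \<Rightarrow> (nat \<Rightarrow> event list) \<Rightarrow> update \<Rightarrow> nat \<Rightarrow> config" where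
  "d_config D n E h x k = (d_round D n E ^^ k) (wakeup D n h x)"

text \<open>
  The update procedure ends as soon as all vertices are asleep. The number of its rounds is
  meaningful only if that happens, which \<open>maintains_mis\<close> below requires. Here \<open>E\<close> is the graph
  after the update \<open>x\<close> and \<open>h\<close> are the histories before it.
\<close>

definition d_rounds ::
  "dyn_alg \<Rightarrow> nat \<Rightarrow> graph \<Rightarrow> (nat \<Rightarrow> event list) \<Rightarrow> update \<Rightarrow> nat" where
  "d_rounds D n E h x = (LEAST k. snd (d_config D n E h x k) = {})"

definition d_messages ::
  "dyn_alg \<Rightarrow> nat \<Rightarrow> graph \<Rightarrow> (nat \<Rightarrow> event list) \<Rightarrow> update \<Rightarrow> nat" where
  "d_messages D n E h x =
     (\<Sum>k<d_rounds D n E h x. card {(u, v). d_inbox D n E (d_config D n E h x k) v u \<noteq> None})"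

primrec d_hist :: "dyn_alg \<Rightarrow> nat \<Rightarrow> update list \<Rightarrow> nat \<Rightarrow> nat \<Rightarrow> event list" where
  "d_hist D n us 0 = (\<lambda>v. [])"
| "d_hist D n us (Suc i) =
     (let E = graph_at us (Suc i); h = d_hist D n us i; x = us ! i
      in fst (d_config D n E h x (d_rounds D n E h x)))"

definition d_result :: "dyn_alg \<Rightarrow> nat \<Rightarrow> nat set \<Rightarrow> update list \<Rightarrow> nat \<Rightarrow> nat set" where
  "d_result D n V us i = {v \<in> V. d_out D n v (d_hist D n us i v)}"

definition maintains_mis ::
  "nat \<Rightarrow> dyn_alg \<Rightarrow> nat \<Rightarrow> nat set \<Rightarrow> update list \<Rightarrow> bool" where
  "maintains_mis b D n V us \<longleftrightarrow>
     (\<forall>i\<le>length us. is_mis V (graph_at us i) (d_result D n V us i)) \<and>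
     (\<forall>i<length us.
        let E = graph_at us (Suc i); h = d_hist D n us i; x = us ! i
        in (\<exists>k. snd (d_config D n E h x k) = {}) \<and>
           (\<forall>k<d_rounds D n E h x. \<forall>u v m.
              d_inbox D n E (d_config D n E h x k) v u = Some m \<longrightarrow> fits b n m))"

definition amortized_rounds :: "dyn_alg \<Rightarrow> nat \<Rightarrow> update list \<Rightarrow> real" where
  "amortized_rounds D n us =
     real (\<Sum>i<length us. d_rounds D n (graph_at us (Suc i)) (d_hist D n us i) (us ! i))
       / real (length us)"

definition amortized_messages :: "dyn_alg \<Rightarrow> nat \<Rightarrow> update list \<Rightarrow> real" where
  "amortized_messages D n us =
     real (\<Sum>i<length us. d_messages D n (graph_at us (Suc i)) (d_hist D n us i) (us ! i))
       / real (length us)"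

end

theory Submission
  imports Defs
begin

text \<open>
  The MIS is the union of an MIS of the light vertices and an MIS of those heavy vertices that have no
  light neighbor in it. The light part is repaired greedily, one vertex at a time, and its changes are
  announced to all neighbors; the heavy part is repaired by running the static algorithm on the heavy
  vertices that have lost their cover, and its changes are announced to heavy neighbors only.

  With the threshold at degree \<open>m powr (2/3)\<close> all this is cheap, but no vertex knows \<open>m\<close>, so the split is
  adaptive. A vertex that an insertion forces out of the light MIS becomes heavy. Departures from the
  heavy MIS explore clusters, sets of heavy vertices within three hops of a common root; the root
  collects the degree sum \<open>M\<close> of its cluster, and the members with \<open>d ^ 3 \<le> M ^ 2\<close> become light. Since
  \<open>M \<le> 4 * m\<close>, such a vertex has degree \<open>O(m powr (2/3))\<close>, and since at most \<open>M powr (1/3)\<close> vertices of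
  larger degree fit into a cluster, all but \<open>M powr (2/3)\<close> of the explored edges are incident to a vertex
  that becomes light. Vertices becoming light may enter the MIS and evict heavy ones, which starts
  another phase.

  A potential proportional to \<open>T * (d + m powr (2/3))\<close> for every light vertex outside the MIS, and three
  times as much for every heavy vertex, pays for the phases. Only a forced departure raises it by more
  than the budget \<open>O(T * m powr (2/3))\<close> of an update, namely if the degree of the vertex is large; then
  many edges have been deleted or inserted since the vertex became light, and these have paid.
\<close>

section \<open>Encoding of messages\<close>

text \<open>Why a cluster sum can replace \<open>m\<close>: pings not charged to a vertex becoming
  light join two vertices of degree above \<open>M powr (2/3)\<close>, and at most
  \<open>M powr (1/3)\<close> of these fit on either side, whatever the value of \<open>M\<close>.
  The askers of a cluster and their heavy neighbors have degree sum at most \<open>2 * m\<close>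
  each, hence \<open>M \<le> 4 * m\<close>. A heavy vertex counts three times because it pays three
  times: when it decides to become light (for the exploration), when it does so (for the run), and
  when it enters the MIS (for its announcement and the evictions). After a forced departure several
  light neighbors may be free at once and adjacent to each other, so the vertex that left admits
  them one by one. Rounds are therefore bounded by a separate, unweighted measure: the sum of the
  ranks, which an update raises by a constant only. Sleeping vertices cannot count rounds; the
  analysis follows one global execution, linked to the local views by a simulation. Charging to
  \<open>T n\<close> requires \<open>T n \<ge> 1\<close>, which is proved for more than two
  vertices; at most two need no message.\<close>

type_synonym payload = "nat \<times> nat \<times> msg"
type_synonym pinbox = "nat \<Rightarrow> payload option"

fun nat_bits :: "nat \<Rightarrow> bool list" where
  "nat_bits 0 = []"
| "nat_bits (Suc k) = odd (Suc k) # nat_bits (Suc k div 2)"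

text \<open>A prefix-free code: the fields of a message can be concatenated and still be told apart,
  at the price of doubling their length.\<close>

fun delimit :: "bool list \<Rightarrow> bool list \<Rightarrow> bool list" where
  "delimit [] r = False # r"
| "delimit (x # xs) r = True # x # delimit xs r"

fun encode :: "nat \<Rightarrow> payload \<Rightarrow> msg" where
  "encode t (i, j, bs) = delimit (nat_bits t) (delimit (nat_bits i) (delimit (nat_bits j) bs))"

definition decode :: "msg \<Rightarrow> nat \<times> payload" where
  "decode m = (THE x. encode (fst x) (snd x) = m)"

lemma nat_bits_inject: "nat_bits i = nat_bits j \<Longrightarrow> i = j"
proof (induction i arbitrary: j rule: nat_bits.induct)
  case 1
  then show ?case by (cases j) auto
next
  case (2 i)
  then obtain k where j: "j = Suc k" by (cases j) auto
  have "Suc i div 2 = Suc k div 2" "odd (Suc i) = odd (Suc k)"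
    using 2 unfolding j by auto
  then show ?case unfolding j by presburger
qed

lemma delimit_inject: "delimit xs r = delimit ys r' \<Longrightarrow> xs = ys \<and> r = r'"
proof (induction xs r arbitrary: ys rule: delimit.induct)
  case (1 r)
  then show ?case by (cases ys) auto
next
  case (2 x xs r)
  then show ?case by (cases ys) auto
qed

lemma encode_inject: "encode t x = encode t' x' \<Longrightarrow> t = t' \<and> x = x'"
  by (cases x; cases x') (auto dest!: delimit_inject nat_bits_inject)

lemma decode_encode [simp]: "decode (encode t x) = (t, x)"
  unfolding decode_def by (rule the_equality) (auto dest: encode_inject)

lemma length_delimit [simp]: "length (delimit xs r) = 2 * length xs + 1 + length r"
  by (induction xs r rule: delimit.induct) auto

lemma length_nat_bits: "k > 0 \<Longrightarrow> 2 ^ (length (nat_bits k) - 1) \<le> k"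
proof (induction k rule: nat_bits.induct)
  case (2 k)
  show ?case
  proof (cases "Suc k div 2 = 0")
    case False
    then obtain l where l: "nat_bits (Suc k div 2) = l" "length l > 0"
      by (cases "Suc k div 2") auto
    with 2 False have "2 ^ (length l - 1) \<le> Suc k div 2" by auto
    then have "2 * 2 ^ (length l - 1) \<le> Suc k" by linarith
    moreover have "2 * 2 ^ (length l - 1) = (2::nat) ^ length l"
      using l(2) by (cases "length l") auto
    ultimately show ?thesis using l by simp
  qed simp
qed simp

lemma length_nat_bits_log:
  assumes "k < n ^ q" "n \<ge> 2"
  shows "real (length (nat_bits k)) \<le> real (q + 1) * log 2 (real n)"
proof -
  have L: "1 \<le> log 2 (real n)" using assms(2) by (simp add: le_log_iff)
  show ?thesis
  proof (cases "k = 0")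
    case True
    then show ?thesis using L by simp
  next
    case False
    then have "2 ^ (length (nat_bits k) - 1) < n ^ q"
      using length_nat_bits[of k] assms(1) by simp
    then have "(2::real) ^ (length (nat_bits k) - 1) \<le> real n ^ q"
      by (metis less_imp_le of_nat_le_iff of_nat_numeral of_nat_power)
    then have "log 2 ((2::real) ^ (length (nat_bits k) - 1)) \<le> log 2 (real n ^ q)"
      using assms(2) by (subst log_le_cancel_iff) auto
    then have "real (length (nat_bits k) - 1) \<le> real q * log 2 (real n)"
      using assms(2) by (simp add: log_nat_power)
    then have "real (length (nat_bits k)) \<le> real q * log 2 (real n) + 1" by linarith
    also have "\<dots> \<le> real (q + 1) * log 2 (real n)" using L by (simp add: algebra_simps)
    finally show ?thesis .
  qed
qed

text \<open>The fields \<open>i\<close> and \<open>j\<close> take at most \<open>q + 1\<close>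
  logarithms each and are doubled by \<open>delimit\<close>, which gives \<open>4 * (q + 1)\<close>.
  The tag, below 16, and the three end marks add 13 bits, absorbed because the logarithm is at least
  1.\<close>

lemma fits_encode:
  assumes "n \<ge> 2" "t < 16" "i < n ^ q" "j < n ^ q"
    and "real (length bs) \<le> real b * log 2 (real n)"
  shows "fits (b + 4 * q + 17) n (encode t (i, j, bs))"
proof -
  have L: "1 \<le> log 2 (real n)" using assms(1) by (simp add: le_log_iff)
  have "t < 2 ^ 4" using assms(2) by simp
  then have "real (length (nat_bits t)) \<le> 5"
    using length_nat_bits_log[of t 2 4] by simp
  then have "real (length (encode t (i, j, bs))) \<le>
      13 + 4 * (real (q + 1) * log 2 (real n)) + real b * log 2 (real n)"
    using length_nat_bits_log[OF assms(3,1)] length_nat_bits_log[OF assms(4,1)] assms(5) by simp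
  also have "\<dots> \<le> real (b + 4 * q + 17) * log 2 (real n)"
    using L by (simp add: algebra_simps)
  finally show ?thesis by (simp add: fits_def)
qed

declare encode.simps [simp del]

section \<open>The algorithm\<close>

text \<open>
  The class \<open>cls\<close> of a vertex is 1 (light, not in the MIS), 2 (light, in the MIS) or 3 (heavy); \<open>hm\<close> marks
  the heavy members of the MIS. The map \<open>nbc\<close> holds the classes of the neighbors; there 0 means that
  there is no edge and 9 that the edge is new.
  The other fields describe the part of the vertex in the current update: \<open>ann\<close>, its class has changed
  and is to be announced; \<open>left\<close>, it has left the MIS as a heavy vertex, or the light part of it by force,
  and belongs to the cluster of \<open>lroot\<close>; \<open>ask\<close>, it is heavy, its neighbor \<open>apar\<close> has left, and it
  belongs to the cluster of \<open>aroot\<close>; \<open>pinged\<close>, who asked it, and for which cluster; \<open>amass\<close>, \<open>lmass\<close>,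
  \<open>rmass\<close>, the degree sums collected in these roles, and \<open>lthr\<close>, \<open>athr\<close>, the sum sent back by the root;
  \<open>conv\<close>, it is about to become light; \<open>unc\<close>, it is heavy and uncovered; \<open>cands\<close>, the light vertices
  that wait for the permission of this vertex to enter the MIS, and \<open>coord\<close>, the vertex whose permission
  it awaits itself; \<open>part\<close>, \<open>rnbs\<close>, \<open>hist\<close>, the simulation of the static algorithm.
\<close>

record vstate =
  cls :: nat
  hm :: bool
  nbc :: "nat \<Rightarrow> nat"
  ann :: bool
  left :: bool
  lroot :: nat
  ask :: bool
  apar :: nat
  aroot :: nat
  pinged :: "nat \<Rightarrow> nat option"
  amass :: nat
  lmass :: nat
  rmass :: nat
  lkids :: "nat set"
  rkids :: "nat set"
  lthr :: nat
  athr :: nat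
  conv :: bool
  unc :: bool
  cands :: "nat set"
  coord :: "nat option"
  part :: bool
  rnbs :: "nat set"
  hist :: "inbox list"
  awake :: bool

definition fresh :: "nat \<Rightarrow> bool \<Rightarrow> (nat \<Rightarrow> nat) \<Rightarrow> nat option \<Rightarrow> vstate" where
  "fresh k h f c = \<lparr>cls = k, hm = h, nbc = f, ann = False, left = False, lroot = 0, ask = False,
     apar = 0, aroot = 0, pinged = (\<lambda>u. None), amass = 0, lmass = 0, rmass = 0, lkids = {},
     rkids = {}, lthr = 0, athr = 0, conv = False, unc = False, cands = {}, coord = c,
     part = False, rnbs = {}, hist = [], awake = False\<rparr>"

definition has_ml :: "vstate \<Rightarrow> bool" where
  "has_ml s \<longleftrightarrow> (\<exists>u. nbc s u = 2)"

definition deg :: "vstate \<Rightarrow> nat" where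
  "deg s = card {u. nbc s u \<noteq> 0}"

definition heard :: "pinbox \<Rightarrow> nat \<Rightarrow> nat set" where
  "heard ib k = {u. \<exists>x. ib u = Some (k, x)}"

text \<open>
  Awake vertices agree on a position \<open>p\<close>, which messages carry to sleeping ones. An update starts at
  position \<open>11 + T n\<close>, where the endpoints of a new edge exchange their status. Then the positions
  \<open>0, \<dots>, 10 + T n\<close> repeat: 0, announce a new class; 1, departures tell the heavy neighbors, candidates
  their coordinator; 2 and 3, ping and reply; 4 and 5, degree sums to the root; 6 to 8, the total back,
  whereupon the vertices of small degree decide to become light, and the coordinator picks one
  candidate; 9, the candidate announces that it enters; 10, vertices becoming light and uncovered heavy
  vertices announce themselves; from 11 on, both groups run the static algorithm, separately.
\<close>

definition vsend ::
  "static_alg \<Rightarrow> (nat \<Rightarrow> nat) \<Rightarrow> nat \<Rightarrow> nat \<Rightarrow> nat \<Rightarrow> vstate \<Rightarrow> nat \<Rightarrow> payload option" where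
  "vsend A T n p v s u =
    (if \<not> awake s then None
     else if p = 0 \<or> p = 9 then (if ann s \<and> nbc s u \<noteq> 0 then Some (cls s, 0, []) else None)
     else if p = 1 then
       (if coord s = Some u then Some (if has_ml s then 2 else 1, 0, [])
        else if left s \<and> nbc s u = 3 then Some (0, lroot s, []) else None)
     else if p = 2 then (if ask s \<and> nbc s u = 3 then Some (aroot s, 0, []) else None)
     else if p = 3 then
       (case pinged s u of None \<Rightarrow> None
        | Some z \<Rightarrow> Some (if hm s then 1 else 0,
            if u = Min {w. pinged s w = Some z} then deg s else 0, []))
     else if p = 4 then (if ask s \<and> apar s \<noteq> v \<and> apar s = u then Some (amass s, 0, []) else None)
     else if p = 5 then (if left s \<and> lroot s \<noteq> v \<and> lroot s = u then Some (lmass s, 0, []) else None)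
     else if p = 6 then (if u \<in> rkids s then Some (rmass s, 0, []) else None)
     else if p = 7 then (if u \<in> lkids s then Some (lthr s, 0, []) else None)
     else if p = 8 then
       (if ask s \<and> nbc s u = 3 then Some (athr s, 0, [])
        else if cands s \<noteq> {} \<and> u = Min (cands s) then Some (0, 0, [True]) else None)
     else if p = 10 then
       (if conv s \<and> nbc s u \<noteq> 0 then Some (if has_ml s then 1 else 4, 0, [])
        else if unc s \<and> \<not> has_ml s \<and> nbc s u = 3 then Some (5, 0, []) else None)
     else if p \<le> 10 + T n then
       (if part s \<and> u \<in> rnbs s
        then map_option (\<lambda>m. (0, 0, m)) (s_send A n v (rnbs s) (hist s) u) else None)
     else (if nbc s u = 9 then Some (cls s, if hm s then 1 else 0, []) else None))"

definition step_announce :: "vstate \<Rightarrow> pinbox \<Rightarrow> vstate" where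
  "step_announce s ib =
    s\<lparr>nbc := (\<lambda>u. case ib u of None \<Rightarrow> nbc s u | Some x \<Rightarrow> fst x),
      ann := False,
      hm := hm s \<and> heard ib 2 = {},
      left := left s \<or> hm s \<and> heard ib 2 \<noteq> {},
      lroot := (if hm s \<and> heard ib 2 \<noteq> {} then Min (heard ib 2) else lroot s),
      coord := (if cls s = 1 \<and> heard ib 3 \<noteq> {} \<and>
                  (\<forall>u. (case ib u of None \<Rightarrow> nbc s u | Some x \<Rightarrow> fst x) \<noteq> 2)
                then Some (Min (heard ib 3)) else coord s)\<rparr>"

definition step_left :: "vstate \<Rightarrow> pinbox \<Rightarrow> vstate" where
  "step_left s ib =
    (let a = (cls s = 3 \<and> heard ib 0 \<noteq> {}) in
     s\<lparr>ask := ask s \<or> a,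
       apar := (if a then Min (heard ib 0) else apar s),
       aroot := (if a then fst (snd (the (ib (Min (heard ib 0))))) else aroot s),
       cands := cands s \<union> heard ib 1 - heard ib 2,
       coord := (if has_ml s then None else coord s)\<rparr>)"

definition step_reply :: "vstate \<Rightarrow> pinbox \<Rightarrow> vstate" where
  "step_reply s ib =
    s\<lparr>amass := (if ask s then deg s + (\<Sum>u | ib u \<noteq> None. fst (snd (the (ib u)))) else 0),
      unc := ask s \<and> \<not> hm s \<and> \<not> has_ml s \<and> heard ib 1 = {}\<rparr>"

definition total :: "pinbox \<Rightarrow> nat" where
  "total ib = (\<Sum>u | ib u \<noteq> None. fst (the (ib u)))"

definition step_mass2 :: "nat \<Rightarrow> vstate \<Rightarrow> pinbox \<Rightarrow> vstate" where
  "step_mass2 v s ib =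
    s\<lparr>rkids := {u. ib u \<noteq> None},
      rmass := total ib + (if left s \<and> lroot s = v then lmass s else 0)
        + (if ask s \<and> apar s = v then amass s else 0)\<rparr>"

text \<open>The cubes express \<open>deg s \<le> M powr (2/3)\<close> in natural numbers. A heavy
  vertex is tested against the sum of its own cluster and those of all clusters with an asker next
  to it. Isolated vertices never convert, because their weight in the potential is 0 and could not
  pay.\<close>

definition decide_conv :: "vstate \<Rightarrow> pinbox \<Rightarrow> bool" where
  "decide_conv s ib \<longleftrightarrow> cls s = 3 \<and> deg s \<ge> 1 \<and>
     (ask s \<and> deg s ^ 3 \<le> athr s ^ 2 \<or> (\<exists>u k. ib u = Some (k, 0, []) \<and> deg s ^ 3 \<le> k ^ 2))"

definition step_decide :: "vstate \<Rightarrow> pinbox \<Rightarrow> vstate" where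
  "step_decide s ib =
    (let pick = (\<exists>u. ib u = Some (0, 0, [True]));
         cv = decide_conv s ib;
         cs = (if cands s = {} then {} else cands s - {Min (cands s)})
     in (fresh (if pick then 2 else cls s) (hm s) (nbc s)
           (if pick \<or> has_ml s then None else coord s))
        \<lparr>ann := pick, conv := cv, unc := unc s \<and> \<not> cv, cands := cs,
         awake := pick \<or> cv \<or> unc s \<or> cs \<noteq> {}\<rparr>)"

definition step_class :: "nat \<Rightarrow> vstate \<Rightarrow> pinbox \<Rightarrow> vstate" where
  "step_class v s ib =
    s\<lparr>cls := (if conv s then 1 else cls s),
      hm := hm s \<and> \<not> conv s,
      left := left s \<or> conv s \<and> hm s,
      lroot := (if conv s \<and> hm s then v else lroot s),
      nbc := (\<lambda>u. if u \<in> heard ib 1 \<union> heard ib 4 then 1 else nbc s u),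
      part := (conv s \<or> unc s) \<and> \<not> has_ml s,
      rnbs := (if conv s then heard ib 4 else if unc s then heard ib 5 else {}),
      hist := []\<rparr>"

definition step_run :: "static_alg \<Rightarrow> (nat \<Rightarrow> nat) \<Rightarrow> nat \<Rightarrow> nat \<Rightarrow> nat \<Rightarrow> vstate \<Rightarrow> pinbox \<Rightarrow> vstate" where
  "step_run A T n p v s ib =
    (let h = hist s @ [\<lambda>u. if u \<in> rnbs s then map_option (snd \<circ> snd) (ib u) else None];
         out = (part s \<and> s_out A n v (rnbs s) h)
     in if p < 10 + T n then s\<lparr>hist := h\<rparr>
        else s\<lparr>cls := (if conv s \<and> out then 2 else cls s), ann := conv s \<and> out,
               hm := hm s \<or> unc s \<and> out, conv := False, unc := False, part := False,
               rnbs := {}, hist := []\<rparr>)"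

text \<open>Tie-breaking on a new edge inside the MIS: a heavy member yields to a light one,
  otherwise the endpoint with the larger ID yields. So exactly one endpoint departs. An endpoint
  with nothing left to do becomes clean at once.\<close>

definition step_exchange :: "nat \<Rightarrow> vstate \<Rightarrow> pinbox \<Rightarrow> vstate" where
  "step_exchange v s ib =
    (let conflict = (\<exists>u k j m. nbc s u = 9 \<and> ib u = Some (k, j, m) \<and>
           (cls s = 2 \<and> k = 2 \<and> u < v \<or> hm s \<and> (k = 2 \<or> j = 1 \<and> u < v)));
         f = (\<lambda>u. if nbc s u = 9 then (case ib u of None \<Rightarrow> 0 | Some x \<Rightarrow> fst x) else nbc s u)
     in if ann s \<or> left s \<or> ask s \<or> conflict
        then s\<lparr>nbc := f,
          left := left s \<or> conflict,
          lroot := (if conflict then v else lroot s),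
          ann := ann s \<or> conflict \<and> cls s = 2,
          cls := (if conflict then 3 else cls s),
          hm := hm s \<and> \<not> conflict\<rparr>
        else fresh (cls s) (hm s) f (if \<exists>u. f u = 2 then None else coord s))"

definition step_const :: "nat \<Rightarrow> nat \<Rightarrow> vstate \<Rightarrow> pinbox \<Rightarrow> vstate" where
  "step_const p v s ib =
    (if p = 0 \<or> p = 9 then step_announce s ib
     else if p = 1 then step_left s ib
     else if p = 2 then s\<lparr>pinged := (\<lambda>u. map_option fst (ib u))\<rparr>
     else if p = 3 then step_reply s ib
     else if p = 4 then s\<lparr>lkids := {u. ib u \<noteq> None}, lmass := total ib\<rparr>
     else if p = 5 then step_mass2 v s ib
     else if p = 6 then
       s\<lparr>lthr := (if left s then if lroot s = v then rmass s else fst (the (ib (lroot s))) else 0)\<rparr>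
     else if p = 7 then
       s\<lparr>athr := (if ask s then if apar s = v then rmass s else fst (the (ib (apar s))) else 0)\<rparr>
     else step_class v s ib)"

definition vnext ::
  "static_alg \<Rightarrow> (nat \<Rightarrow> nat) \<Rightarrow> nat \<Rightarrow> nat \<Rightarrow> nat \<Rightarrow> vstate \<Rightarrow> pinbox \<Rightarrow> vstate" where
  "vnext A T n p v s ib =
    (if p = 8 then step_decide s ib
     else if p \<le> 10 then (step_const p v s ib)\<lparr>awake := awake s \<or> (\<exists>u. ib u \<noteq> None)\<rparr>
     else if \<not> awake s then s
     else if p \<le> 10 + T n then step_run A T n p v s ib
     else step_exchange v s ib)"

definition next_pos :: "nat \<Rightarrow> nat \<Rightarrow> nat" where
  "next_pos t p = (if p \<ge> 10 + t then 0 else Suc p)"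

definition ev_ins :: "nat \<Rightarrow> vstate \<Rightarrow> vstate" where
  "ev_ins u s = s\<lparr>nbc := (nbc s)(u := 9), awake := True\<rparr>"

text \<open>A light vertex without a neighbor in the light MIS can be told from \<open>nbc\<close>
  alone and enters at once. The map does not record heavy members, so a heavy vertex must ask its
  neighbors whether one of them covers it, as the root of a cluster of its own.\<close>

definition ev_del :: "nat \<Rightarrow> nat \<Rightarrow> vstate \<Rightarrow> vstate" where
  "ev_del v u s =
    (let f = (nbc s)(u := 0); bare = (\<forall>w. f w \<noteq> 2); a = (cls s = 3 \<and> \<not> hm s \<and> bare)
     in s\<lparr>nbc := f, cls := (if cls s = 1 \<and> bare then 2 else cls s), ann := (cls s = 1 \<and> bare),
          ask := a, apar := (if a then v else 0), aroot := (if a then v else 0), awake := True\<rparr>)"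

fun vevent ::
  "static_alg \<Rightarrow> (nat \<Rightarrow> nat) \<Rightarrow> nat \<Rightarrow> nat \<Rightarrow> event \<Rightarrow> vstate \<times> nat \<Rightarrow> vstate \<times> nat" where
  "vevent A T n v (Inserted u) (s, p) = (ev_ins u s, 11 + T n)"
| "vevent A T n v (Deleted u) (s, p) = (ev_del v u s, 11 + T n)"
| "vevent A T n v (Received ib) (s, p) =
    (let q = (if awake s then p else fst (decode (the (ib (SOME u. ib u \<noteq> None)))))
     in (vnext A T n q v s (\<lambda>u. map_option (snd \<circ> decode) (ib u)), next_pos (T n) q))"

definition vstart :: vstate where
  "vstart = fresh 2 False (\<lambda>u. 0) None"

definition vlocal :: "static_alg \<Rightarrow> (nat \<Rightarrow> nat) \<Rightarrow> nat \<Rightarrow> nat \<Rightarrow> event list \<Rightarrow> vstate \<times> nat" where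
  "vlocal A T n v evs = fold (vevent A T n v) evs (vstart, 0)"

text \<open>On two vertices a static algorithm may need no round at all, so no message is allowed there.\<close>

definition mis_alg :: "static_alg \<Rightarrow> (nat \<Rightarrow> nat) \<Rightarrow> dyn_alg" where
  "mis_alg A T =
    \<lparr>d_send = (\<lambda>n v evs u. if n \<le> 2 then None else
       (case vlocal A T n v evs of (s, p) \<Rightarrow> map_option (encode (min p 11)) (vsend A T n p v s u))),
     d_sleep = (\<lambda>n v evs. n \<le> 2 \<or> \<not> awake (fst (vlocal A T n v evs))),
     d_out = (\<lambda>n v evs. if n \<le> 2
       then \<not> (evs \<noteq> [] \<and> (\<exists>u. last evs = Inserted u \<and> u < v))
       else cls (fst (vlocal A T n v evs)) = 2 \<or> hm (fst (vlocal A T n v evs)))\<rparr>"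

section \<open>The global execution\<close>

type_synonym gstate = "nat \<Rightarrow> vstate"

definition gin :: "static_alg \<Rightarrow> (nat \<Rightarrow> nat) \<Rightarrow> nat \<Rightarrow> graph \<Rightarrow> nat \<Rightarrow> gstate \<Rightarrow> nat \<Rightarrow> pinbox" where
  "gin A T n E p \<sigma> v = (\<lambda>u. if u \<in> neighbors E v then vsend A T n p u (\<sigma> u) v else None)"

definition ground :: "static_alg \<Rightarrow> (nat \<Rightarrow> nat) \<Rightarrow> nat \<Rightarrow> graph \<Rightarrow> nat \<Rightarrow> gstate \<Rightarrow> gstate" where
  "ground A T n E p \<sigma> = (\<lambda>v. vnext A T n p v (\<sigma> v) (gin A T n E p \<sigma> v))"

text \<open>The possible states of a sleeping vertex. The coordinator survives sleep, because a
  candidate may have to wait several phases for its permission.\<close>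

definition clean :: "vstate \<Rightarrow> bool" where
  "clean s \<longleftrightarrow> s = fresh (cls s) (hm s) (nbc s) (coord s) \<and> (has_ml s \<longrightarrow> coord s = None)"

definition okay :: "vstate \<Rightarrow> bool" where
  "okay s \<longleftrightarrow> awake s \<or> clean s"

lemma fresh_sel [simp]:
  "cls (fresh k h f c) = k" "hm (fresh k h f c) = h" "nbc (fresh k h f c) = f"
  "ann (fresh k h f c) = False" "left (fresh k h f c) = False" "lroot (fresh k h f c) = 0"
  "ask (fresh k h f c) = False" "apar (fresh k h f c) = 0" "aroot (fresh k h f c) = 0"
  "pinged (fresh k h f c) = (\<lambda>u. None)" "amass (fresh k h f c) = 0" "lmass (fresh k h f c) = 0"
  "rmass (fresh k h f c) = 0" "lkids (fresh k h f c) = {}" "rkids (fresh k h f c) = {}"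
  "lthr (fresh k h f c) = 0" "athr (fresh k h f c) = 0" "conv (fresh k h f c) = False"
  "unc (fresh k h f c) = False" "cands (fresh k h f c) = {}" "coord (fresh k h f c) = c"
  "part (fresh k h f c) = False" "rnbs (fresh k h f c) = {}" "hist (fresh k h f c) = []"
  "awake (fresh k h f c) = False"
  by (simp_all add: fresh_def)

lemma clean_sel:
  assumes "clean s"
  shows "\<not> ann s" "\<not> left s" "lroot s = 0" "\<not> ask s" "apar s = 0" "aroot s = 0"
    "pinged s = (\<lambda>u. None)" "amass s = 0" "lmass s = 0" "rmass s = 0" "lkids s = {}" "rkids s = {}"
    "lthr s = 0" "athr s = 0" "\<not> conv s" "\<not> unc s" "cands s = {}" "\<not> part s" "rnbs s = {}"
    "hist s = []" "\<not> awake s" "has_ml s \<Longrightarrow> coord s = None"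
  using assms unfolding clean_def by (metis fresh_sel)+

lemma heard_None [simp]: "heard (\<lambda>u. None) k = {}"
  by (simp add: heard_def)

text \<open>A sleeping vertex observes nothing, whereas the global execution applies
  \<open>vnext\<close> everywhere in every round; this makes the two agree. From position 11 on a
  sleeping vertex is not affected even by a message.\<close>

lemma vnext_clean:
  assumes "clean s" and "p \<ge> 11 \<or> ib = (\<lambda>u. None)"
  shows "vnext A T n p v s ib = s"
proof (cases "p \<ge> 11")
  case True
  then show ?thesis using clean_sel(21)[OF assms(1)] by (simp add: vnext_def)
next
  case False
  with assms(2) have ib: "ib = (\<lambda>u. None)" by simp
  note c = clean_sel[OF assms(1)]
  from False have "p = 0 \<or> p = 1 \<or> p = 2 \<or> p = 3 \<or> p = 4 \<or> p = 5 \<or> p = 6 \<or> p = 7 \<or> p = 8 \<or> p = 9 \<or> p = 10"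
    by presburger
  then consider "p = 0" | "p = 1" | "p = 2" | "p = 3" | "p = 4" | "p = 5" | "p = 6"
    | "p = 7" | "p = 8" | "p = 9" | "p = 10" by blast
  then show ?thesis
  proof cases
    case 9
    have "step_decide s ib = fresh (cls s) (hm s) (nbc s) (coord s)"
      using c unfolding ib by (auto simp: step_decide_def decide_conv_def fresh_def)
    with 9 show ?thesis using assms(1) by (auto simp: vnext_def clean_def)
  qed (use c in \<open>auto simp: ib vnext_def step_const_def step_announce_def step_left_def
      step_reply_def total_def step_mass2_def step_class_def\<close>)
qed

lemma okay_vnext:
  assumes "okay s"
  shows "okay (vnext A T n p v s ib)"
proof (cases "awake s \<or> (p \<le> 10 \<and> (\<exists>u. ib u \<noteq> None))")
  case False
  then have "clean s" using assms by (simp add: okay_def)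
  moreover have "p \<ge> 11 \<or> ib = (\<lambda>u. None)" using False by (auto simp: fun_eq_iff simp del: not_None_eq)
  ultimately show ?thesis using vnext_clean assms by metis
next
  case True
  consider "p = 8" | "p \<le> 10" "p \<noteq> 8" | "p \<ge> 11" "p \<le> 10 + T n" | "p > 10 + T n" "p \<ge> 11" by linarith
  then show ?thesis
  proof cases
    case 1
    then show ?thesis
      by (auto simp: okay_def clean_def vnext_def step_decide_def fresh_def Let_def has_ml_def)
  next
    case 2
    then show ?thesis using True by (auto simp: okay_def vnext_def)
  next
    case 3
    then show ?thesis using True
      by (auto simp: okay_def vnext_def step_run_def Let_def)
  next
    case 4
    then show ?thesis using True
      by (auto simp: okay_def clean_def vnext_def step_exchange_def Let_def has_ml_def)
  qed
qed

fun gevent :: "update \<Rightarrow> gstate \<Rightarrow> gstate" where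
  "gevent (Ins u v) \<sigma> = (\<lambda>x. if x \<in> {u, v} then ev_ins (if x = u then v else u) (\<sigma> x) else \<sigma> x)"
| "gevent (Del u v) \<sigma> = (\<lambda>x. if x \<in> {u, v} then ev_del x (if x = u then v else u) (\<sigma> x) else \<sigma> x)"

definition gstep :: "static_alg \<Rightarrow> (nat \<Rightarrow> nat) \<Rightarrow> nat \<Rightarrow> graph \<Rightarrow> nat \<times> gstate \<Rightarrow> nat \<times> gstate" where
  "gstep A T n E x = (next_pos (T n) (fst x), ground A T n E (fst x) (snd x))"

definition grun :: "static_alg \<Rightarrow> (nat \<Rightarrow> nat) \<Rightarrow> nat \<Rightarrow> graph \<Rightarrow> nat \<Rightarrow> nat \<times> gstate \<Rightarrow> nat \<times> gstate" where
  "grun A T n E k = gstep A T n E ^^ k"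

definition gcount :: "static_alg \<Rightarrow> (nat \<Rightarrow> nat) \<Rightarrow> nat \<Rightarrow> graph \<Rightarrow> nat \<Rightarrow> gstate \<Rightarrow> nat" where
  "gcount A T n E p \<sigma> = card {(u, v). gin A T n E p \<sigma> v u \<noteq> None}"

definition gmsgs :: "static_alg \<Rightarrow> (nat \<Rightarrow> nat) \<Rightarrow> nat \<Rightarrow> graph \<Rightarrow> nat \<Rightarrow> nat \<times> gstate \<Rightarrow> nat" where
  "gmsgs A T n E K x =
     (\<Sum>k<K. gcount A T n E (fst (grun A T n E k x)) (snd (grun A T n E k x)))"

definition gfits :: "nat \<Rightarrow> nat \<Rightarrow> static_alg \<Rightarrow> (nat \<Rightarrow> nat) \<Rightarrow> nat \<Rightarrow> graph \<Rightarrow> nat \<Rightarrow> gstate \<Rightarrow> bool" where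
  "gfits q b A T n E p \<sigma> \<longleftrightarrow> (\<forall>v u i j bs. gin A T n E p \<sigma> v u = Some (i, j, bs) \<longrightarrow>
     i < n ^ q \<and> j < n ^ q \<and> real (length bs) \<le> real b * log 2 (real n))"

section \<open>Simulation of the distributed execution by the global one\<close>

definition asleep :: "gstate \<Rightarrow> bool" where
  "asleep \<sigma> \<longleftrightarrow> (\<forall>v. \<not> awake (\<sigma> v) \<and> clean (\<sigma> v))"

text \<open>The position has to be right for awake vertices only: a sleeping vertex does not notice
  the rounds, so its stored position is stale.\<close>

definition represents ::
  "static_alg \<Rightarrow> (nat \<Rightarrow> nat) \<Rightarrow> nat \<Rightarrow> config \<Rightarrow> nat \<times> gstate \<Rightarrow> bool" where
  "represents A T n C x \<longleftrightarrow>
     (\<forall>v. fst (vlocal A T n v (fst C v)) = snd x v \<and> okay (snd x v) \<and>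
          (awake (snd x v) \<longrightarrow> snd (vlocal A T n v (fst C v)) = fst x)) \<and>
     snd C = {v. awake (snd x v)}"

lemma vlocal_snoc: "vlocal A T n v (es @ [e]) = vevent A T n v e (vlocal A T n v es)"
  by (simp add: vlocal_def)

lemma d_inbox_represents:
  assumes "n > 2" "represents A T n C x"
  shows "d_inbox (mis_alg A T) n E C v u =
    map_option (encode (min (fst x) 11)) (gin A T n E (fst x) (snd x) v u)"
proof -
  obtain h W where C: "C = (h, W)" by (cases C)
  obtain p \<sigma> where x: "x = (p, \<sigma>)" by (cases x)
  show ?thesis
  proof (cases "awake (\<sigma> u)")
    case True
    then have "vlocal A T n u (h u) = (\<sigma> u, p)"
      using assms(2) unfolding represents_def C x by (simp add: prod_eq_iff)
    then show ?thesis using assms True unfolding represents_def C x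
      by (simp add: gin_def mis_alg_def)
  next
    case False
    then show ?thesis using assms unfolding represents_def C x
      by (simp add: gin_def vsend_def)
  qed
qed

lemma map_option_comp_decode:
  "(\<lambda>u. map_option (snd \<circ> decode) (map_option (encode t) (f u))) = f"
  by (rule ext) (simp add: option.map_comp comp_def option.map_ident)

lemma represents_round:
  assumes n: "n > 2" and rep: "represents A T n C x"
  shows "represents A T n (d_round (mis_alg A T) n E C) (gstep A T n E x)"
proof -
  obtain h W where C: "C = (h, W)" by (cases C)
  obtain p \<sigma> where x: "x = (p, \<sigma>)" by (cases x)
  let ?D = "mis_alg A T"
  define ib where "ib v = d_inbox ?D n E C v" for v
  define g where "g v = gin A T n E p \<sigma> v" for v
  have ib: "ib v u = map_option (encode (min p 11)) (g v u)" for v u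
    using d_inbox_represents[OF n rep] by (simp add: ib_def g_def x)
  have W: "W = {v. awake (\<sigma> v)}" and ok: "\<And>v. okay (\<sigma> v)"
    and st: "\<And>v. fst (vlocal A T n v (h v)) = \<sigma> v"
    and ps: "\<And>v. awake (\<sigma> v) \<Longrightarrow> snd (vlocal A T n v (h v)) = p"
    using rep unfolding represents_def C x by auto
  let ?P = "W \<union> {v. \<exists>u. ib v u \<noteq> None}"
  define h' where "h' v = (if v \<in> ?P then h v @ [Received (ib v)] else h v)" for v
  have round: "d_round ?D n E C = (h', {v \<in> ?P. \<not> d_sleep ?D n v (h' v)})"
    unfolding C d_round.simps observe_def Let_def h'_def ib_def by simp
  have main: "fst (vlocal A T n v (h' v)) = vnext A T n p v (\<sigma> v) (g v) \<and>
      (awake (vnext A T n p v (\<sigma> v) (g v)) \<longrightarrow> v \<in> ?P \<and> snd (vlocal A T n v (h' v)) = next_pos (T n) p)" for v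
  proof (cases "v \<in> ?P")
    case False
    then have sl: "clean (\<sigma> v)" and e: "g v = (\<lambda>u. None)"
      using ok[of v] W by (auto simp: okay_def ib fun_eq_iff)
    then show ?thesis using vnext_clean[OF sl, of p "g v"] st[of v] False clean_sel(21)[OF sl]
      by (simp add: h'_def)
  next
    case True
    obtain s q where sq: "vlocal A T n v (h v) = (s, q)" by fastforce
    have s: "s = \<sigma> v" using st[of v] sq by simp
    have dec: "(\<lambda>u. map_option (snd \<circ> decode) (ib v u)) = g v"
      unfolding ib by (rule map_option_comp_decode)
    define q' where "q' = (if awake s then q else fst (decode (the (ib v (SOME u. ib v u \<noteq> None)))))"
    have loc: "vlocal A T n v (h' v) = (vnext A T n q' v s (g v), next_pos (T n) q')"
      using True by (simp add: h'_def vlocal_snoc sq dec q'_def[symmetric])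
    show ?thesis
    proof (cases "awake s")
      case True
      then have "q' = p" using ps[of v] sq s by (simp add: q'_def)
      with loc s \<open>v \<in> ?P\<close> show ?thesis by simp
    next
      case False
      then have "\<exists>u. ib v u \<noteq> None" using True W s by simp
      then have "ib v (SOME u. ib v u \<noteq> None) \<noteq> None" by (rule someI_ex)
      \<comment> \<open>All messages of a round carry the same tag, so the choice made by
        \<open>SOME\<close> is harmless. The tag is cut off at 11 to keep its length constant;
        beyond that a woken vertex does not change its state, whatever the exact position.\<close>
      then have q': "q' = min p 11" using False by (auto simp: q'_def ib)
      have cl: "clean s" using ok[of v] False s by (simp add: okay_def)
      show ?thesis
      proof (cases "p \<ge> 11")
        case True
        then have "vnext A T n q' v s (g v) = s" "vnext A T n p v s (g v) = s"
          using vnext_clean[OF cl] q' by auto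
        then show ?thesis using loc s False by simp
      next
        case False
        then show ?thesis using loc s q' \<open>v \<in> ?P\<close> by simp
      qed
    qed
  qed
  have "{v \<in> ?P. \<not> d_sleep ?D n v (h' v)} = {v. awake (vnext A T n p v (\<sigma> v) (g v))}"
    using main n by (auto simp: mis_alg_def)
  moreover have "okay (vnext A T n p v (\<sigma> v) (g v))" for v
    using okay_vnext ok by blast
  ultimately show ?thesis
    unfolding represents_def round gstep_def ground_def x using main by (simp add: g_def)
qed

lemma represents_wakeup:
  assumes n: "n > 2" and rep: "represents A T n (h, {}) (p, \<sigma>)"
  shows "represents A T n (wakeup (mis_alg A T) n h x) (11 + T n, gevent x \<sigma>)"
proof -
  have st: "\<And>v. fst (vlocal A T n v (h v)) = \<sigma> v" and ok: "\<And>v. okay (\<sigma> v)" and sl: "\<And>v. \<not> awake (\<sigma> v)"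
    using rep unfolding represents_def by auto
  have st': "vlocal A T n v (h v) = (\<sigma> v, snd (vlocal A T n v (h v)))" for v
    using st[of v] by (simp add: prod_eq_iff)
  have ins: "vlocal A T n v (h v @ [Inserted u]) = (ev_ins u (\<sigma> v), 11 + T n)" for u v
    unfolding vlocal_snoc by (subst st') simp
  have del: "vlocal A T n v (h v @ [Deleted u]) = (ev_del v u (\<sigma> v), 11 + T n)" for u v
    unfolding vlocal_snoc by (subst st') simp
  have aw: "awake (ev_ins u s)" "awake (ev_del v u s)" for u v s
    by (simp_all add: ev_ins_def ev_del_def Let_def)
  show ?thesis
    using n st ok sl
    by (cases x) (auto simp: represents_def observe_def Let_def ins del aw okay_def mis_alg_def)
qed

lemma represents_run:
  assumes "n > 2" "represents A T n C x"
  shows "represents A T n ((d_round (mis_alg A T) n E ^^ k) C) (grun A T n E k x)"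
  using assms by (induction k) (auto simp: grun_def intro: represents_round)

lemma gstep_asleep: "asleep (snd x) \<Longrightarrow> snd (gstep A T n E x) = snd x"
proof -
  assume a: "asleep (snd x)"
  have "gin A T n E p (snd x) v = (\<lambda>u. None)" for p v
    using a by (auto simp: gin_def asleep_def vsend_def)
  then show ?thesis using a vnext_clean
    by (auto simp: gstep_def ground_def asleep_def fun_eq_iff)
qed

lemma grun_asleep: "asleep (snd x) \<Longrightarrow> snd (grun A T n E k x) = snd x"
proof (induction k)
  case (Suc k)
  then show ?case using gstep_asleep[of "grun A T n E k x"] by (simp add: grun_def)
qed (simp add: grun_def)

lemma grun_add: "grun A T n E (j + k) x = grun A T n E k (grun A T n E j x)"
  by (subst add.commute) (simp add: grun_def funpow_add)

lemma gmsgs_add: "gmsgs A T n E (j + k) x = gmsgs A T n E j x + gmsgs A T n E k (grun A T n E j x)"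
proof (induction k)
  case (Suc k)
  then show ?case by (simp add: gmsgs_def grun_add)
qed (simp add: gmsgs_def)

text \<open>The horizon \<open>K\<close> is any number of rounds after which everyone is asleep. The
  least such number may be smaller, but a sleeping configuration no longer changes, so that the
  result can be read off at \<open>K\<close> and the messages up to \<open>K\<close> are an upper
  bound.\<close>

lemma update_execution:
  assumes n: "n > 2" and rep: "represents A T n (h, {}) (p, \<sigma>)"
    and K: "asleep (snd (grun A T n E K (11 + T n, gevent x \<sigma>)))"
  defines "D \<equiv> mis_alg A T"
  shows "\<exists>k. snd (d_config D n E h x k) = {}"
    and "d_rounds D n E h x \<le> K"
    and "d_messages D n E h x \<le> gmsgs A T n E K (11 + T n, gevent x \<sigma>)"
    and "\<exists>p'. represents A T n (fst (d_config D n E h x (d_rounds D n E h x)), {})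
           (p', snd (grun A T n E K (11 + T n, gevent x \<sigma>)))"
    and "(\<forall>k<K. gfits q b A T n E (fst (grun A T n E k (11 + T n, gevent x \<sigma>)))
              (snd (grun A T n E k (11 + T n, gevent x \<sigma>)))) \<longrightarrow>
         (\<forall>k<d_rounds D n E h x. \<forall>u v m.
              d_inbox D n E (d_config D n E h x k) v u = Some m \<longrightarrow> fits (b + 4 * q + 17) n m)"
proof -
  let ?x = "(11 + T n, gevent x \<sigma>)"
  have rk: "represents A T n (d_config D n E h x k) (grun A T n E k ?x)" for k
    unfolding d_config_def D_def
    by (rule represents_run[OF n represents_wakeup[OF n rep]])
  have W: "snd (d_config D n E h x k) = {v. awake (snd (grun A T n E k ?x) v)}" for k
    using rk[of k] by (simp add: represents_def)
  have WK: "snd (d_config D n E h x K) = {}" using K W by (auto simp: asleep_def)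
  then show "\<exists>k. snd (d_config D n E h x k) = {}" by blast
  let ?r = "d_rounds D n E h x"
  show le: "?r \<le> K" unfolding d_rounds_def using WK by (rule Least_le)
  have Wr: "snd (d_config D n E h x ?r) = {}" unfolding d_rounds_def using WK by (rule LeastI)
  have ar: "asleep (snd (grun A T n E ?r ?x))"
    using Wr rk[of ?r] W[of ?r] by (auto simp: asleep_def represents_def okay_def)
  then have eq: "snd (grun A T n E K ?x) = snd (grun A T n E ?r ?x)"
    using grun_asleep[OF ar, of A T n E "K - ?r"] le by (metis grun_add le_add_diff_inverse)
  show "\<exists>p'. represents A T n (fst (d_config D n E h x ?r), {}) (p', snd (grun A T n E K ?x))"
    using rk[of ?r] Wr unfolding eq
    by (intro exI[of _ "fst (grun A T n E ?r ?x)"]) (metis prod.collapse)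
  have inb: "d_inbox D n E (d_config D n E h x k) v u =
      map_option (encode (min (fst (grun A T n E k ?x)) 11))
        (gin A T n E (fst (grun A T n E k ?x)) (snd (grun A T n E k ?x)) v u)" for k u v
    unfolding D_def by (rule d_inbox_represents[OF n rk[unfolded D_def]])
  have "d_messages D n E h x = (\<Sum>k<?r. gcount A T n E (fst (grun A T n E k ?x)) (snd (grun A T n E k ?x)))"
    unfolding d_messages_def gcount_def inb by simp
  also have "\<dots> \<le> gmsgs A T n E K ?x"
    unfolding gmsgs_def by (rule sum_mono2) (use le in auto)
  finally show "d_messages D n E h x \<le> gmsgs A T n E K ?x" .
  show "(\<forall>k<K. gfits q b A T n E (fst (grun A T n E k ?x)) (snd (grun A T n E k ?x))) \<longrightarrow>
         (\<forall>k<?r. \<forall>u v m. d_inbox D n E (d_config D n E h x k) v u = Some m \<longrightarrow> fits (b + 4 * q + 17) n m)"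
  proof (intro impI allI)
    fix k u v m
    assume f: "\<forall>k<K. gfits q b A T n E (fst (grun A T n E k ?x)) (snd (grun A T n E k ?x))"
      and k: "k < ?r" and m: "d_inbox D n E (d_config D n E h x k) v u = Some m"
    let ?p = "fst (grun A T n E k ?x)"
    from m obtain i j bs where g: "gin A T n E ?p (snd (grun A T n E k ?x)) v u = Some (i, j, bs)"
      and m: "m = encode (min ?p 11) (i, j, bs)" unfolding inb by auto
    have "i < n ^ q \<and> j < n ^ q \<and> real (length bs) \<le> real b * log 2 (real n)"
      using f g k le unfolding gfits_def by (meson less_le_trans)
    then show "fits (b + 4 * q + 17) n m" unfolding m using n by (intro fits_encode) auto
  qed
qed

section \<open>Counting lemmas\<close>

text \<open>A vertex pinged by several askers of one cluster reports its degree only to the smallest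
  of them. So the sums collected along different branches count it once.\<close>

lemma sum_min_owner:
  fixes d :: "nat \<Rightarrow> nat" and N :: "nat \<Rightarrow> nat set"
  assumes "finite R" "\<And>r. r \<in> R \<Longrightarrow> finite (N r)"
  shows "(\<Sum>r\<in>R. \<Sum>w\<in>N r. if r = Min {r' \<in> R. w \<in> N r'} then d w else 0) = (\<Sum>w\<in>(\<Union>r\<in>R. N r). d w)"
proof -
  let ?W = "\<Union>r\<in>R. N r"
  have fW: "finite ?W" using assms by auto
  have "(\<Sum>r\<in>R. \<Sum>w\<in>N r. if r = Min {r' \<in> R. w \<in> N r'} then d w else 0)
      = (\<Sum>r\<in>R. \<Sum>w\<in>?W. if w \<in> N r \<and> r = Min {r' \<in> R. w \<in> N r'} then d w else 0)"
  proof (rule sum.cong[OF refl])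
    fix r assume r: "r \<in> R"
    show "(\<Sum>w\<in>N r. if r = Min {r' \<in> R. w \<in> N r'} then d w else 0) =
      (\<Sum>w\<in>?W. if w \<in> N r \<and> r = Min {r' \<in> R. w \<in> N r'} then d w else 0)"
      by (rule sum.mono_neutral_cong_left) (use r fW in auto)
  qed
  also have "\<dots> = (\<Sum>w\<in>?W. \<Sum>r\<in>R. if w \<in> N r \<and> r = Min {r' \<in> R. w \<in> N r'} then d w else 0)"
    by (rule sum.swap)
  also have "\<dots> = (\<Sum>w\<in>?W. d w)"
  proof (rule sum.cong[OF refl])
    fix w assume "w \<in> ?W"
    then have "Min {r' \<in> R. w \<in> N r'} \<in> {r' \<in> R. w \<in> N r'}" using assms(1) by (intro Min_in) auto
    then have "(w \<in> N r \<and> r = Min {r' \<in> R. w \<in> N r'}) = (r = Min {r' \<in> R. w \<in> N r'})" for r by auto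
    moreover have "Min {r' \<in> R. w \<in> N r'} \<in> R"
      using \<open>Min {r' \<in> R. w \<in> N r'} \<in> {r' \<in> R. w \<in> N r'}\<close> by blast
    ultimately show "(\<Sum>r\<in>R. if w \<in> N r \<and> r = Min {r' \<in> R. w \<in> N r'} then d w else 0) = d w"
      using assms(1) by simp
  qed
  finally show ?thesis .
qed

section \<open>Few vertices of large degree in a cluster\<close>

lemma powr_third_cube:
  assumes "(k::nat) ^ 3 > M ^ 2" shows "real k > real M powr (2/3)"
proof (rule ccontr)
  assume "\<not> real k > real M powr (2/3)"
  then have "real k ^ 3 \<le> (real M powr (2/3)) ^ 3" by (intro power_mono) auto
  also have "\<dots> = real M ^ 2"
    by (cases "M = 0") (simp_all add: powr_power)
  finally have "real (k ^ 3) \<le> real (M ^ 2)" by simp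
  with assms show False by linarith
qed

lemma cube_le_imp_powr:
  assumes "(k::nat) ^ 3 \<le> M ^ 2" shows "real k \<le> real M powr (2/3)"
proof -
  have "real k ^ 3 \<le> real M ^ 2" using assms by (metis of_nat_le_iff of_nat_power)
  also have "\<dots> = (real M powr (2/3)) ^ 3" by (cases "M = 0") (simp_all add: powr_power)
  finally show ?thesis by (simp add: power_mono_iff)
qed

lemma card_large_le:
  fixes d :: "nat \<Rightarrow> nat"
  assumes "finite B" "(\<Sum>r\<in>B. d r) \<le> M" "\<And>r. r \<in> B \<Longrightarrow> d r ^ 3 > M ^ 2"
  shows "real (card B) \<le> real M powr (1/3)"
proof (cases "B = {}")
  case False
  then obtain r where r: "r \<in> B" by blast
  have "M > 0"
  proof (rule ccontr)
    assume "\<not> M > 0"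
    then have "d r = 0" using assms(1,2) r by (simp add: sum_eq_0_iff)
    then show False using assms(3)[OF r] by simp
  qed
  have "real (card B) * real M powr (2/3) = (\<Sum>r\<in>B. real M powr (2/3))" by simp
  also have "\<dots> \<le> (\<Sum>r\<in>B. real (d r))"
    using powr_third_cube[OF assms(3)] by (intro sum_mono) (simp add: less_imp_le)
  also have "\<dots> \<le> real M" using assms(2) by (metis of_nat_le_iff of_nat_sum)
  also have "\<dots> = real M powr (1/3) * real M powr (2/3)"
    using \<open>M > 0\<close> by (simp flip: powr_add)
  finally show ?thesis using \<open>M > 0\<close> by simp
qed simp

text \<open>The pairs \<open>(r, w)\<close> split into those with \<open>r\<close> in
  \<open>Q\<close>, those with \<open>w\<close> in \<open>Q\<close>, and the rest. The first two
  kinds are charged to degrees in \<open>Q\<close>, hence the factor 2. In the rest both degrees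
  exceed \<open>M powr (2/3)\<close> for the cluster of \<open>r\<close>, which leaves at most
  \<open>M powr (1/3)\<close> choices for either end. In the application \<open>R\<close> are the
  askers, \<open>N r\<close> their heavy neighbors, \<open>\<rho>\<close> the roots and
  \<open>Q\<close> the vertices becoming light.\<close>

lemma cluster_bound:
  fixes d M \<rho> :: "nat \<Rightarrow> nat" and N :: "nat \<Rightarrow> nat set"
  assumes R: "finite R" and N: "\<And>r. r \<in> R \<Longrightarrow> finite (N r)"
    and dR: "\<And>r. r \<in> R \<Longrightarrow> card (N r) \<le> d r"
    and dW: "\<And>w. card {r \<in> R. w \<in> N r} \<le> d w"
    and mR: "\<And>z. (\<Sum>r | r \<in> R \<and> \<rho> r = z. d r) \<le> M z"
    and mW: "\<And>z. (\<Sum>w\<in>(\<Union>r\<in>{r \<in> R. \<rho> r = z}. N r). d w) \<le> M z"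
    and Q: "finite Q"
    and cR: "\<And>r. r \<in> R \<Longrightarrow> N r \<noteq> {} \<Longrightarrow> d r ^ 3 \<le> M (\<rho> r) ^ 2 \<Longrightarrow> r \<in> Q"
    and cW: "\<And>r w. r \<in> R \<Longrightarrow> w \<in> N r \<Longrightarrow> d w ^ 3 \<le> M (\<rho> r) ^ 2 \<Longrightarrow> w \<in> Q"
  shows "real (\<Sum>r\<in>R. card (N r)) \<le> 2 * real (\<Sum>v\<in>Q. d v) + (\<Sum>z\<in>\<rho> ` R. real (M z) powr (2/3))"
proof -
  define B where "B z = {r \<in> R. \<rho> r = z \<and> d r ^ 3 > M z ^ 2}" for z
  define C where "C z = {w \<in> (\<Union>r\<in>{r \<in> R. \<rho> r = z}. N r). d w ^ 3 > M z ^ 2}" for z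
  define P1 where "P1 = (SIGMA r:R \<inter> Q. N r)"
  define P2 where "P2 = (\<lambda>(w, r). (r, w)) ` (SIGMA w:Q. {r \<in> R. w \<in> N r})"
  define P3 where "P3 = (\<Union>z\<in>\<rho> ` R. B z \<times> C z)"
  have fB: "finite (B z)" and fC: "finite (C z)" for z using R N by (auto simp: B_def C_def)
  have fin: "finite P1" "finite P2" "finite P3"
    using R N Q fB fC by (auto simp: P1_def P2_def P3_def)
  have "(SIGMA r:R. N r) \<subseteq> P1 \<union> P2 \<union> P3"
  proof (rule subrelI)
    fix r w assume rw: "(r, w) \<in> (SIGMA r:R. N r)"
    show "(r, w) \<in> P1 \<union> P2 \<union> P3"
    proof (cases "r \<in> Q \<or> w \<in> Q")
      case True
      then show ?thesis using rw by (auto simp: P1_def P2_def image_iff)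
    next
      case False
      then have "r \<in> B (\<rho> r)" "w \<in> C (\<rho> r)"
        using rw cR[of r] cW[of r w] by (auto simp: B_def C_def not_le[symmetric])
      then show ?thesis using rw by (auto simp: P3_def)
    qed
  qed
  then have "card (SIGMA r:R. N r) \<le> card (P1 \<union> P2 \<union> P3)" using fin by (intro card_mono) auto
  also have "\<dots> \<le> card P1 + card P2 + card P3"
    using card_Un_le[of "P1 \<union> P2" P3] card_Un_le[of P1 P2] by linarith
  finally have "(\<Sum>r\<in>R. card (N r)) \<le> card P1 + card P2 + card P3"
    using R N by (simp add: card_SigmaI)
  moreover have "card P1 \<le> (\<Sum>v\<in>Q. d v)"
  proof -
    have "card P1 = (\<Sum>r\<in>R \<inter> Q. card (N r))" using R N by (simp add: P1_def card_SigmaI)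
    also have "\<dots> \<le> (\<Sum>r\<in>R \<inter> Q. d r)" using dR by (intro sum_mono) auto
    also have "\<dots> \<le> (\<Sum>v\<in>Q. d v)" using Q by (intro sum_mono2) auto
    finally show ?thesis .
  qed
  moreover have "card P2 \<le> (\<Sum>v\<in>Q. d v)"
  proof -
    have "card P2 \<le> card (SIGMA w:Q. {r \<in> R. w \<in> N r})"
      unfolding P2_def using Q R by (intro card_image_le) auto
    also have "\<dots> = (\<Sum>w\<in>Q. card {r \<in> R. w \<in> N r})" using R Q by (simp add: card_SigmaI)
    also have "\<dots> \<le> (\<Sum>v\<in>Q. d v)" using dW by (intro sum_mono) auto
    finally show ?thesis .
  qed
  moreover have "real (card P3) \<le> (\<Sum>z\<in>\<rho> ` R. real (M z) powr (2/3))"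
  proof -
    have "card P3 \<le> (\<Sum>z\<in>\<rho> ` R. card (B z \<times> C z))" unfolding P3_def using R by (intro card_UN_le) auto
    then have "real (card P3) \<le> (\<Sum>z\<in>\<rho> ` R. real (card (B z)) * real (card (C z)))"
      by (simp add: card_cartesian_product flip: of_nat_mult of_nat_sum)
    also have "\<dots> \<le> (\<Sum>z\<in>\<rho> ` R. real (M z) powr (1/3) * real (M z) powr (1/3))"
    proof (intro sum_mono mult_mono)
      fix z
      have "(\<Sum>r\<in>B z. d r) \<le> (\<Sum>r | r \<in> R \<and> \<rho> r = z. d r)"
        using R by (intro sum_mono2) (auto simp: B_def)
      then show "real (card (B z)) \<le> real (M z) powr (1/3)"
        using mR[of z] fB[of z] by (intro card_large_le[where d=d]) (auto simp: B_def)
      have "(\<Sum>r\<in>C z. d r) \<le> (\<Sum>w\<in>(\<Union>r\<in>{r \<in> R. \<rho> r = z}. N r). d w)"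
        using R N by (intro sum_mono2) (auto simp: C_def)
      then show "real (card (C z)) \<le> real (M z) powr (1/3)"
        using mW[of z] fC[of z] by (intro card_large_le[where d=d]) (auto simp: C_def)
    qed auto
    also have "\<dots> = (\<Sum>z\<in>\<rho> ` R. real (M z) powr (2/3))" by (simp flip: powr_add)
    finally show ?thesis .
  qed
  ultimately show ?thesis by linarith
qed

text \<open>The cube of \<open>4 powr (2/3)\<close> is 16, less than 27.\<close>

lemma four_powr_le: "(4 * x) powr (2/3) \<le> 3 * x powr (2/3)" if "(x::real) \<ge> 0"
proof -
  have "(4::real) powr (2/3) \<le> 3"
  proof (rule ccontr)
    assume "\<not> (4::real) powr (2/3) \<le> 3"
    then have "(3::real) ^ 3 < (4 powr (2/3)) ^ 3" by (intro power_strict_mono) auto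
    then show False by (simp add: powr_power)
  qed
  then show ?thesis using that by (simp add: powr_mult mult_right_mono)
qed

text \<open>Jensen's inequality up to a factor 2. With \<open>a\<close> the average,
  \<open>x powr (2/3) \<le> (x + a) * a powr (-1/3)\<close> holds pointwise, by cases whether
  \<open>x\<close> exceeds \<open>a\<close>, and its right-hand side is linear in \<open>x\<close>.
  This turns costs in the current numbers of edges into one in the average number.\<close>

lemma sum_powr_le_avg:
  fixes f :: "nat \<Rightarrow> real"
  assumes "\<And>i. i \<le> N \<Longrightarrow> f i \<ge> 0"
  shows "(\<Sum>i\<le>N. f i powr (2/3)) \<le> 2 * real (N + 1) * ((\<Sum>i\<le>N. f i) / real (N + 1)) powr (2/3)"
proof -
  define a where "a = (\<Sum>i\<le>N. f i) / real (N + 1)"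
  have s: "(\<Sum>i\<le>N. f i) = a * real (N + 1)" by (simp add: a_def)
  have a0: "a \<ge> 0" unfolding a_def using assms by (intro divide_nonneg_nonneg sum_nonneg) auto
  show ?thesis
  proof (cases "a = 0")
    case True
    then have "\<forall>i\<le>N. f i = 0" using s assms sum_nonneg_eq_0_iff[of "{..N}" f] by auto
    then show ?thesis unfolding a_def[symmetric] True by simp
  next
    case False
    then have a: "a > 0" using a0 by simp
    have "x powr (2/3) \<le> (x + a) * a powr (-1/3)" if "x \<ge> 0" for x :: real
    proof (cases "x \<le> a")
      case True
      then have "x powr (2/3) \<le> a powr (2/3)" using that by (intro powr_mono2) auto
      also have "\<dots> = a * a powr (-1/3)" using a powr_add[of a 1 "-1/3"] by simp
      also have "\<dots> \<le> (x + a) * a powr (-1/3)" using that by (intro mult_right_mono) auto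
      finally show ?thesis .
    next
      case False
      then have "x powr (2/3) = x * x powr (-1/3)" using a powr_add[of x 1 "-1/3"] by simp
      also have "\<dots> \<le> x * a powr (-1/3)"
        using that a False by (intro mult_left_mono powr_mono2') auto
      also have "\<dots> \<le> (x + a) * a powr (-1/3)" using a by (intro mult_right_mono) auto
      finally show ?thesis .
    qed
    then have "(\<Sum>i\<le>N. f i powr (2/3)) \<le> (\<Sum>i\<le>N. (f i + a) * a powr (-1/3))"
      using assms by (intro sum_mono) auto
    also have "\<dots> = (2 * real (N + 1) * a) * a powr (-1/3)"
      by (simp add: sum_distrib_right[symmetric] sum.distrib s)
    also have "\<dots> = 2 * real (N + 1) * a powr (2/3)" using a powr_add[of a 1 "-1/3"] by simp
    finally show ?thesis unfolding a_def .
  qed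
qed

text \<open>Since the exponent -1/3 is negative, \<open>(m - 1) * m powr (-1/3)\<close> is at most
  \<open>(m - 1) powr (2/3)\<close>. It tells how far one edge moves the threshold, for insertions
  and deletions alike.\<close>

lemma powr_step:
  assumes "m \<ge> 1"
  shows "real m powr (2/3) - real (m - 1) powr (2/3) \<le> real m powr (-1/3)"
proof (cases "m = 1")
  case False
  then have m: "m \<ge> 2" using assms by simp
  have "real (m - 1) * real m powr (-1/3) \<le> real (m - 1) * real (m - 1) powr (-1/3)"
    using m by (intro mult_left_mono powr_mono2') auto
  also have "\<dots> = real (m - 1) powr (2/3)" using m powr_add[of "real (m - 1)" 1 "-1/3"] by simp
  finally have "real (m - 1) * real m powr (-1/3) \<le> real (m - 1) powr (2/3)" .
  moreover have "real m powr (2/3) = real m * real m powr (-1/3)"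
    using m powr_add[of "real m" 1 "-1/3"] by simp
  moreover have "real (m - 1) = real m - 1" using m by simp
  ultimately show ?thesis by (simp add: algebra_simps)
qed simp

text \<open>The class 1 and the position 1 should not turn into \<open>Suc 0\<close>.\<close>

declare One_nat_def [simp del]

section \<open>Exploration\<close>

text \<open>The invariants at position 0, where class changes are pending, and at position 9.\<close>

locale stateB =
  fixes V :: "nat set" and E :: graph and \<sigma> :: gstate
  assumes b_nbc: "\<And>v u. nbc (\<sigma> v) u = (if u \<in> neighbors E v
       then if ann (\<sigma> u) then if cls (\<sigma> u) = 2 then 1 else 2 else cls (\<sigma> u) else 0)"
    and b_cls: "\<And>v. cls (\<sigma> v) \<in> {1, 2, 3}"
    and b_hm3: "\<And>v. hm (\<sigma> v) \<Longrightarrow> cls (\<sigma> v) = 3"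
    and b_ask: "\<And>v. ask (\<sigma> v) \<Longrightarrow> cls (\<sigma> v) = 3 \<and> apar (\<sigma> v) = v \<and> aroot (\<sigma> v) = v"
    and b_left: "\<And>v. left (\<sigma> v) \<Longrightarrow> lroot (\<sigma> v) = v \<or> lroot (\<sigma> v) \<in> neighbors E v"
    and b_awV: "\<And>v. awake (\<sigma> v) \<Longrightarrow> v \<in> V"
    and b_ok: "\<And>v. okay (\<sigma> v)"
    and b_ml: "\<And>u v. u \<in> neighbors E v \<Longrightarrow> cls (\<sigma> u) = 2 \<Longrightarrow> cls (\<sigma> v) \<noteq> 2"
    and b_ln: "\<And>v. cls (\<sigma> v) = 1 \<Longrightarrow> coord (\<sigma> v) \<noteq> None \<or>
       (\<exists>u\<in>neighbors E v. cls (\<sigma> u) = 2 \<or> ann (\<sigma> u) \<and> cls (\<sigma> u) = 3)"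
    and b_hm: "\<And>u v. hm (\<sigma> v) \<Longrightarrow> u \<in> neighbors E v \<Longrightarrow> \<not> hm (\<sigma> u) \<and> (cls (\<sigma> u) = 2 \<longrightarrow> ann (\<sigma> u))"
    and b_h: "\<And>v. cls (\<sigma> v) = 3 \<Longrightarrow> \<not> hm (\<sigma> v) \<Longrightarrow> ask (\<sigma> v) \<or>
       (\<exists>u\<in>neighbors E v. cls (\<sigma> u) = 2 \<or> hm (\<sigma> u) \<or> left (\<sigma> u))"
    and b_co: "\<And>v c. coord (\<sigma> v) = Some c \<Longrightarrow> cls (\<sigma> v) = 1 \<and> \<not> left (\<sigma> v) \<and> c \<in> neighbors E v"
    and b_cands: "\<And>v c. coord (\<sigma> v) = Some c \<longleftrightarrow> v \<in> cands (\<sigma> c)"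
    and b_uniq: "\<And>c c'. cands (\<sigma> c) \<noteq> {} \<Longrightarrow> cands (\<sigma> c') \<noteq> {} \<Longrightarrow> c = c'"
    and b_forced: "\<And>u. ann (\<sigma> u) \<Longrightarrow> cls (\<sigma> u) = 3 \<Longrightarrow> (\<forall>c. cands (\<sigma> c) = {}) \<and>
       (\<forall>w. ann (\<sigma> w) \<and> cls (\<sigma> w) = 3 \<longrightarrow> w = u) \<and> (\<forall>w. left (\<sigma> w) \<longrightarrow> cls (\<sigma> w) = 3)"
    and b_coaw: "\<And>u v. coord (\<sigma> v) \<noteq> None \<Longrightarrow> u \<in> neighbors E v \<Longrightarrow> cls (\<sigma> u) = 2 \<Longrightarrow> \<not> ann (\<sigma> u) \<Longrightarrow>
       awake (\<sigma> v)"

locale stateA =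
  fixes V :: "nat set" and E :: graph and \<sigma> :: gstate
  assumes a_nbc: "\<And>v u. nbc (\<sigma> v) u =
       (if u \<in> neighbors E v then if ann (\<sigma> u) then 1 else cls (\<sigma> u) else 0)"
    and a_cls: "\<And>v. cls (\<sigma> v) \<in> {1, 2, 3}"
    and a_hm3: "\<And>v. hm (\<sigma> v) \<Longrightarrow> cls (\<sigma> v) = 3"
    and a_ann: "\<And>v. ann (\<sigma> v) \<Longrightarrow> cls (\<sigma> v) = 2 \<and> neighbors E v \<noteq> {} \<and> coord (\<sigma> v) = None"
    and a_awV: "\<And>v. awake (\<sigma> v) \<Longrightarrow> v \<in> V"
    and a_ok: "\<And>v. okay (\<sigma> v)"
    and a_ml: "\<And>u v. u \<in> neighbors E v \<Longrightarrow> cls (\<sigma> u) = 2 \<Longrightarrow> cls (\<sigma> v) \<noteq> 2"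
    and a_ln: "\<And>v. cls (\<sigma> v) = 1 \<Longrightarrow> coord (\<sigma> v) \<noteq> None \<or> (\<exists>u\<in>neighbors E v. cls (\<sigma> u) = 2)"
    and a_hm: "\<And>u v. hm (\<sigma> v) \<Longrightarrow> u \<in> neighbors E v \<Longrightarrow> \<not> hm (\<sigma> u) \<and> (cls (\<sigma> u) = 2 \<longrightarrow> ann (\<sigma> u))"
    and a_h: "\<And>v. cls (\<sigma> v) = 3 \<Longrightarrow> \<not> hm (\<sigma> v) \<Longrightarrow> unc (\<sigma> v) \<or> conv (\<sigma> v) \<or>
       (\<exists>u\<in>neighbors E v. cls (\<sigma> u) = 2 \<or> hm (\<sigma> u))"
    and a_unc: "\<And>v. unc (\<sigma> v) \<Longrightarrow> cls (\<sigma> v) = 3 \<and> \<not> hm (\<sigma> v) \<and> \<not> conv (\<sigma> v) \<and>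
       (\<forall>u\<in>neighbors E v. \<not> hm (\<sigma> u))"
    and a_conv: "\<And>v. conv (\<sigma> v) \<Longrightarrow> cls (\<sigma> v) = 3 \<and> neighbors E v \<noteq> {}"
    and a_idle: "\<And>v. \<not> left (\<sigma> v) \<and> \<not> ask (\<sigma> v)"
    and a_co: "\<And>v c. coord (\<sigma> v) = Some c \<Longrightarrow> cls (\<sigma> v) = 1 \<and> c \<in> neighbors E v \<and>
       (\<forall>u\<in>neighbors E v. cls (\<sigma> u) = 2 \<longrightarrow> ann (\<sigma> u))"
    and a_cands: "\<And>v c. coord (\<sigma> v) = Some c \<longleftrightarrow> v \<in> cands (\<sigma> c)"
    and a_uniq: "\<And>c c'. cands (\<sigma> c) \<noteq> {} \<Longrightarrow> cands (\<sigma> c') \<noteq> {} \<Longrightarrow> c = c'"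
    and a_awake: "\<And>v. awake (\<sigma> v) \<Longrightarrow> conv (\<sigma> v) \<or> unc (\<sigma> v) \<or> ann (\<sigma> v) \<or> cands (\<sigma> v) \<noteq> {}"
    and a_pick: "\<And>v. cands (\<sigma> v) \<noteq> {} \<Longrightarrow> \<exists>w. ann (\<sigma> w)"

section \<open>The fixed network after one update\<close>

locale net =
  fixes A :: static_alg and T :: "nat \<Rightarrow> nat" and n ce be :: nat and V :: "nat set" and E :: graph
  assumes vs: "vertex_set ce n V" and gr: "graph_on V E" and n: "n > 2" and T: "T n \<ge> 1"
    and static: "static_mis ce be A T"
begin

abbreviation N :: "nat \<Rightarrow> nat set" where "N \<equiv> neighbors E"
abbreviation d :: "nat \<Rightarrow> nat" where "d v \<equiv> card (N v)"

lemma finV: "finite V" using vs by (simp add: vertex_set_def)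

lemma N_sym: "u \<in> N v \<longleftrightarrow> v \<in> N u" by (simp add: neighbors_def insert_commute)

lemma N_irrefl: "v \<notin> N v"
proof
  assume "v \<in> N v"
  then have "card {v, v} = 2" using gr by (auto simp: neighbors_def graph_on_def)
  then show False by simp
qed

lemma N_V: "u \<in> N v \<Longrightarrow> u \<in> V" using gr by (auto simp: neighbors_def graph_on_def)

lemma N_V': "u \<in> N v \<Longrightarrow> v \<in> V" using N_V N_sym by blast

lemma finN: "finite (N v)" using N_V finV by (meson finite_subset subsetI)

lemma d_le: "d v \<le> n"
  using card_mono[OF finV, of "N v"] N_V vs by (auto simp: vertex_set_def)

text \<open>Handshake lemma, by double counting of incidences.\<close>

lemma sum_d: "(\<Sum>v\<in>V. d v) = 2 * card E"
proof -
  have fE: "finite E" using gr finV unfolding graph_on_def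
    by (meson PowI finite_Pow_iff finite_subset subsetI)
  have "card (N v) = card {e \<in> E. v \<in> e}" for v
  proof (rule bij_betw_same_card[of "\<lambda>u. {u, v}"], unfold bij_betw_def, intro conjI)
    show "inj_on (\<lambda>u. {u, v}) (N v)"
      using N_irrefl by (auto simp: inj_on_def doubleton_eq_iff)
    show "(\<lambda>u. {u, v}) ` N v = {e \<in> E. v \<in> e}"
    proof
      show "{e \<in> E. v \<in> e} \<subseteq> (\<lambda>u. {u, v}) ` N v"
      proof
        fix e assume e: "e \<in> {e \<in> E. v \<in> e}"
        then have "card e = 2" using gr by (auto simp: graph_on_def)
        then obtain x y where "e = {x, y}" "x \<noteq> y" by (auto simp: card_2_iff)
        with e show "e \<in> (\<lambda>u. {u, v}) ` N v" by (auto simp: neighbors_def insert_commute image_iff)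
      qed
    qed (auto simp: neighbors_def)
  qed
  then have "(\<Sum>v\<in>V. d v) = (\<Sum>v\<in>V. card {e \<in> E. v \<in> e})" by simp
  also have "\<dots> = (\<Sum>e\<in>E. card {v \<in> V. v \<in> e})"
  proof -
    have "(\<Sum>v\<in>V. card {e \<in> E. v \<in> e}) = (\<Sum>v\<in>V. \<Sum>e\<in>E. if v \<in> e then 1 else 0)"
      using fE by (simp add: sum.If_cases Int_def)
    also have "\<dots> = (\<Sum>e\<in>E. \<Sum>v\<in>V. if v \<in> e then 1 else 0)" by (rule sum.swap)
    finally show ?thesis using finV by (simp add: sum.If_cases Int_def)
  qed
  also have "\<dots> = (\<Sum>e\<in>E. 2)"
  proof (rule sum.cong[OF refl])
    fix e assume "e \<in> E"
    then have "{v \<in> V. v \<in> e} = e" "card e = 2" using gr by (auto simp: graph_on_def)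
    then show "card {v \<in> V. v \<in> e} = 2" by simp
  qed
  finally show ?thesis by simp
qed

lemma sum_d_le: "(\<Sum>v\<in>B. d v) \<le> 2 * card E" if "B \<subseteq> V"
  using sum_mono2[OF finV that, of d] sum_d by simp

abbreviation G :: "nat \<Rightarrow> gstate \<Rightarrow> nat \<Rightarrow> pinbox" where "G \<equiv> gin A T n E"

lemma gin_in: "G p \<sigma> v u = (if u \<in> N v then vsend A T n p u (\<sigma> u) v else None)"
  by (simp add: gin_def)

lemma gcount_le:
  assumes "finite B" "\<And>u. u \<in> B \<Longrightarrow> finite (X u)"
    and "\<And>u v. G p \<sigma> v u \<noteq> None \<Longrightarrow> u \<in> B \<and> v \<in> X u"
  shows "gcount A T n E p \<sigma> \<le> (\<Sum>u\<in>B. card (X u))"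
proof -
  have "{(u, v). G p \<sigma> v u \<noteq> None} \<subseteq> Sigma B X" using assms(3) by blast
  then have "gcount A T n E p \<sigma> \<le> card (Sigma B X)"
    unfolding gcount_def using assms(1,2) by (intro card_mono) auto
  then show ?thesis using assms(1,2) by (simp add: card_SigmaI)
qed

end

locale phaseB = net A T n ce be V E + stateB V E "S 0"
  for A T n ce be V E and S :: "nat \<Rightarrow> gstate" +
  assumes step: "\<And>k. k < 9 \<Longrightarrow> S (Suc k) = ground A T n E k (S k)"
begin

abbreviation C :: "nat \<Rightarrow> nat" where "C v \<equiv> cls (S 0 v)"

lemma step': "k < 9 \<Longrightarrow> S (Suc k) v = vnext A T n k v (S k v) (G k (S k) v)"
  using step by (simp add: ground_def)

lemma ok: "k \<le> 9 \<Longrightarrow> okay (S k v)"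
proof (induction k)
  case (Suc k)
  then show ?case using okay_vnext step'[of k v] by simp
qed (rule b_ok)

lemma flag_awake:
  assumes "k \<le> 9"
  shows "ann (S k v) \<Longrightarrow> awake (S k v)" "left (S k v) \<Longrightarrow> awake (S k v)" "ask (S k v) \<Longrightarrow> awake (S k v)"
    "pinged (S k v) u = Some z \<Longrightarrow> awake (S k v)" "cands (S k v) \<noteq> {} \<Longrightarrow> awake (S k v)"
    "rkids (S k v) \<noteq> {} \<Longrightarrow> awake (S k v)" "lkids (S k v) \<noteq> {} \<Longrightarrow> awake (S k v)"
  using ok[OF assms, of v] clean_sel[of "S k v"] by (auto simp: okay_def)

subsection \<open>Announcements\<close>

lemma in0: "G 0 (S 0) v u = (if u \<in> N v \<and> ann (S 0 u) then Some (C u, 0, []) else None)"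
proof -
  have "u \<in> N v \<Longrightarrow> nbc (S 0 u) v \<noteq> 0"
    using b_nbc[of u v] N_sym[of u v] b_cls[of v] by auto
  then show ?thesis using flag_awake(1)[of 0 u] by (auto simp: gin_in vsend_def)
qed

lemma S1: "S 1 v = (step_announce (S 0 v) (G 0 (S 0) v))\<lparr>awake := awake (S 0 v) \<or> (\<exists>u. G 0 (S 0) v u \<noteq> None)\<rparr>"
  using step'[of 0 v] by (simp add: vnext_def step_const_def One_nat_def)

lemma heard0: "heard (G 0 (S 0) v) k = {u \<in> N v. ann (S 0 u) \<and> C u = k}"
  by (auto simp: heard_def in0)

lemma nbc1': "(case G 0 (S 0) v u of None \<Rightarrow> nbc (S 0 v) u | Some x \<Rightarrow> fst x) = (if u \<in> N v then C u else 0)"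
  by (simp add: in0 b_nbc)

lemma
  shows cls1: "cls (S 1 v) = C v"
    and nbc1: "nbc (S 1 v) u = (if u \<in> N v then C u else 0)"
    and hm1: "hm (S 1 v) \<longleftrightarrow> hm (S 0 v) \<and> (\<forall>u\<in>N v. C u \<noteq> 2)"
    and left1: "left (S 1 v) \<longleftrightarrow> left (S 0 v) \<or> hm (S 0 v) \<and> (\<exists>u\<in>N v. C u = 2)"
    and lroot1: "lroot (S 1 v) = (if hm (S 0 v) \<and> (\<exists>u\<in>N v. C u = 2)
       then Min {u \<in> N v. ann (S 0 u) \<and> C u = 2} else lroot (S 0 v))"
    and coord1: "coord (S 1 v) = (if C v = 1 \<and> (\<exists>u\<in>N v. ann (S 0 u) \<and> C u = 3) \<and> (\<forall>u\<in>N v. C u \<noteq> 2)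
       then Some (Min {u \<in> N v. ann (S 0 u) \<and> C u = 3}) else coord (S 0 v))"
    and ask1: "ask (S 1 v) = ask (S 0 v)" "apar (S 1 v) = apar (S 0 v)" "aroot (S 1 v) = aroot (S 0 v)"
    and cands1: "cands (S 1 v) = cands (S 0 v)"
    and aw1: "awake (S 1 v) \<longleftrightarrow> awake (S 0 v) \<or> (\<exists>u\<in>N v. ann (S 0 u))"
proof -
  have *: "heard (G 0 (S 0) v) 2 = {} \<longleftrightarrow> (\<forall>u\<in>N v. C u \<noteq> 2)" if "hm (S 0 v)"
    using b_hm[OF that] by (auto simp: heard0)
  have 3: "heard (G 0 (S 0) v) 3 \<noteq> {} \<longleftrightarrow> (\<exists>u\<in>N v. ann (S 0 u) \<and> C u = 3)" by (auto simp: heard0)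
  have 2: "(\<forall>u. (if u \<in> N v then C u else 0) \<noteq> 2) \<longleftrightarrow> (\<forall>u\<in>N v. C u \<noteq> 2)" by auto
  show "cls (S 1 v) = C v" "ask (S 1 v) = ask (S 0 v)" "apar (S 1 v) = apar (S 0 v)"
    "aroot (S 1 v) = aroot (S 0 v)" "cands (S 1 v) = cands (S 0 v)"
    unfolding S1 by (simp_all add: step_announce_def)
  show "nbc (S 1 v) u = (if u \<in> N v then C u else 0)"
    unfolding S1 by (simp add: step_announce_def nbc1')
  show "hm (S 1 v) \<longleftrightarrow> hm (S 0 v) \<and> (\<forall>u\<in>N v. C u \<noteq> 2)"
    unfolding S1 using * by (auto simp: step_announce_def)
  show "left (S 1 v) \<longleftrightarrow> left (S 0 v) \<or> hm (S 0 v) \<and> (\<exists>u\<in>N v. C u = 2)"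
    unfolding S1 using * by (auto simp: step_announce_def)
  show "lroot (S 1 v) = (if hm (S 0 v) \<and> (\<exists>u\<in>N v. C u = 2)
       then Min {u \<in> N v. ann (S 0 u) \<and> C u = 2} else lroot (S 0 v))"
    unfolding S1 using * by (auto simp: step_announce_def heard0[symmetric])
  show "coord (S 1 v) = (if C v = 1 \<and> (\<exists>u\<in>N v. ann (S 0 u) \<and> C u = 3) \<and> (\<forall>u\<in>N v. C u \<noteq> 2)
       then Some (Min {u \<in> N v. ann (S 0 u) \<and> C u = 3}) else coord (S 0 v))"
    unfolding S1 using 3 2 by (auto simp: step_announce_def nbc1' heard0[symmetric])
  show "awake (S 1 v) \<longleftrightarrow> awake (S 0 v) \<or> (\<exists>u\<in>N v. ann (S 0 u))"
    unfolding S1 by (auto simp: in0)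
qed

lemma ml1: "has_ml (S 1 v) \<longleftrightarrow> (\<exists>u\<in>N v. C u = 2)"
  by (auto simp: has_ml_def nbc1)

definition X where "X = {v. left (S 1 v)}"

lemma X_lroot: "x \<in> X \<Longrightarrow> lroot (S 1 x) = x \<or> lroot (S 1 x) \<in> N x"
proof -
  assume x: "x \<in> X"
  have "Min {u \<in> N x. ann (S 0 u) \<and> C u = 2} \<in> N x" if "hm (S 0 x)" "\<exists>u\<in>N x. C u = 2"
  proof -
    have "Min {u \<in> N x. ann (S 0 u) \<and> C u = 2} \<in> {u \<in> N x. ann (S 0 u) \<and> C u = 2}"
      using b_hm[OF that(1)] that(2) finN by (intro Min_in) auto
    then show ?thesis by blast
  qed
  then show ?thesis using x b_left[of x] by (auto simp: X_def left1 lroot1)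
qed

text \<open>The possible roots of departed vertices are known before the exploration: an evicted
  heavy vertex adopts an announcing neighbor, all others have fixed their root earlier. This lets
  the potential set aside an amount per root.\<close>

lemma X_roots: "x \<in> X \<Longrightarrow> lroot (S 1 x) \<in> {v. ann (S 0 v) \<and> C v = 2} \<union> (\<lambda>v. lroot (S 0 v)) ` {v. left (S 0 v)}"
proof -
  assume x: "x \<in> X"
  have "Min {u \<in> N x. ann (S 0 u) \<and> C u = 2} \<in> {v. ann (S 0 v) \<and> C v = 2}"
    if "hm (S 0 x)" "\<exists>u\<in>N x. C u = 2"
  proof -
    have "Min {u \<in> N x. ann (S 0 u) \<and> C u = 2} \<in> {u \<in> N x. ann (S 0 u) \<and> C u = 2}"
      using b_hm[OF that(1)] that(2) finN by (intro Min_in) auto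
    then show ?thesis by blast
  qed
  then show ?thesis using x by (auto simp: X_def left1 lroot1)
qed

text \<open>At position 1 a vertex has one message per neighbor, so it must not depart and be a
  candidate at once. It could become a new candidate only through a forced departure, and
  \<open>b_forced\<close> then confines departures to class 3.\<close>

lemma X_coord: "x \<in> X \<Longrightarrow> coord (S 1 x) = None"
proof (rule ccontr)
  assume x: "x \<in> X" and co: "coord (S 1 x) \<noteq> None"
  show False
  proof (cases "C x = 1 \<and> (\<exists>u\<in>N x. ann (S 0 u) \<and> C u = 3) \<and> (\<forall>u\<in>N x. C u \<noteq> 2)")
    case True
    then show ?thesis using x b_forced b_hm3[of x] by (auto simp: X_def left1)
  next
    case False
    with co obtain c where "coord (S 0 x) = Some c" by (auto simp: coord1)
    then show ?thesis using b_co[of x c] x b_hm3[of x] by (auto simp: X_def left1)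
  qed
qed

lemma coord1_co: "coord (S 1 v) = Some c \<Longrightarrow> C v = 1 \<and> c \<in> N v"
proof -
  assume a: "coord (S 1 v) = Some c"
  show ?thesis
  proof (cases "C v = 1 \<and> (\<exists>u\<in>N v. ann (S 0 u) \<and> C u = 3) \<and> (\<forall>u\<in>N v. C u \<noteq> 2)")
    case True
    then have "Min {u \<in> N v. ann (S 0 u) \<and> C u = 3} \<in> {u \<in> N v. ann (S 0 u) \<and> C u = 3}"
      using finN by (intro Min_in) auto
    then show ?thesis using True a by (auto simp: coord1)
  next
    case False
    then have "coord (S 0 v) = Some c" using a by (simp only: coord1 if_False)
    then show ?thesis using b_co by blast
  qed
qed

lemma finX: "finite X" and XV: "X \<subseteq> V"
proof -
  have "v \<in> V" if "left (S 1 v)" for v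
    using flag_awake(2)[of 1 v] that aw1[of v] b_awV N_V' by auto
  then show "X \<subseteq> V" by (auto simp: X_def)
  then show "finite X" using finV finite_subset by blast
qed

subsection \<open>Departures and candidates\<close>

lemma in1: "G 1 (S 1) v u = (if u \<in> N v then
    if awake (S 1 u) \<and> coord (S 1 u) = Some v then Some (if has_ml (S 1 u) then 2 else 1, 0, [])
    else if u \<in> X \<and> C v = 3 then Some (0, lroot (S 1 u), []) else None else None)"
  using flag_awake(2)[of 1 u] N_sym[of u v] X_coord[of u]
  by (auto simp: gin_in vsend_def X_def nbc1)

lemma S2: "S 2 v = (step_left (S 1 v) (G 1 (S 1) v))\<lparr>awake := awake (S 1 v) \<or> (\<exists>u. G 1 (S 1) v u \<noteq> None)\<rparr>"
  using step'[of 1 v] by (simp add: vnext_def step_const_def numeral_2_eq_2)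

lemma heard1: "C v = 3 \<Longrightarrow> heard (G 1 (S 1) v) 0 = {u \<in> N v. u \<in> X}"
  using X_coord by (auto simp: heard_def in1 split: if_splits)

definition R where "R = {v. ask (S 2 v)}"

lemma
  shows cls2: "cls (S 2 v) = C v" and hm2: "hm (S 2 v) = hm (S 1 v)"
    and nbc2: "nbc (S 2 v) = nbc (S 1 v)"
    and left2: "left (S 2 v) = left (S 1 v)" "lroot (S 2 v) = lroot (S 1 v)"
    and coord2: "coord (S 2 v) = (if \<exists>u\<in>N v. C u = 2 then None else coord (S 1 v))"
  unfolding S2 by (simp_all add: step_left_def Let_def cls1 ml1)

lemma R_iff: "v \<in> R \<longleftrightarrow> ask (S 0 v) \<or> C v = 3 \<and> (\<exists>u\<in>N v. u \<in> X)"
  using heard1[of v] unfolding R_def mem_Collect_eq S2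
  by (auto simp: step_left_def Let_def cls1 ask1)

text \<open>Clusters are trees: a root, departed vertices next to it, askers next to these, and the
  pinged neighbors as third hop. A vertex asking because of a deletion is its own parent and
  root.\<close>

lemma R_par: "v \<in> R \<Longrightarrow> apar (S 2 v) = v \<and> aroot (S 2 v) = v \<and> ask (S 0 v) \<or>
   apar (S 2 v) \<in> N v \<and> apar (S 2 v) \<in> X \<and> aroot (S 2 v) = lroot (S 1 (apar (S 2 v)))"
proof -
  assume v: "v \<in> R"
  show ?thesis
  proof (cases "C v = 3 \<and> (\<exists>u\<in>N v. u \<in> X)")
    case True
    let ?x = "Min {u \<in> N v. u \<in> X}"
    have x: "?x \<in> {u \<in> N v. u \<in> X}" using True finN by (intro Min_in) auto
    have "apar (S 2 v) = ?x" "aroot (S 2 v) = lroot (S 1 ?x)"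
      using True x X_coord[of ?x] heard1[of v]
      by (auto simp: S2 step_left_def Let_def cls1 in1)
    with x show ?thesis by auto
  next
    case False
    then have a: "ask (S 0 v)" using v R_iff by blast
    have "heard (G 1 (S 1) v) 0 = {} \<or> C v \<noteq> 3" using False heard1[of v] by auto
    then have "apar (S 2 v) = apar (S 0 v)" "aroot (S 2 v) = aroot (S 0 v)"
      unfolding S2 by (auto simp: step_left_def Let_def cls1 ask1)
    then show ?thesis using a b_ask[of v] by simp
  qed
qed

lemma R3: "v \<in> R \<Longrightarrow> C v = 3"
  using R_iff b_ask by blast

lemma RV: "R \<subseteq> V"
proof
  fix v assume "v \<in> R"
  then show "v \<in> V" using R_iff[of v] flag_awake(3)[of 0 v] b_awV N_V' by auto
qed

lemma finR: "finite R" using RV finV finite_subset by blast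

text \<open>New candidates appear only after a forced departure, when by \<open>b_forced\<close> no
  old ones are left. An old candidate that is covered again is awake, by an announcement or by
  \<open>b_coaw\<close>, and therefore able to retract.\<close>

lemma cands2: "v \<in> cands (S 2 c) \<longleftrightarrow> coord (S 2 v) = Some c"
proof -
  have h1: "v \<in> heard (G 1 (S 1) c) 1 \<longleftrightarrow> v \<in> N c \<and> awake (S 1 v) \<and> coord (S 1 v) = Some c \<and> \<not> has_ml (S 1 v)"
    by (auto simp: heard_def in1 split: if_splits)
  have h2: "v \<in> heard (G 1 (S 1) c) 2 \<longleftrightarrow> v \<in> N c \<and> awake (S 1 v) \<and> coord (S 1 v) = Some c \<and> has_ml (S 1 v)"
    by (auto simp: heard_def in1 split: if_splits)
  have c2: "cands (S 2 c) = cands (S 0 c) \<union> heard (G 1 (S 1) c) 1 - heard (G 1 (S 1) c) 2"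
    unfolding S2 by (simp add: step_left_def Let_def cands1)
  let ?new = "C v = 1 \<and> (\<exists>u\<in>N v. ann (S 0 u) \<and> C u = 3) \<and> (\<forall>u\<in>N v. C u \<noteq> 2)"
  show ?thesis
  proof (cases ?new)
    case True
    then have "\<forall>c. cands (S 0 c) = {}" using b_forced by blast
    moreover have "awake (S 1 v)" "\<not> has_ml (S 1 v)" using True by (auto simp: aw1 ml1)
    ultimately show ?thesis using True coord1_co[of v c] N_sym[of v c] unfolding c2
      by (auto simp: h1 h2 coord2)
  next
    case False
    then have co: "coord (S 1 v) = coord (S 0 v)" by (simp only: coord1 if_False)
    show ?thesis
    proof (cases "\<exists>u\<in>N v. C u = 2")
      case True
      have "awake (S 1 v)" if "coord (S 0 v) = Some c"
        using True b_coaw[of v] that by (auto simp: aw1)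
      then show ?thesis using True b_cands[of v c] coord1_co[of v c] N_sym[of v c] unfolding c2
        by (auto simp: h1 h2 coord2 ml1 co)
    next
      case no: False
      then show ?thesis using b_cands[of v c] coord1_co[of v c] N_sym[of v c] unfolding c2
        by (auto simp: h1 h2 coord2 ml1 co)
    qed
  qed
qed

lemma coord2_co: "coord (S 2 v) = Some c \<Longrightarrow> C v = 1 \<and> c \<in> N v \<and> (\<forall>u\<in>N v. C u \<noteq> 2)"
  using coord1_co[of v c] by (auto simp: coord2 split: if_splits)

lemma cands2_uniq: "v \<in> cands (S 2 c) \<Longrightarrow> v' \<in> cands (S 2 c') \<Longrightarrow> c = c'"
proof -
  assume a: "v \<in> cands (S 2 c)" "v' \<in> cands (S 2 c')"
  have co: "coord (S 1 v) = Some c" "coord (S 1 v') = Some c'"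
    using a unfolding cands2 by (auto simp: coord2 split: if_splits)
  let ?new = "\<lambda>v. C v = 1 \<and> (\<exists>u\<in>N v. ann (S 0 u) \<and> C u = 3) \<and> (\<forall>u\<in>N v. C u \<noteq> 2)"
  have new: "ann (S 0 c) \<and> C c = 3" if "?new v" "coord (S 1 v) = Some c" for v c
  proof -
    have "Min {u \<in> N v. ann (S 0 u) \<and> C u = 3} \<in> {u \<in> N v. ann (S 0 u) \<and> C u = 3}"
      using finN that(1) by (intro Min_in) auto
    then show ?thesis using that by (auto simp: coord1)
  qed
  have old: "v \<in> cands (S 0 c)" if "\<not> ?new v" "coord (S 1 v) = Some c" for v c
    using that unfolding b_cands[symmetric] by (simp only: coord1 if_False)
  show ?thesis
    using new[of v c] new[of v' c'] old[of v c] old[of v' c'] co b_forced b_uniq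
    by (metis emptyE)
qed

end

lemma vnext_mid:
  assumes "p = 2 \<or> p = 3 \<or> p = 4 \<or> p = 5 \<or> p = 6 \<or> p = 7"
  shows "cls (vnext A T n p v s ib) = cls s \<and> hm (vnext A T n p v s ib) = hm s \<and>
    nbc (vnext A T n p v s ib) = nbc s \<and> left (vnext A T n p v s ib) = left s \<and>
    lroot (vnext A T n p v s ib) = lroot s \<and> ask (vnext A T n p v s ib) = ask s \<and>
    apar (vnext A T n p v s ib) = apar s \<and> aroot (vnext A T n p v s ib) = aroot s \<and>
    cands (vnext A T n p v s ib) = cands s \<and> coord (vnext A T n p v s ib) = coord s"
  using assms by (elim disjE) (simp_all add: vnext_def step_const_def step_reply_def step_mass2_def)

context phaseB
begin

subsection \<open>Pings, masses and thresholds\<close>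

lemma mid: "2 \<le> k \<Longrightarrow> k \<le> 8 \<Longrightarrow> cls (S k v) = C v \<and> hm (S k v) = hm (S 1 v) \<and> nbc (S k v) = nbc (S 1 v) \<and>
    left (S k v) = left (S 1 v) \<and> lroot (S k v) = lroot (S 1 v) \<and> ask (S k v) = ask (S 2 v) \<and>
    apar (S k v) = apar (S 2 v) \<and> aroot (S k v) = aroot (S 2 v) \<and> cands (S k v) = cands (S 2 v) \<and>
    coord (S k v) = coord (S 2 v)"
proof (induction k rule: dec_induct)
  case base
  show ?case by (simp add: cls2 hm2 nbc2 left2)
next
  case (step k)
  then have k: "k = 2 \<or> k = 3 \<or> k = 4 \<or> k = 5 \<or> k = 6 \<or> k = 7" by presburger
  have "S (Suc k) v = vnext A T n k v (S k v) (G k (S k) v)" using step' step by simp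
  then show ?case using vnext_mid[OF k, of A T n v "S k v" "G k (S k) v"] step by simp
qed

abbreviation ml :: "nat \<Rightarrow> bool" where "ml v \<equiv> \<exists>u\<in>N v. C u = 2"
definition NH where "NH v = {u \<in> N v. C u = 3}"
definition Rz where "Rz z = {r \<in> R. aroot (S 2 r) = z}"

lemma finNH: "finite (NH v)" using finN by (simp add: NH_def)

lemma has_ml_mid: "1 \<le> k \<Longrightarrow> k \<le> 8 \<Longrightarrow> has_ml (S k v) \<longleftrightarrow> ml v"
  using mid[of k v] ml1[of v] by (cases "k = 1") (auto simp: has_ml_def)

lemma deg_mid: "1 \<le> k \<Longrightarrow> k \<le> 8 \<Longrightarrow> deg (S k v) = d v"
proof -
  assume "1 \<le> k" "k \<le> 8"
  then have "nbc (S k v) = nbc (S 1 v)" using mid[of k v] by (cases "k = 1") auto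
  moreover have "C u \<noteq> 0" for u using b_cls[of u] by auto
  then have "{u. nbc (S 1 v) u \<noteq> 0} = N v" by (auto simp: nbc1)
  ultimately show ?thesis by (simp add: deg_def)
qed

lemma in2: "G 2 (S 2) w r = (if r \<in> R \<and> w \<in> NH r then Some (aroot (S 2 r), 0, []) else None)"
  using flag_awake(3)[of 2 r] N_sym[of r w]
  by (auto simp: gin_in vsend_def R_def nbc2 nbc1 NH_def)

lemma pinged3: "pinged (S 3 w) r = (if r \<in> R \<and> w \<in> NH r then Some (aroot (S 2 r)) else None)"
  using step'[of 2 w] by (simp add: vnext_def step_const_def in2)

lemma in3: "G 3 (S 3) r w = (if r \<in> R \<and> w \<in> NH r then Some (if hm (S 1 w) then 1 else 0,
    if r = Min {r' \<in> Rz (aroot (S 2 r)). w \<in> NH r'} then d w else 0, []) else None)"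
proof -
  have P: "{w'. pinged (S 3 w) w' = Some z} = {r' \<in> Rz z. w \<in> NH r'}" for z
    by (auto simp: pinged3 Rz_def)
  show ?thesis
  proof (cases "r \<in> R \<and> w \<in> NH r")
    case True
    then have p: "pinged (S 3 w) r = Some (aroot (S 2 r))" by (simp add: pinged3)
    have "r \<notin> N w \<longleftrightarrow> False" using True N_sym[of r w] by (auto simp: NH_def)
    moreover have "awake (S 3 w)" using flag_awake(4)[OF _ p] by simp
    moreover have "w \<in> N r" using True by (simp add: NH_def)
    moreover have "hm (S 3 w) = hm (S 1 w)" using mid[of 3 w] by simp
    ultimately show ?thesis using True deg_mid[of 3 w] by (simp add: gin_in vsend_def p P)
  next
    case False
    then have "pinged (S 3 w) r = None" by (simp add: pinged3)
    then show ?thesis unfolding gin_in vsend_def using False by auto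
  qed
qed

lemma S4: "S 4 v = (step_reply (S 3 v) (G 3 (S 3) v))\<lparr>awake := awake (S 3 v) \<or> (\<exists>u. G 3 (S 3) v u \<noteq> None)\<rparr>"
  using step'[of 3 v] by (simp add: vnext_def step_const_def)

lemma amass4: "r \<in> R \<Longrightarrow> amass (S 4 r) =
    d r + (\<Sum>w\<in>NH r. if r = Min {r' \<in> Rz (aroot (S 2 r)). w \<in> NH r'} then d w else 0)"
proof -
  assume r: "r \<in> R"
  have "{u. G 3 (S 3) r u \<noteq> None} = NH r" using r by (auto simp: in3)
  moreover have "(\<Sum>w\<in>NH r. fst (snd (the (G 3 (S 3) r w)))) =
      (\<Sum>w\<in>NH r. if r = Min {r' \<in> Rz (aroot (S 2 r)). w \<in> NH r'} then d w else 0)"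
    using r by (intro sum.cong) (auto simp: in3)
  moreover have "ask (S 3 r)" using mid[of 3 r] r by (simp add: R_def)
  ultimately show ?thesis unfolding S4 using deg_mid[of 3 r] by (simp add: step_reply_def)
qed

lemma unc4: "unc (S 4 r) \<longleftrightarrow> r \<in> R \<and> \<not> hm (S 1 r) \<and> \<not> ml r \<and> (\<forall>w\<in>N r. \<not> hm (S 1 w))"
proof -
  have "hm (S 1 w) \<Longrightarrow> C w = 3" for w using hm1 b_hm3 by blast
  then have "r \<in> R \<Longrightarrow> heard (G 3 (S 3) r) 1 = {} \<longleftrightarrow> (\<forall>w\<in>N r. \<not> hm (S 1 w))"
    by (auto simp: heard_def in3 NH_def split: if_splits)
  moreover have "ask (S 3 r) \<longleftrightarrow> r \<in> R" "hm (S 3 r) = hm (S 1 r)"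
    using mid[of 3 r] by (auto simp: R_def)
  ultimately show ?thesis unfolding S4 using has_ml_mid[of 3 r] by (auto simp: step_reply_def)
qed

lemma in4: "G 4 (S 4) x r = (if r \<in> R \<and> apar (S 2 r) \<noteq> r \<and> apar (S 2 r) = x
    then Some (amass (S 4 r), 0, []) else None)"
  using mid[of 4 r] flag_awake(3)[of 4 r] R_par[of r] N_sym[of r x]
  by (auto simp: gin_in vsend_def R_def)

definition kids where "kids x = {r \<in> R. apar (S 2 r) \<noteq> r \<and> apar (S 2 r) = x}"

lemma S5: "lkids (S 5 x) = kids x" "lmass (S 5 x) = (\<Sum>r\<in>kids x. amass (S 4 r))"
  "amass (S 5 x) = amass (S 4 x)" "unc (S 5 x) = unc (S 4 x)"
proof -
  have s: "S 5 x = (S 4 x)\<lparr>lkids := {u. G 4 (S 4) x u \<noteq> None}, lmass := total (G 4 (S 4) x),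
      awake := awake (S 4 x) \<or> (\<exists>u. G 4 (S 4) x u \<noteq> None)\<rparr>"
    using step'[of 4 x] by (simp add: vnext_def step_const_def)
  have k: "{u. G 4 (S 4) x u \<noteq> None} = kids x" by (auto simp: in4 kids_def)
  show "lkids (S 5 x) = kids x" "amass (S 5 x) = amass (S 4 x)" "unc (S 5 x) = unc (S 4 x)"
    unfolding s using k by simp_all
  have "total (G 4 (S 4) x) = (\<Sum>r\<in>kids x. amass (S 4 r))"
    unfolding total_def k by (rule sum.cong) (auto simp: in4 kids_def)
  then show "lmass (S 5 x) = (\<Sum>r\<in>kids x. amass (S 4 r))" unfolding s by simp
qed

lemma in5: "G 5 (S 5) z x = (if x \<in> X \<and> lroot (S 1 x) \<noteq> x \<and> lroot (S 1 x) = z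
    then Some (lmass (S 5 x), 0, []) else None)"
  using mid[of 5 x] flag_awake(2)[of 5 x] X_lroot[of x] N_sym[of x z]
  by (auto simp: gin_in vsend_def X_def)

definition M where "M z = (\<Sum>r\<in>Rz z. amass (S 4 r))"

lemma S6: "rkids (S 6 z) = {x \<in> X. lroot (S 1 x) \<noteq> x \<and> lroot (S 1 x) = z}" "rmass (S 6 z) = M z"
  "lkids (S 6 z) = kids z" "unc (S 6 z) = unc (S 4 z)"
proof -
  have s: "S 6 z = (step_mass2 z (S 5 z) (G 5 (S 5) z))\<lparr>awake := awake (S 5 z) \<or> (\<exists>u. G 5 (S 5) z u \<noteq> None)\<rparr>"
    using step'[of 5 z] by (simp add: vnext_def step_const_def)
  let ?X = "{x \<in> X. lroot (S 1 x) \<noteq> x \<and> lroot (S 1 x) = z}"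
  have k: "{u. G 5 (S 5) z u \<noteq> None} = ?X" by (auto simp: in5)
  show "rkids (S 6 z) = ?X" "lkids (S 6 z) = kids z" "unc (S 6 z) = unc (S 4 z)"
    unfolding s using k S5 by (simp_all add: step_mass2_def)
  have t: "total (G 5 (S 5) z) = (\<Sum>x\<in>?X. lmass (S 5 x))"
    unfolding total_def k by (rule sum.cong) (auto simp: in5)
  let ?Xz = "{x \<in> X. lroot (S 1 x) = z}"
  \<comment> \<open>No vertex sends a message to itself: if the root has itself departed, its share
    enters \<open>rmass\<close> locally. The same holds below for a root that asks on its own
    account.\<close>
  have "(\<Sum>x\<in>?Xz. lmass (S 5 x)) = (\<Sum>x\<in>?X. lmass (S 5 x)) + (if z \<in> X \<and> lroot (S 1 z) = z then lmass (S 5 z) else 0)"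
  proof (cases "z \<in> X \<and> lroot (S 1 z) = z")
    case True
    then have "?Xz = insert z ?X" "z \<notin> ?X" by auto
    then show ?thesis using True finX by simp
  next
    case False
    then have "?Xz = ?X" by auto
    then show ?thesis using False by auto
  qed
  moreover have "left (S 5 z) \<and> lroot (S 5 z) = z \<longleftrightarrow> z \<in> X \<and> lroot (S 1 z) = z"
    "ask (S 5 z) \<and> apar (S 5 z) = z \<longleftrightarrow> z \<in> R \<and> apar (S 2 z) = z"
    using mid[of 5 z] by (auto simp: X_def R_def)
  ultimately have rm: "rmass (S 6 z) = (\<Sum>x\<in>?Xz. lmass (S 5 x)) +
      (if z \<in> R \<and> apar (S 2 z) = z then amass (S 4 z) else 0)"
    unfolding s using t S5(3) by (simp add: step_mass2_def)
  let ?Rx = "{r \<in> Rz z. apar (S 2 r) \<noteq> r}"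
  have "(\<Sum>x\<in>?Xz. lmass (S 5 x)) = (\<Sum>x\<in>?Xz. \<Sum>r\<in>{r \<in> ?Rx. apar (S 2 r) = x}. amass (S 4 r))"
  proof (rule sum.cong[OF refl])
    fix x assume x: "x \<in> ?Xz"
    have "kids x = {r \<in> ?Rx. apar (S 2 r) = x}"
      using x R_par by (auto simp: kids_def Rz_def)
    then show "lmass (S 5 x) = (\<Sum>r\<in>{r \<in> ?Rx. apar (S 2 r) = x}. amass (S 4 r))" using S5(2) by simp
  qed
  also have "\<dots> = (\<Sum>r\<in>?Rx. amass (S 4 r))"
  proof (rule sum.group)
    show "(\<lambda>r. apar (S 2 r)) ` ?Rx \<subseteq> ?Xz"
    proof (rule image_subsetI)
      fix r assume "r \<in> ?Rx"
      then show "apar (S 2 r) \<in> ?Xz" using R_par[of r] by (auto simp: Rz_def)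
    qed
  qed (use finR finX in \<open>auto simp: Rz_def\<close>)
  finally have e: "(\<Sum>x\<in>?Xz. lmass (S 5 x)) = (\<Sum>r\<in>?Rx. amass (S 4 r))" .
  have "M z = (\<Sum>r\<in>?Rx. amass (S 4 r)) + (\<Sum>r\<in>{r \<in> Rz z. apar (S 2 r) = r}. amass (S 4 r))"
    unfolding M_def using finR
    by (subst sum.union_disjoint[symmetric]) (auto intro!: sum.cong simp: Rz_def)
  moreover have "aroot (S 2 r) = r" if "r \<in> R" "apar (S 2 r) = r" for r
    using R_par[of r] N_irrefl[of r] that by auto
  then have "{r \<in> Rz z. apar (S 2 r) = r} = (if z \<in> R \<and> apar (S 2 z) = z then {z} else {})"
    by (auto simp: Rz_def)
  ultimately show "rmass (S 6 z) = M z" using rm e by auto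
qed

lemma in6: "x \<in> X \<Longrightarrow> lroot (S 1 x) \<noteq> x \<Longrightarrow> G 6 (S 6) x (lroot (S 1 x)) = Some (M (lroot (S 1 x)), 0, [])"
proof -
  assume x: "x \<in> X" "lroot (S 1 x) \<noteq> x"
  then have "x \<in> rkids (S 6 (lroot (S 1 x)))" by (simp add: S6)
  moreover from this have "awake (S 6 (lroot (S 1 x)))" by (intro flag_awake(6)) auto
  ultimately show ?thesis using x X_lroot[of x] S6 by (auto simp: gin_in vsend_def)
qed

lemma S7: "x \<in> X \<Longrightarrow> lthr (S 7 x) = M (lroot (S 1 x))"
  "lkids (S 7 x) = kids x" "rmass (S 7 x) = M x" "unc (S 7 x) = unc (S 4 x)"
proof -
  have s: "S 7 x = (S 6 x)\<lparr>lthr := (if left (S 6 x) then if lroot (S 6 x) = x then rmass (S 6 x)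
      else fst (the (G 6 (S 6) x (lroot (S 6 x)))) else 0),
      awake := awake (S 6 x) \<or> (\<exists>u. G 6 (S 6) x u \<noteq> None)\<rparr>"
    using step'[of 6 x] by (simp add: vnext_def step_const_def)
  show "lkids (S 7 x) = kids x" "rmass (S 7 x) = M x" "unc (S 7 x) = unc (S 4 x)"
    unfolding s by (simp_all add: S6)
  show "x \<in> X \<Longrightarrow> lthr (S 7 x) = M (lroot (S 1 x))"
    unfolding s using mid[of 6 x] in6[of x] by (auto simp: X_def S6)
qed

lemma in7: "r \<in> R \<Longrightarrow> apar (S 2 r) \<noteq> r \<Longrightarrow> G 7 (S 7) r (apar (S 2 r)) = Some (M (aroot (S 2 r)), 0, [])"
proof -
  assume r: "r \<in> R" "apar (S 2 r) \<noteq> r"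
  then have "r \<in> lkids (S 7 (apar (S 2 r)))" by (simp add: S7 kids_def)
  moreover from this have "awake (S 7 (apar (S 2 r)))" by (intro flag_awake(7)) auto
  ultimately show ?thesis using r R_par[of r] S7(1)[of "apar (S 2 r)"] by (auto simp: gin_in vsend_def)
qed

lemma S8: "r \<in> R \<Longrightarrow> athr (S 8 r) = M (aroot (S 2 r))" "unc (S 8 r) = unc (S 4 r)"
proof -
  have s: "S 8 r = (S 7 r)\<lparr>athr := (if ask (S 7 r) then if apar (S 7 r) = r then rmass (S 7 r)
      else fst (the (G 7 (S 7) r (apar (S 7 r)))) else 0),
      awake := awake (S 7 r) \<or> (\<exists>u. G 7 (S 7) r u \<noteq> None)\<rparr>"
    using step'[of 7 r] by (simp add: vnext_def step_const_def)
  show "unc (S 8 r) = unc (S 4 r)" unfolding s by (simp add: S7)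
  show "r \<in> R \<Longrightarrow> athr (S 8 r) = M (aroot (S 2 r))"
    unfolding s using mid[of 7 r] in7[of r] R_par[of r] N_irrefl[of r] by (auto simp: R_def S7)
qed

subsection \<open>Decisions\<close>

definition picked where "picked v \<longleftrightarrow> (\<exists>u. cands (S 2 u) \<noteq> {} \<and> v = Min (cands (S 2 u)))"

lemma fin_cands: "finite (cands (S 2 u))"
proof (rule finite_subset[OF _ finN])
  show "cands (S 2 u) \<subseteq> N u" using cands2 coord2_co N_sym by blast
qed

lemma picked_cand: "cands (S 2 u) \<noteq> {} \<Longrightarrow> Min (cands (S 2 u)) \<in> cands (S 2 u)"
  using fin_cands by (rule Min_in)

lemma in8: "G 8 (S 8) v u = (if u \<in> R \<and> v \<in> NH u then Some (M (aroot (S 2 u)), 0, [])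
    else if cands (S 2 u) \<noteq> {} \<and> v = Min (cands (S 2 u)) then Some (0, 0, [True]) else None)"
proof -
  have "u \<in> R \<Longrightarrow> awake (S 8 u)" using flag_awake(3)[of 8 u] mid[of 8 u] by (simp add: R_def)
  moreover have "cands (S 2 u) \<noteq> {} \<Longrightarrow> awake (S 8 u) \<and> (v = Min (cands (S 2 u)) \<longrightarrow> u \<in> N v)"
    using flag_awake(5)[of 8 u] mid[of 8 u] picked_cand[of u] cands2[of v u] coord2_co[of v u] by auto
  ultimately show ?thesis
    using mid[of 8 u] N_sym[of u v] S8(1)[of u]
    by (auto simp: gin_in vsend_def R_def NH_def nbc1)
qed

text \<open>A coordinator that is also an asker sends permissions and thresholds in the same round,
  but never both to one neighbor: candidates have class 1, thresholds go to class 3.\<close>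

lemma picked_iff: "(\<exists>u. G 8 (S 8) v u = Some (0, 0, [True])) \<longleftrightarrow> picked v"
proof -
  have "v \<notin> NH u" if "cands (S 2 u) \<noteq> {}" "v = Min (cands (S 2 u))" for u
    using picked_cand[of u] that cands2[of v u] coord2_co[of v u] by (auto simp: NH_def)
  then show ?thesis by (auto simp: in8 picked_def)
qed

lemma picked_co: "picked v \<Longrightarrow> \<exists>u. coord (S 2 v) = Some u"
  using picked_cand cands2 by (auto simp: picked_def)

lemma picked_uniq: "picked v \<Longrightarrow> picked w \<Longrightarrow> v = w"
  using picked_cand cands2_uniq unfolding picked_def by metis

definition cv where "cv v \<longleftrightarrow> C v = 3 \<and> d v \<ge> 1 \<and>
   (v \<in> R \<and> d v ^ 3 \<le> M (aroot (S 2 v)) ^ 2 \<or> (\<exists>u. u \<in> R \<and> v \<in> NH u \<and> d v ^ 3 \<le> M (aroot (S 2 u)) ^ 2))"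

lemma cv_iff: "decide_conv (S 8 v) (G 8 (S 8) v) \<longleftrightarrow> cv v"
proof -
  have "(\<exists>u k. G 8 (S 8) v u = Some (k, 0, []) \<and> d v ^ 3 \<le> k ^ 2) \<longleftrightarrow>
    (\<exists>u. u \<in> R \<and> v \<in> NH u \<and> d v ^ 3 \<le> M (aroot (S 2 u)) ^ 2)"
    by (auto simp: in8 split: if_splits)
  then show ?thesis
    using mid[of 8 v] deg_mid[of 8 v] S8(1)[of v] by (auto simp: decide_conv_def cv_def R_def)
qed

lemma S9: "S 9 v = step_decide (S 8 v) (G 8 (S 8) v)"
  using step'[of 8 v] by (simp add: vnext_def)

lemma
  shows cls9: "cls (S 9 v) = (if picked v then 2 else C v)"
    and hm9: "hm (S 9 v) = hm (S 1 v)"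
    and nbc9: "nbc (S 9 v) = nbc (S 1 v)"
    and ann9: "ann (S 9 v) = picked v"
    and conv9: "conv (S 9 v) = cv v"
    and unc9: "unc (S 9 v) \<longleftrightarrow> unc (S 4 v) \<and> \<not> cv v"
    and coord9: "coord (S 9 v) = (if picked v \<or> ml v then None else coord (S 2 v))"
    and cands9: "cands (S 9 v) = (if cands (S 2 v) = {} then {} else cands (S 2 v) - {Min (cands (S 2 v))})"
    and flags9: "\<not> left (S 9 v)" "\<not> ask (S 9 v)"
    and aw9: "awake (S 9 v) \<longleftrightarrow> picked v \<or> cv v \<or> unc (S 4 v) \<or> cands (S 9 v) \<noteq> {}"
  unfolding S9 using mid[of 8 v] has_ml_mid[of 8 v] S8(2)[of v]
  by (simp_all add: step_decide_def Let_def picked_iff cv_iff)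

lemma hm1_C: "hm (S 1 w) \<Longrightarrow> C w = 3" using hm1 b_hm3 by blast

lemma picked_C: "picked v \<Longrightarrow> C v = 1 \<and> \<not> ml v \<and> N v \<noteq> {}"
  using picked_co[of v] coord2_co[of v] by auto

lemma cands9_iff: "coord (S 9 v) = Some c \<longleftrightarrow> v \<in> cands (S 9 c)"
proof -
  have "coord (S 2 v) = Some c \<Longrightarrow> \<not> ml v" using coord2_co by blast
  moreover have "coord (S 2 v) = Some c \<Longrightarrow> picked v \<longleftrightarrow> v = Min (cands (S 2 c))"
    using cands2[of v] cands2_uniq picked_cand unfolding picked_def by (metis empty_iff)
  ultimately show ?thesis using cands2[of v c] by (auto simp: coord9 cands9)
qed

lemma stateA9: "stateA V E (S 9)"
proof
  fix u v c c'
  show "nbc (S 9 v) u = (if u \<in> N v then if ann (S 9 u) then 1 else cls (S 9 u) else 0)"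
    using picked_C[of u] by (simp add: nbc9 nbc1 ann9 cls9)
  show "cls (S 9 v) \<in> {1, 2, 3}" using b_cls[of v] by (simp add: cls9)
  show "hm (S 9 v) \<Longrightarrow> cls (S 9 v) = 3" using hm1_C[of v] picked_C[of v] by (auto simp: hm9 cls9)
  show "ann (S 9 v) \<Longrightarrow> cls (S 9 v) = 2 \<and> N v \<noteq> {} \<and> coord (S 9 v) = None"
    using picked_C[of v] by (auto simp: ann9 cls9 coord9)
  show "awake (S 9 v) \<Longrightarrow> v \<in> V"
  proof -
    assume "awake (S 9 v)"
    then consider "picked v" | "cv v" | "unc (S 4 v)" | "cands (S 9 v) \<noteq> {}" using aw9 by blast
    then show "v \<in> V"
    proof cases
      case 1
      then show ?thesis using picked_co[of v] coord2_co N_V' by blast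
    next
      case 2
      then have "N v \<noteq> {}" using finN by (auto simp: cv_def)
      then show ?thesis using N_V' by blast
    next
      case 3
      then show ?thesis using unc4 RV by blast
    next
      case 4
      then obtain w where "w \<in> cands (S 2 v)" by (auto simp: cands9 split: if_splits)
      then show ?thesis using cands2 coord2_co N_V by blast
    qed
  qed
  show "okay (S 9 v)" using ok[of 9] by simp
  \<comment> \<open>Only one candidate is picked in the whole network, and it has no neighbor in the
    light MIS.\<close>
  show "u \<in> N v \<Longrightarrow> cls (S 9 u) = 2 \<Longrightarrow> cls (S 9 v) \<noteq> 2"
    using b_ml[of u v] picked_C[of u] picked_C[of v] picked_uniq[of u v] N_irrefl[of v] N_sym[of u v]
    by (auto simp: cls9 split: if_splits)
  show "cls (S 9 v) = 1 \<Longrightarrow> coord (S 9 v) \<noteq> None \<or> (\<exists>u\<in>N v. cls (S 9 u) = 2)"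
  proof (rule ccontr)
    assume a: "cls (S 9 v) = 1" "\<not> (coord (S 9 v) \<noteq> None \<or> (\<exists>u\<in>N v. cls (S 9 u) = 2))"
    then have v: "C v = 1" "\<not> picked v" by (auto simp: cls9 split: if_splits)
    have "cls (S 9 u) = 2" if "C u = 2" for u using that by (simp add: cls9)
    then have m: "\<not> ml v" using a(2) by blast
    then have "coord (S 2 v) = None" using a(2) v by (simp add: coord9)
    then have "coord (S 1 v) = None" using m by (simp add: coord2)
    then show False using b_ln[OF v(1)] m v by (auto simp: coord1 split: if_splits)
  qed
  show "hm (S 9 v) \<Longrightarrow> u \<in> N v \<Longrightarrow> \<not> hm (S 9 u) \<and> (cls (S 9 u) = 2 \<longrightarrow> ann (S 9 u))"
    using b_hm[of v u] by (auto simp: hm9 cls9 ann9 hm1)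
  show "cls (S 9 v) = 3 \<Longrightarrow> \<not> hm (S 9 v) \<Longrightarrow> unc (S 9 v) \<or> conv (S 9 v) \<or> (\<exists>u\<in>N v. cls (S 9 u) = 2 \<or> hm (S 9 u))"
  proof (rule ccontr)
    assume a: "cls (S 9 v) = 3" "\<not> hm (S 9 v)" "\<not> (unc (S 9 v) \<or> conv (S 9 v) \<or> (\<exists>u\<in>N v. cls (S 9 u) = 2 \<or> hm (S 9 u)))"
    then have v: "C v = 3" by (auto simp: cls9 split: if_splits)
    have "cls (S 9 u) = 2" if "C u = 2" for u using that by (simp add: cls9)
    then have m: "\<not> ml v" and h: "\<forall>u\<in>N v. \<not> hm (S 1 u)" using a(3) by (auto simp: hm9)
    have "\<not> hm (S 1 v)" using a(2) by (simp add: hm9)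
    moreover have "v \<notin> R" using a h m by (auto simp: unc9 conv9 unc4 hm9)
    moreover have "\<not> hm (S 0 v)" using \<open>\<not> hm (S 1 v)\<close> m by (auto simp: hm1)
    \<comment> \<open>The former cover of \<open>v\<close> is a heavy vertex. Since it is no longer
      a member, it has departed and notified \<open>v\<close>, so that \<open>v\<close> would have
      become an asker.\<close>
    ultimately obtain w where w: "w \<in> N v" "hm (S 0 w) \<or> left (S 0 w)"
      using b_h[OF v] m R_iff by blast
    then have "w \<in> X" using h by (auto simp: X_def left1 hm1)
    then show False using \<open>v \<notin> R\<close> v w by (auto simp: R_iff)
  qed
  show "unc (S 9 v) \<Longrightarrow> cls (S 9 v) = 3 \<and> \<not> hm (S 9 v) \<and> \<not> conv (S 9 v) \<and> (\<forall>u\<in>N v. \<not> hm (S 9 u))"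
    using R3[of v] picked_C[of v] by (auto simp: unc9 unc4 cls9 hm9 conv9)
  show "conv (S 9 v) \<Longrightarrow> cls (S 9 v) = 3 \<and> N v \<noteq> {}"
    using picked_C[of v] by (auto simp: conv9 cv_def cls9)
  show "\<not> left (S 9 v) \<and> \<not> ask (S 9 v)" by (simp add: flags9)
  show "coord (S 9 v) = Some c \<Longrightarrow> cls (S 9 v) = 1 \<and> c \<in> N v \<and> (\<forall>u\<in>N v. cls (S 9 u) = 2 \<longrightarrow> ann (S 9 u))"
    using coord2_co[of v c] by (auto simp: coord9 cls9 ann9 split: if_splits)
  show "coord (S 9 v) = Some c \<longleftrightarrow> v \<in> cands (S 9 c)" by (rule cands9_iff)
  show "cands (S 9 c) \<noteq> {} \<Longrightarrow> cands (S 9 c') \<noteq> {} \<Longrightarrow> c = c'"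
    using cands2_uniq[of _ c _ c'] by (auto simp: cands9 split: if_splits)
  show "awake (S 9 v) \<Longrightarrow> conv (S 9 v) \<or> unc (S 9 v) \<or> ann (S 9 v) \<or> cands (S 9 v) \<noteq> {}"
    using aw9[of v] by (auto simp: conv9 unc9 ann9)
  show "cands (S 9 v) \<noteq> {} \<Longrightarrow> \<exists>w. ann (S 9 w)"
    by (auto simp: cands9 ann9 picked_def split: if_splits)
qed

end

section \<open>Message cost of an exploration\<close>

definition rootsB :: "gstate \<Rightarrow> nat set" where
  "rootsB \<sigma> = {v. ann (\<sigma> v) \<and> cls (\<sigma> v) = 2} \<union> (\<lambda>v. lroot (\<sigma> v)) ` {v. left (\<sigma> v)} \<union> {v. ask (\<sigma> v)}"

text \<open>Communication already due at position 0: announcements, messages of awake candidates to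
  the coordinator, reports of departed vertices to their roots, and notices of departed vertices
  that are no longer heavy. Notices of departed heavy vertices are missing because pings account for
  them, see \<open>KX_le\<close>.\<close>

definition pend :: "graph \<Rightarrow> gstate \<Rightarrow> nat" where
  "pend E \<sigma> = (\<Sum>v | ann (\<sigma> v). card (neighbors E v)) + card {v. awake (\<sigma> v) \<and> coord (\<sigma> v) \<noteq> None} +
     card {v. left (\<sigma> v)} + (\<Sum>v | left (\<sigma> v) \<and> cls (\<sigma> v) \<noteq> 3. card (neighbors E v))"

definition hdeg :: "graph \<Rightarrow> gstate \<Rightarrow> nat \<Rightarrow> nat" where
  "hdeg E \<sigma> v = card {u \<in> neighbors E v. cls (\<sigma> u) = 3}"

context net
begin

lemma gcount_le':
  assumes "finite B" "\<And>v. v \<in> B \<Longrightarrow> finite (X v)"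
    and "\<And>u v. G p \<sigma> v u \<noteq> None \<Longrightarrow> v \<in> B \<and> u \<in> X v"
  shows "gcount A T n E p \<sigma> \<le> (\<Sum>v\<in>B. card (X v))"
proof -
  have "{(u, v). G p \<sigma> v u \<noteq> None} \<subseteq> (\<lambda>(v, u). (u, v)) ` Sigma B X" using assms(3) by force
  then have "gcount A T n E p \<sigma> \<le> card ((\<lambda>(v, u). (u, v)) ` Sigma B X)"
    unfolding gcount_def using assms(1,2) by (intro card_mono) auto
  also have "\<dots> \<le> card (Sigma B X)" using assms(1,2) by (intro card_image_le) auto
  finally show ?thesis using assms(1,2) by (simp add: card_SigmaI)
qed

lemma small_lt:
  assumes "k \<le> 2 * n ^ 2" shows "k < n ^ (ce + 3)"
proof -
  have "2 * n ^ 2 < n * n ^ 2" using n by (intro mult_strict_right_mono) auto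
  also have "n * n ^ 2 = n ^ 3" by (simp add: power3_eq_cube power2_eq_square)
  also have "\<dots> \<le> n ^ (ce + 3)" using n by (intro power_increasing) auto
  finally show ?thesis using assms by simp
qed

lemma const_lt: "k \<le> 5 \<Longrightarrow> k < n ^ (ce + 3)"
proof (rule small_lt)
  assume "k \<le> 5"
  moreover have "3 * 3 \<le> n * n" using n by (intro mult_mono) auto
  ultimately show "k \<le> 2 * n ^ 2" by (simp add: power2_eq_square)
qed

lemma id_lt: "v \<in> V \<Longrightarrow> v < n ^ (ce + 3)"
proof -
  assume "v \<in> V"
  then have "v < n ^ ce" using vs by (auto simp: vertex_set_def)
  also have "\<dots> \<le> n ^ (ce + 3)" using n by (intro power_increasing) auto
  finally show ?thesis .
qed

lemma cardE_le: "4 * card E \<le> 2 * n ^ 2"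
proof -
  have "2 * card E = (\<Sum>v\<in>V. d v)" using sum_d by simp
  also have "\<dots> \<le> (\<Sum>v\<in>V. n)" by (intro sum_mono d_le)
  also have "\<dots> = n ^ 2" using vs by (simp add: vertex_set_def power2_eq_square)
  finally show ?thesis by simp
qed

lemma log_n: "log 2 (real n) \<ge> 1"
  using n by (simp add: le_log_iff)

end

context phaseB
begin

definition KR where "KR = (\<Sum>r\<in>R. card (NH r))"

lemma Rz_fin: "finite (Rz z)" using finR by (simp add: Rz_def)

lemma M_eq: "M z = (\<Sum>r\<in>Rz z. d r) + (\<Sum>w\<in>(\<Union>r\<in>Rz z. NH r). d w)"
proof -
  have "M z = (\<Sum>r\<in>Rz z. d r + (\<Sum>w\<in>NH r. if r = Min {r' \<in> Rz z. w \<in> NH r'} then d w else 0))"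
    unfolding M_def by (rule sum.cong) (auto simp: amass4 Rz_def)
  then show ?thesis
    using sum_min_owner[OF Rz_fin[of z], of NH d] finNH by (simp add: sum.distrib)
qed

lemma M_le: "M z \<le> 4 * card E"
proof -
  have "Rz z \<subseteq> V" using RV by (auto simp: Rz_def)
  moreover have "(\<Union>r\<in>Rz z. NH r) \<subseteq> V" using N_V by (auto simp: NH_def)
  ultimately show ?thesis using sum_d_le[of "Rz z"] sum_d_le[of "\<Union>r\<in>Rz z. NH r"] unfolding M_eq by linarith
qed

lemma cvV: "{v. cv v} \<subseteq> V"
proof
  fix v assume "v \<in> {v. cv v}"
  then have "N v \<noteq> {}" by (auto simp: cv_def)
  then show "v \<in> V" using N_V' by blast
qed

lemma fin_cv: "finite {v. cv v}" using cvV finV finite_subset by blast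

lemma cv_deg: "cv v \<Longrightarrow> d v ^ 3 \<le> (4 * card E) ^ 2"
  using M_le power_mono[OF M_le, where n=2] unfolding cv_def by (meson le_trans zero_le)

lemma aroot_roots: "(\<lambda>r. aroot (S 2 r)) ` R \<subseteq> rootsB (S 0)"
proof (rule image_subsetI)
  fix r assume r: "r \<in> R"
  show "aroot (S 2 r) \<in> rootsB (S 0)"
    using R_par[OF r] X_roots[of "apar (S 2 r)"] by (auto simp: rootsB_def)
qed

lemma fin_flags: "finite {v. ann (S 0 v)}" "finite {v. left (S 0 v)}" "finite {v. ask (S 0 v)}"
  "finite {v. awake (S 0 v)}"
proof -
  have "{v. awake (S 0 v)} \<subseteq> V" using b_awV by blast
  then show f: "finite {v. awake (S 0 v)}" using finV finite_subset by blast
  show "finite {v. ann (S 0 v)}" "finite {v. left (S 0 v)}" "finite {v. ask (S 0 v)}"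
    by (rule finite_subset[OF _ f], use flag_awake[of 0] in auto)+
qed

lemma fin_roots: "finite (rootsB (S 0))"
  using fin_flags by (auto simp: rootsB_def intro: finite_subset[OF _ fin_flags(1)])

text \<open>This is \<open>cluster_bound\<close> with \<open>Q\<close> the vertices about to become
  light; \<open>M_le\<close> and \<open>four_powr_le\<close> turn the contribution of each root into
  three times the power of the number of edges.\<close>

lemma KR_bound: "real KR \<le> 2 * real (\<Sum>v | cv v. d v) + 3 * real (card (rootsB (S 0))) * real (card E) powr (2/3)"
proof -
  have "real KR \<le> 2 * real (\<Sum>v | cv v. d v) + (\<Sum>z\<in>(\<lambda>r. aroot (S 2 r)) ` R. real (M z) powr (2/3))"
    unfolding KR_def
  proof (rule cluster_bound)
    fix r w z
    show "r \<in> R \<Longrightarrow> card (NH r) \<le> d r" using finN by (intro card_mono) (auto simp: NH_def)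
    show "card {r \<in> R. w \<in> NH r} \<le> d w" using finN N_sym by (intro card_mono) (auto simp: NH_def)
    show "(\<Sum>r | r \<in> R \<and> aroot (S 2 r) = z. d r) \<le> M z" by (simp add: M_eq Rz_def)
    show "(\<Sum>w\<in>(\<Union>r\<in>{r \<in> R. aroot (S 2 r) = z}. NH r). d w) \<le> M z" by (simp add: M_eq Rz_def)
    show "r \<in> R \<Longrightarrow> NH r \<noteq> {} \<Longrightarrow> d r ^ 3 \<le> M (aroot (S 2 r)) ^ 2 \<Longrightarrow> r \<in> {v. cv v}"
    proof -
      assume a: "r \<in> R" "NH r \<noteq> {}" "d r ^ 3 \<le> M (aroot (S 2 r)) ^ 2"
      then have "N r \<noteq> {}" by (auto simp: NH_def)
      then have "d r \<ge> 1" using finN by (simp add: One_nat_def Suc_le_eq card_gt_0_iff)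
      then show ?thesis using a R3 by (simp add: cv_def)
    qed
    show "r \<in> R \<Longrightarrow> w \<in> NH r \<Longrightarrow> d w ^ 3 \<le> M (aroot (S 2 r)) ^ 2 \<Longrightarrow> w \<in> {v. cv v}"
    proof -
      assume a: "r \<in> R" "w \<in> NH r" "d w ^ 3 \<le> M (aroot (S 2 r)) ^ 2"
      then have "N w \<noteq> {}" using N_sym by (auto simp: NH_def)
      then have "d w \<ge> 1" using finN by (simp add: One_nat_def Suc_le_eq card_gt_0_iff)
      then show ?thesis using a by (auto simp: cv_def NH_def)
    qed
  qed (use finR finNH fin_cv in auto)
  also have "(\<Sum>z\<in>(\<lambda>r. aroot (S 2 r)) ` R. real (M z) powr (2/3)) \<le>
      (\<Sum>z\<in>rootsB (S 0). real (M z) powr (2/3))"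
    by (rule sum_mono2[OF fin_roots aroot_roots]) auto
  also have "\<dots> \<le> (\<Sum>z\<in>rootsB (S 0). 3 * real (card E) powr (2/3))"
  proof (rule sum_mono)
    fix z
    have "real (M z) powr (2/3) \<le> (4 * real (card E)) powr (2/3)"
      using M_le[of z] by (intro powr_mono2) auto
    also have "\<dots> \<le> 3 * real (card E) powr (2/3)" by (rule four_powr_le) simp
    finally show "real (M z) powr (2/3) \<le> 3 * real (card E) powr (2/3)" .
  qed
  finally show ?thesis by simp
qed

definition DA where "DA = (\<Sum>v | ann (S 0 v). d v)"

lemma card_UN_ann: "card (\<Union>u\<in>{v. ann (S 0 v)}. N u) \<le> DA"
  unfolding DA_def by (rule card_UN_le[OF fin_flags(1)])

lemma card_X: "card X \<le> card {v. left (S 0 v)} + DA"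
proof -
  have "X \<subseteq> {v. left (S 0 v)} \<union> (\<Union>u\<in>{v. ann (S 0 v)}. N u)"
  proof
    fix x assume "x \<in> X"
    then consider "left (S 0 x)" | u where "hm (S 0 x)" "u \<in> N x" "C u = 2"
      by (auto simp: X_def left1)
    then show "x \<in> {v. left (S 0 v)} \<union> (\<Union>u\<in>{v. ann (S 0 v)}. N u)"
    proof cases
      case 2
      then have "ann (S 0 u)" "x \<in> N u" using b_hm[of x u] N_sym[of x u] by auto
      then show ?thesis by blast
    qed simp
  qed
  then have "card X \<le> card ({v. left (S 0 v)} \<union> (\<Union>u\<in>{v. ann (S 0 v)}. N u))"
    using fin_flags finN by (intro card_mono) auto
  also have "\<dots> \<le> card {v. left (S 0 v)} + card (\<Union>u\<in>{v. ann (S 0 v)}. N u)" by (rule card_Un_le)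
  finally show ?thesis using card_UN_ann by linarith
qed

definition KX where "KX = (\<Sum>x\<in>X. card (NH x))"

lemma card_NH_le: "card (NH v) \<le> d v"
  using finN by (intro card_mono) (auto simp: NH_def)

text \<open>A heavy neighbor notified by a departed heavy vertex becomes an asker and pings it back,
  so reversing pairs maps notices injectively to pings. A departed vertex that has become light is
  not pinged; its degree is charged instead.\<close>

lemma KX_le: "KX \<le> KR + (\<Sum>v | left (S 0 v) \<and> C v \<noteq> 3. d v)"
proof -
  have "KX = (\<Sum>x\<in>{x \<in> X. C x = 3}. card (NH x)) + (\<Sum>x\<in>{x \<in> X. C x \<noteq> 3}. card (NH x))"
    unfolding KX_def using finX
    by (subst sum.union_disjoint[symmetric]) (auto intro!: sum.cong)
  moreover have "(\<Sum>x\<in>{x \<in> X. C x = 3}. card (NH x)) \<le> KR"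
  proof -
    have "(\<Sum>x\<in>{x \<in> X. C x = 3}. card (NH x)) = card (SIGMA x:{x \<in> X. C x = 3}. NH x)"
      using finX finNH by (simp add: card_SigmaI)
    also have "\<dots> \<le> card (SIGMA r:R. NH r)"
    proof (rule card_inj_on_le[where f="\<lambda>(x, r). (r, x)"])
      show "(\<lambda>(x, r). (r, x)) ` (SIGMA x:{x \<in> X. C x = 3}. NH x) \<subseteq> (SIGMA r:R. NH r)"
        using N_sym by (auto simp: NH_def R_iff)
    qed (use finR finNH in \<open>auto simp: inj_on_def\<close>)
    also have "\<dots> = KR" using finR finNH by (simp add: card_SigmaI KR_def)
    finally show ?thesis .
  qed
  moreover have "(\<Sum>x\<in>{x \<in> X. C x \<noteq> 3}. card (NH x)) \<le> (\<Sum>v | left (S 0 v) \<and> C v \<noteq> 3. d v)"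
  proof -
    have "{x \<in> X. C x \<noteq> 3} \<subseteq> {v. left (S 0 v) \<and> C v \<noteq> 3}"
      using b_hm3 by (auto simp: X_def left1)
    then have "(\<Sum>x\<in>{x \<in> X. C x \<noteq> 3}. card (NH x)) \<le> (\<Sum>v | left (S 0 v) \<and> C v \<noteq> 3. card (NH v))"
      using fin_flags(2) by (intro sum_mono2) auto
    also have "\<dots> \<le> (\<Sum>v | left (S 0 v) \<and> C v \<noteq> 3. d v)" by (intro sum_mono card_NH_le)
    finally show ?thesis .
  qed
  ultimately show ?thesis by linarith
qed

abbreviation gc where "gc k \<equiv> gcount A T n E k (S k)"

lemma gc0: "gc 0 \<le> DA"
  unfolding DA_def using fin_flags finN N_sym
  by (intro gcount_le) (auto simp: in0 split: if_splits)

lemma gc1: "gc 1 \<le> KX + card {v. awake (S 0 v) \<and> coord (S 0 v) \<noteq> None} + DA"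
proof -
  define Z where "Z = {v. awake (S 1 v) \<and> coord (S 1 v) \<noteq> None}"
  have "Z \<subseteq> {v. awake (S 0 v) \<and> coord (S 0 v) \<noteq> None} \<union> (\<Union>u\<in>{v. ann (S 0 v)}. N u)" (is "_ \<subseteq> ?W")
  proof
    fix v assume "v \<in> Z"
    then have v: "awake (S 0 v) \<or> (\<exists>u\<in>N v. ann (S 0 u))" "coord (S 1 v) \<noteq> None"
      by (auto simp: Z_def aw1)
    show "v \<in> ?W"
    proof (cases "\<exists>u\<in>N v. ann (S 0 u)")
      case True
      then obtain u where "ann (S 0 u)" "v \<in> N u" using N_sym[of v] by blast
      then show ?thesis by blast
    next
      case False
      then have "coord (S 1 v) = coord (S 0 v)" by (auto simp: coord1)
      then show ?thesis using v False by simp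
    qed
  qed
  moreover have fW: "finite ?W" using fin_flags finN by (auto intro: finite_subset[OF _ fin_flags(4)])
  ultimately have "card Z \<le> card ?W" "finite Z" by (auto intro: card_mono finite_subset)
  then have Z: "card Z \<le> card {v. awake (S 0 v) \<and> coord (S 0 v) \<noteq> None} + DA"
    using card_Un_le[of "{v. awake (S 0 v) \<and> coord (S 0 v) \<noteq> None}" "\<Union>u\<in>{v. ann (S 0 v)}. N u"] card_UN_ann
    by linarith
  have dj: "X \<inter> Z = {}" using X_coord by (auto simp: Z_def)
  have "gc 1 \<le> (\<Sum>u\<in>X \<union> Z. card (if u \<in> Z then {the (coord (S 1 u))} else NH u))"
  proof (rule gcount_le)
    show "finite (X \<union> Z)" using finX \<open>finite Z\<close> by simp
    fix u v
    assume "G 1 (S 1) v u \<noteq> None"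
    then show "u \<in> X \<union> Z \<and> v \<in> (if u \<in> Z then {the (coord (S 1 u))} else NH u)"
      using N_sym[of u v] X_coord[of u] by (auto simp: in1 Z_def NH_def split: if_splits)
  qed (use finNH in auto)
  also have "\<dots> = (\<Sum>u\<in>X. card (if u \<in> Z then {the (coord (S 1 u))} else NH u)) +
      (\<Sum>u\<in>Z. card (if u \<in> Z then {the (coord (S 1 u))} else NH u))"
    using finX \<open>finite Z\<close> dj by (rule sum.union_disjoint)
  also have "(\<Sum>u\<in>X. card (if u \<in> Z then {the (coord (S 1 u))} else NH u)) = KX"
    unfolding KX_def using dj by (intro sum.cong) auto
  also have "(\<Sum>u\<in>Z. card (if u \<in> Z then {the (coord (S 1 u))} else NH u)) = card Z" by simp
  finally show ?thesis using Z by linarith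
qed

lemma gc2: "gc 2 \<le> KR"
  unfolding KR_def using finR finNH by (intro gcount_le) (auto simp: in2 split: if_splits)

lemma gc3: "gc 3 \<le> KR"
  unfolding KR_def using finR finNH by (intro gcount_le') (auto simp: in3 split: if_splits)

text \<open>Every such asker was notified by its parent, which is a departed vertex.\<close>

lemma card_kid: "card {r \<in> R. apar (S 2 r) \<noteq> r} \<le> KX"
proof -
  have "{r \<in> R. apar (S 2 r) \<noteq> r} \<subseteq> (\<Union>x\<in>X. NH x)"
  proof
    fix r assume r: "r \<in> {r \<in> R. apar (S 2 r) \<noteq> r}"
    then have "apar (S 2 r) \<in> X" "apar (S 2 r) \<in> N r" "C r = 3" using R_par[of r] R3[of r] by auto
    then show "r \<in> (\<Union>x\<in>X. NH x)" using N_sym[of r "apar (S 2 r)"] by (auto simp: NH_def)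
  qed
  then have "card {r \<in> R. apar (S 2 r) \<noteq> r} \<le> card (\<Union>x\<in>X. NH x)"
    using finX finNH by (intro card_mono) auto
  also have "\<dots> \<le> KX" unfolding KX_def by (rule card_UN_le[OF finX])
  finally show ?thesis .
qed

lemma gc4: "gc 4 \<le> KX"
proof -
  have "gc 4 \<le> (\<Sum>r\<in>{r \<in> R. apar (S 2 r) \<noteq> r}. card {apar (S 2 r)})"
    using finR by (intro gcount_le) (auto simp: in4 split: if_splits)
  then show ?thesis using card_kid by simp
qed

lemma gc5: "gc 5 \<le> card X"
proof -
  have "gc 5 \<le> (\<Sum>x\<in>X. card {lroot (S 1 x)})"
    using finX by (intro gcount_le) (auto simp: in5 split: if_splits)
  then show ?thesis by simp
qed

lemma in6_Some: "G 6 (S 6) x z = Some y \<Longrightarrow> x \<in> X \<and> z = lroot (S 1 x) \<and> y = (M z, 0, [])"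
  using S6 by (auto simp: gin_in vsend_def split: if_splits)

lemma in7_Some: "G 7 (S 7) r x = Some y \<Longrightarrow> r \<in> R \<and> apar (S 2 r) \<noteq> r \<and> x = apar (S 2 r) \<and> y = (lthr (S 7 x), 0, [])"
  using S7 by (auto simp: gin_in vsend_def kids_def split: if_splits)

lemma gc6: "gc 6 \<le> card X"
proof -
  have "gc 6 \<le> (\<Sum>x\<in>X. card {lroot (S 1 x)})"
    using finX in6_Some by (intro gcount_le') auto
  then show ?thesis by simp
qed

lemma gc7: "gc 7 \<le> KX"
proof -
  have "gc 7 \<le> (\<Sum>r\<in>{r \<in> R. apar (S 2 r) \<noteq> r}. card {apar (S 2 r)})"
  proof (rule gcount_le')
    fix u v assume "G 7 (S 7) v u \<noteq> None"
    then obtain y where "G 7 (S 7) v u = Some y" by blast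
    then show "v \<in> {r \<in> R. apar (S 2 r) \<noteq> r} \<and> u \<in> {apar (S 2 v)}" using in7_Some by blast
  qed (use finR in auto)
  then show ?thesis using card_kid by simp
qed

lemma fin_picked: "finite {v. picked v}"
proof -
  have "{v. picked v} \<subseteq> V" using picked_C N_V' by blast
  then show ?thesis using finV finite_subset by blast
qed

lemma gc8: "gc 8 \<le> KR + card {v. picked v}"
proof -
  let ?P = "{(u, v). cands (S 2 u) \<noteq> {} \<and> v = Min (cands (S 2 u))}"
  have inj: "inj_on snd ?P" using picked_cand cands2_uniq by (fastforce simp: inj_on_def)
  have im: "snd ` ?P \<subseteq> {v. picked v}" by (auto simp: picked_def)
  then have fP: "finite ?P" using inj fin_picked by (meson finite_imageD finite_subset)
  have "gc 8 \<le> card ((SIGMA r:R. NH r) \<union> ?P)"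
    unfolding gcount_def using finR finNH fP
    by (intro card_mono) (auto simp: in8 split: if_splits)
  also have "\<dots> \<le> card (SIGMA r:R. NH r) + card ?P" by (rule card_Un_le)
  also have "card ?P \<le> card {v. picked v}" by (rule card_inj_on_le[OF inj im fin_picked])
  finally show ?thesis using finR finNH by (simp add: card_SigmaI KR_def)
qed

text \<open>Positions 2, 3 and 8 cost \<open>KR\<close> and positions 1, 4 and 7 cost
  \<open>KX\<close>, which makes the 6. The degrees of announcing vertices occur four times: at
  positions 0 and 1, and through \<open>card X\<close> at 5 and 6.\<close>

lemma msgs9: "(\<Sum>k<9. gc k) \<le> 6 * KR + 4 * pend E (S 0) + card {v. picked v}"
proof -
  have "(\<Sum>k<9. gc k) = gc 0 + gc 1 + gc 2 + gc 3 + gc 4 + gc 5 + gc 6 + gc 7 + gc 8"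
    by (simp add: numeral_eq_Suc One_nat_def)
  moreover define w l e p where "w = card {v. awake (S 0 v) \<and> coord (S 0 v) \<noteq> None}"
    "l = card {v. left (S 0 v)}" "e = (\<Sum>v | left (S 0 v) \<and> C v \<noteq> 3. d v)" "p = card {v. picked v}"
  note gc1[folded w_l_e_p_def(1)] card_X[folded w_l_e_p_def(2)] KX_le[folded w_l_e_p_def(3)]
    gc8[folded w_l_e_p_def(4)]
  moreover have "pend E (S 0) = DA + w + l + e" by (simp add: pend_def DA_def w_l_e_p_def)
  ultimately show ?thesis
    unfolding w_l_e_p_def(4)[symmetric] using gc0 gc2 gc3 gc4 gc5 gc6 gc7 by linarith
qed

lemma unc9_sum: "(\<Sum>v | unc (S 9 v). hdeg E (S 9) v) \<le> KR"
proof -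
  have "hdeg E (S 9) v = card (NH v)" for v
    unfolding hdeg_def NH_def using picked_C by (auto simp: cls9 intro!: arg_cong[where f=card])
  moreover have "{v. unc (S 9 v)} \<subseteq> R" by (auto simp: unc9 unc4)
  ultimately show ?thesis unfolding KR_def using finR by (simp add: sum_mono2)
qed

lemma unc9_roots: "unc (S 9 v) \<Longrightarrow> rootsB (S 0) \<noteq> {}"
  using aroot_roots by (auto simp: unc9 unc4)

lemma lroot_V: "x \<in> X \<Longrightarrow> lroot (S 1 x) \<in> V"
  using X_lroot[of x] XV N_V by auto

lemma aroot_V: "r \<in> R \<Longrightarrow> aroot (S 2 r) \<in> V"
  using R_par[of r] RV lroot_V by auto

lemma M_lt: "M z < n ^ (ce + 3)"
  using M_le[of z] cardE_le by (intro small_lt) linarith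

lemma amass_le: "r \<in> R \<Longrightarrow> amass (S 4 r) \<le> M (aroot (S 2 r))"
  unfolding M_def by (rule member_le_sum) (auto simp: Rz_def finR)

lemma lmass_le: "x \<in> X \<Longrightarrow> lmass (S 5 x) \<le> M (lroot (S 1 x))"
proof -
  have "kids x \<subseteq> Rz (lroot (S 1 x))" using R_par by (auto simp: kids_def Rz_def)
  then show ?thesis unfolding S5 M_def using Rz_fin by (intro sum_mono2) auto
qed

lemma fits9: "k < 9 \<Longrightarrow> gfits (ce + 3) (be + 1) A T n E k (S k)"
proof -
  assume "k < 9"
  have C: "C u < n ^ (ce + 3)" for u using b_cls[of u] const_lt[of "C u"] by auto
  have D: "d u < n ^ (ce + 3)" for u
  proof (rule small_lt)
    have "n \<le> n ^ 2" using n by (simp add: power2_eq_square)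
    then show "d u \<le> 2 * n ^ 2" using d_le[of u] by linarith
  qed
  note c = const_lt[of 0] const_lt[of 1] const_lt[of 2]
  have L: "1 \<le> (real be + 1) * log 2 (real n)"
    using mult_mono[of 1 "real be + 1" 1 "log 2 (real n)"] log_n by simp
  have L0: "0 \<le> (real be + 1) * log 2 (real n)" using L by linarith
  from \<open>k < 9\<close> have "k = 0 \<or> k = 1 \<or> k = 2 \<or> k = 3 \<or> k = 4 \<or> k = 5 \<or> k = 6 \<or> k = 7 \<or> k = 8"
    by presburger
  then show ?thesis
  proof (elim disjE)
    assume k: "k = 0" show ?thesis unfolding k gfits_def using C c L0 by (auto simp: in0 split: if_splits)
  next
    assume k: "k = 1" show ?thesis unfolding k gfits_def using id_lt[OF lroot_V] c L0
      by (auto simp: in1 split: if_splits)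
  next
    assume k: "k = 2" show ?thesis unfolding k gfits_def using id_lt[OF aroot_V] c L0
      by (auto simp: in2 split: if_splits)
  next
    assume k: "k = 3" show ?thesis unfolding k gfits_def using D c L0
      by (auto simp: in3 split: if_splits)
  next
    assume k: "k = 4" show ?thesis unfolding k gfits_def using le_less_trans[OF amass_le M_lt] c L0
      by (auto simp: in4 split: if_splits)
  next
    assume k: "k = 5" show ?thesis unfolding k gfits_def using le_less_trans[OF lmass_le M_lt] c L0
      by (auto simp: in5 split: if_splits)
  next
    assume k: "k = 6" show ?thesis unfolding k gfits_def
    proof (intro allI impI)
      fix v u i j bs
      assume a: "G 6 (S 6) v u = Some (i, j, bs)"
      show "i < n ^ (ce + 3) \<and> j < n ^ (ce + 3) \<and> real (length bs) \<le> real (be + 1) * log 2 (real n)"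
        using in6_Some[OF a] M_lt c L0 by auto
    qed
  next
    assume k: "k = 7" show ?thesis unfolding k gfits_def
    proof (intro allI impI)
      fix v u i j bs
      assume a: "G 7 (S 7) v u = Some (i, j, bs)"
      note b = in7_Some[OF a]
      then have "u \<in> X" using R_par[of v] by auto
      then show "i < n ^ (ce + 3) \<and> j < n ^ (ce + 3) \<and> real (length bs) \<le> real (be + 1) * log 2 (real n)"
        using b S7(1) M_lt c L0 by auto
    qed
  next
    assume k: "k = 8" show ?thesis unfolding k gfits_def using M_lt c L0 L
      by (auto simp: in8 split: if_splits)
  qed
qed

end

section \<open>Entering the independent set\<close>

locale phaseA = net A T n ce be V E + stateA V E "S 0"
  for A T n ce be V E and S :: "nat \<Rightarrow> gstate" +
  assumes step: "\<And>k. k < 2 + T n \<Longrightarrow> S (Suc k) = ground A T n E (9 + k) (S k)"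
begin

abbreviation C :: "nat \<Rightarrow> nat" where "C v \<equiv> cls (S 0 v)"
abbreviation ml :: "nat \<Rightarrow> bool" where "ml v \<equiv> \<exists>u\<in>N v. C u = 2"
abbreviation cv :: "nat \<Rightarrow> bool" where "cv v \<equiv> conv (S 0 v)"
abbreviation uc :: "nat \<Rightarrow> bool" where "uc v \<equiv> unc (S 0 v)"

lemma step': "k < 2 + T n \<Longrightarrow> S (Suc k) v = vnext A T n (9 + k) v (S k v) (G (9 + k) (S k) v)"
  using step by (simp add: ground_def)

lemma ok: "k \<le> 2 + T n \<Longrightarrow> okay (S k v)"
proof (induction k)
  case (Suc k)
  then show ?case using okay_vnext step'[of k v] by simp
qed (rule a_ok)

lemma flag_awake:
  assumes "k \<le> 2 + T n"
  shows "ann (S k v) \<Longrightarrow> awake (S k v)" "left (S k v) \<Longrightarrow> awake (S k v)" "conv (S k v) \<Longrightarrow> awake (S k v)"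
    "unc (S k v) \<Longrightarrow> awake (S k v)" "cands (S k v) \<noteq> {} \<Longrightarrow> awake (S k v)" "part (S k v) \<Longrightarrow> awake (S k v)"
  using ok[OF assms, of v] clean_sel[of "S k v"] by (auto simp: okay_def)

lemma C0: "C u \<noteq> 0" using a_cls[of u] by auto

lemma in9: "G 9 (S 0) v u = (if u \<in> N v \<and> ann (S 0 u) then Some (2, 0, []) else None)"
proof -
  have "u \<in> N v \<Longrightarrow> nbc (S 0 u) v \<noteq> 0"
    using a_nbc[of u v] N_sym[of u v] C0[of v] by auto
  then show ?thesis using flag_awake(1)[of 0 u] a_ann[of u] by (auto simp: gin_in vsend_def)
qed

lemma S1: "S 1 v = (step_announce (S 0 v) (G 9 (S 0) v))\<lparr>awake := awake (S 0 v) \<or> (\<exists>u. G 9 (S 0) v u \<noteq> None)\<rparr>"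
  using step'[of 0 v] by (simp add: vnext_def step_const_def One_nat_def)

lemma heard9: "heard (G 9 (S 0) v) k = (if k = 2 then {u \<in> N v. ann (S 0 u)} else {})"
  by (auto simp: heard_def in9)

lemma
  shows cls1: "cls (S 1 v) = C v"
    and nbc1: "nbc (S 1 v) u = (if u \<in> N v then C u else 0)"
    and hm1: "hm (S 1 v) \<longleftrightarrow> hm (S 0 v) \<and> \<not> ml v"
    and left1: "left (S 1 v) \<longleftrightarrow> hm (S 0 v) \<and> ml v"
    and lroot1: "left (S 1 v) \<Longrightarrow> lroot (S 1 v) \<in> N v \<and> ann (S 0 (lroot (S 1 v)))"
    and coord1: "coord (S 1 v) = coord (S 0 v)"
    and cands1: "cands (S 1 v) = cands (S 0 v)"
    and conv1: "conv (S 1 v) = cv v" and unc1: "unc (S 1 v) = uc v"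
    and ann1: "\<not> ann (S 1 v)" and ask1: "\<not> ask (S 1 v)"
    and aw1: "awake (S 1 v) \<longleftrightarrow> awake (S 0 v) \<or> (\<exists>u\<in>N v. ann (S 0 u))"
proof -
  have *: "heard (G 9 (S 0) v) 2 = {} \<longleftrightarrow> \<not> ml v" if "hm (S 0 v)"
    using a_hm[OF that] a_ann by (auto simp: heard9)
  show "cls (S 1 v) = C v" "cands (S 1 v) = cands (S 0 v)" "conv (S 1 v) = cv v" "unc (S 1 v) = uc v"
    "\<not> ann (S 1 v)" "coord (S 1 v) = coord (S 0 v)" "\<not> ask (S 1 v)"
    unfolding S1 using a_idle by (simp_all add: step_announce_def heard9)
  show "nbc (S 1 v) u = (if u \<in> N v then C u else 0)"
    unfolding S1 using a_ann[of u] by (simp add: step_announce_def in9 a_nbc)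
  show "hm (S 1 v) \<longleftrightarrow> hm (S 0 v) \<and> \<not> ml v"
    unfolding S1 using * by (auto simp: step_announce_def)
  show l: "left (S 1 v) \<longleftrightarrow> hm (S 0 v) \<and> ml v"
    unfolding S1 using * a_idle[of v] by (auto simp: step_announce_def)
  show "left (S 1 v) \<Longrightarrow> lroot (S 1 v) \<in> N v \<and> ann (S 0 (lroot (S 1 v)))"
  proof -
    assume "left (S 1 v)"
    then have h: "hm (S 0 v)" "ml v" using l by auto
    then have ne: "heard (G 9 (S 0) v) 2 \<noteq> {}" using * by simp
    then have "lroot (S 1 v) = Min (heard (G 9 (S 0) v) 2)"
      unfolding S1 using h(1) by (simp add: step_announce_def)
    moreover have "Min (heard (G 9 (S 0) v) 2) \<in> heard (G 9 (S 0) v) 2"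
      by (rule Min_in[OF _ ne]) (simp add: heard9 finN)
    ultimately show ?thesis by (simp add: heard9)
  qed
  show "awake (S 1 v) \<longleftrightarrow> awake (S 0 v) \<or> (\<exists>u\<in>N v. ann (S 0 u))"
    unfolding S1 by (auto simp: in9)
qed

lemma ml1: "has_ml (S 1 v) \<longleftrightarrow> ml v"
  by (auto simp: has_ml_def nbc1)

lemma in10: "G 10 (S 1) v u = (if u \<in> N v then
    if cv u then Some (if ml u then 1 else 4, 0, [])
    else if uc u \<and> \<not> ml u \<and> C v = 3 then Some (5, 0, []) else None else None)"
  using flag_awake(3,4)[of 1 u] N_sym[of u v] C0[of v]
  by (simp add: gin_in vsend_def ml1 nbc1 conv1 unc1)

lemma S2: "S 2 v = (step_class v (S 1 v) (G 10 (S 1) v))\<lparr>awake := awake (S 1 v) \<or> (\<exists>u. G 10 (S 1) v u \<noteq> None)\<rparr>"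
  using step'[of 1 v] by (simp add: vnext_def step_const_def numeral_2_eq_2 One_nat_def)

lemma heard10: "heard (G 10 (S 1) v) 1 = {u \<in> N v. cv u \<and> ml u}"
  "heard (G 10 (S 1) v) 4 = {u \<in> N v. cv u \<and> \<not> ml u}"
  "C v = 3 \<Longrightarrow> heard (G 10 (S 1) v) 5 = {u \<in> N v. uc u \<and> \<not> ml u}"
  using a_unc by (auto simp: heard_def in10 split: if_splits)

section \<open>Simulation of the static algorithm\<close>

definition P where "P v \<longleftrightarrow> (cv v \<or> uc v) \<and> \<not> ml v"

lemma
  shows cls2: "cls (S 2 v) = (if cv v then 1 else C v)"
    and hm2: "hm (S 2 v) \<longleftrightarrow> hm (S 0 v) \<and> \<not> ml v \<and> \<not> cv v"
    and left2: "left (S 2 v) \<longleftrightarrow> hm (S 0 v) \<and> (ml v \<or> cv v)"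
    and lroot2: "left (S 2 v) \<Longrightarrow> lroot (S 2 v) = v \<and> cv v \<or> lroot (S 2 v) \<in> N v \<and> ann (S 0 (lroot (S 2 v)))"
    and nbc2: "nbc (S 2 v) u = (if u \<in> N v then cls (S 2 u) else 0)"
    and part2: "part (S 2 v) \<longleftrightarrow> P v"
    and rnbs2: "P v \<Longrightarrow> rnbs (S 2 v) = {u \<in> N v. P u \<and> cv u = cv v}"
    and hist2: "hist (S 2 v) = []"
    and coord2: "coord (S 2 v) = coord (S 0 v)" and cands2: "cands (S 2 v) = cands (S 0 v)"
    and conv2: "conv (S 2 v) = cv v" and unc2: "unc (S 2 v) = uc v"
    and ann2: "\<not> ann (S 2 v)" and ask2: "\<not> ask (S 2 v)"
    and aw2: "awake (S 2 v) \<longleftrightarrow> awake (S 0 v) \<or> (\<exists>u\<in>N v. ann (S 0 u) \<or> cv u \<or> uc u \<and> \<not> ml u \<and> C v = 3)"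
proof -
  show c: "cls (S 2 v) = (if cv v then 1 else C v)" for v
    unfolding S2 by (simp add: step_class_def cls1 conv1)
  show "hm (S 2 v) \<longleftrightarrow> hm (S 0 v) \<and> \<not> ml v \<and> \<not> cv v"
    unfolding S2 by (auto simp: step_class_def hm1 conv1)
  show "left (S 2 v) \<longleftrightarrow> hm (S 0 v) \<and> (ml v \<or> cv v)"
    unfolding S2 by (auto simp: step_class_def left1 hm1 conv1)
  show "left (S 2 v) \<Longrightarrow> lroot (S 2 v) = v \<and> cv v \<or> lroot (S 2 v) \<in> N v \<and> ann (S 0 (lroot (S 2 v)))"
    unfolding S2 using lroot1[of v] by (auto simp: step_class_def conv1)
  show "nbc (S 2 v) u = (if u \<in> N v then cls (S 2 u) else 0)"
    unfolding c unfolding S2 by (auto simp: step_class_def heard10 nbc1)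
  show "part (S 2 v) \<longleftrightarrow> P v" unfolding S2 by (simp add: step_class_def P_def conv1 unc1 ml1)
  show "P v \<Longrightarrow> rnbs (S 2 v) = {u \<in> N v. P u \<and> cv u = cv v}"
    unfolding S2 using heard10[of v] a_unc by (auto simp: step_class_def P_def conv1 unc1)
  show "hist (S 2 v) = []" "coord (S 2 v) = coord (S 0 v)" "cands (S 2 v) = cands (S 0 v)"
    "conv (S 2 v) = cv v" "unc (S 2 v) = uc v" "\<not> ann (S 2 v)" "\<not> ask (S 2 v)"
    unfolding S2 by (simp_all add: step_class_def coord1 cands1 conv1 unc1 ann1 ask1)
  show "awake (S 2 v) \<longleftrightarrow> awake (S 0 v) \<or> (\<exists>u\<in>N v. ann (S 0 u) \<or> cv u \<or> uc u \<and> \<not> ml u \<and> C v = 3)"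
    unfolding S2 by (auto simp: aw1 in10)
qed

text \<open>Both groups are served by a single run on all of \<open>V\<close>: edges between the
  groups and edges to other vertices are dropped, and non-participants become isolated. An MIS of
  this graph restricts to an MIS of each group.\<close>

definition E' where "E' = {{u, v} | u v. u \<in> N v \<and> P u \<and> P v \<and> cv u = cv v}"

lemma E'_iff: "{u, v} \<in> E' \<longleftrightarrow> u \<in> N v \<and> P u \<and> P v \<and> cv u = cv v"
  using N_sym[of u v] by (auto simp: E'_def doubleton_eq_iff)

lemma E'_N: "neighbors E' v = (if P v then {u \<in> N v. P u \<and> cv u = cv v} else {})"
  by (auto simp: neighbors_def E'_iff)

lemma gr': "graph_on V E'"
  unfolding graph_on_def
proof
  fix e assume "e \<in> E'"
  then obtain u v where e: "e = {u, v}" "u \<in> N v" by (auto simp: E'_def)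
  then have "u \<noteq> v" using N_irrefl by blast
  then show "e \<subseteq> V \<and> card e = 2" using e N_V N_V' by auto
qed

lemma mis: "is_mis V E' (s_result A n V E' (T n))"
  and sfits: "r < T n \<Longrightarrow> s_inbox A n E' (s_hist A n E' r) v u = Some m \<Longrightarrow> fits be n m"
  using static vs gr' unfolding static_mis_def by blast+

lemma P_rnbs: "P v \<Longrightarrow> rnbs (S 2 v) = neighbors E' v"
  using rnbs2 by (simp add: E'_N)

lemma in_run:
  assumes r: "r < T n" and I: "\<And>v. \<exists>h. S (2 + r) v = (S 2 v)\<lparr>hist := h\<rparr> \<and> (P v \<longrightarrow> h = s_hist A n E' r v)"
  shows "G (11 + r) (S (2 + r)) v u = map_option (\<lambda>m. (0, 0, m)) (s_inbox A n E' (s_hist A n E' r) v u)"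
proof -
  obtain h where h: "S (2 + r) u = (S 2 u)\<lparr>hist := h\<rparr>" "P u \<longrightarrow> h = s_hist A n E' r u" using I by blast
  show ?thesis
  proof (cases "P u")
    case True
    then have "awake (S 2 u)" using flag_awake(6)[of 2 u] part2 by simp
    moreover have "u \<in> N v" if "v \<in> neighbors E' u" using that N_sym by (auto simp: E'_N split: if_splits)
    moreover have "v \<in> neighbors E' u \<longleftrightarrow> u \<in> neighbors E' v" by (simp add: neighbors_def insert_commute)
    ultimately show ?thesis
      using True h r by (auto simp: gin_in vsend_def part2 P_rnbs s_inbox_def)
  next
    case False
    then have "u \<notin> neighbors E' v" by (auto simp: E'_N)
    then show ?thesis using False h r by (auto simp: gin_in vsend_def part2 s_inbox_def)
  qed
qed

lemma run_inbox:
  assumes r: "r < T n" and I: "\<And>v. \<exists>h. S (2 + r) v = (S 2 v)\<lparr>hist := h\<rparr> \<and> (P v \<longrightarrow> h = s_hist A n E' r v)"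
    and P: "P v"
  shows "(\<lambda>u. if u \<in> rnbs (S 2 v) then map_option (snd \<circ> snd) (G (11 + r) (S (2 + r)) v u) else None) =
    s_inbox A n E' (s_hist A n E' r) v"
  unfolding in_run[OF r I] P_rnbs[OF P]
  by (rule ext) (simp add: s_inbox_def option.map_comp comp_def option.map_ident)

lemma run_step: "r < T n \<Longrightarrow> S (2 + Suc r) v = vnext A T n (11 + r) v (S (2 + r) v) (G (11 + r) (S (2 + r)) v)"
  using step'[of "2 + r" v] by (simp add: add.assoc[symmetric])

text \<open>Before the last round only \<open>hist\<close> changes. The last round also evaluates
  the output and resets the flags, so it is excluded here and treated in
  \<open>clsF\<close>.\<close>

lemma run_inv: "r < T n \<Longrightarrow> \<exists>h. S (2 + r) v = (S 2 v)\<lparr>hist := h\<rparr> \<and> (P v \<longrightarrow> h = s_hist A n E' r v)"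
proof (induction r arbitrary: v)
  case 0
  have "S 2 v = (S 2 v)\<lparr>hist := hist (S 2 v)\<rparr>" by simp
  then have "S (2 + 0) v = (S 2 v)\<lparr>hist := []\<rparr>" unfolding hist2 by simp
  then show ?case by (intro exI[of _ "[]"]) simp
next
  case (Suc r)
  then have r: "r < T n" by simp
  obtain h where h: "S (2 + r) v = (S 2 v)\<lparr>hist := h\<rparr>" "P v \<longrightarrow> h = s_hist A n E' r v"
    using Suc.IH[OF r, of v] by (elim exE conjE)
  show ?case
  proof (cases "awake (S 2 v)")
    case False
    then have "\<not> P v" using flag_awake(6)[of 2 v] part2 by auto
    moreover have "S (2 + Suc r) v = (S 2 v)\<lparr>hist := h\<rparr>"
      unfolding run_step[OF r] h(1) using False by (simp add: vnext_def)
    ultimately show ?thesis by (intro exI[of _ h]) simp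
  next
    case True
    have lt: "11 + r < 10 + T n" using Suc.prems by simp
    let ?f = "\<lambda>u. if u \<in> rnbs (S 2 v) then map_option (snd \<circ> snd) (G (11 + r) (S (2 + r)) v u) else None"
    have "S (2 + Suc r) v = (S 2 v)\<lparr>hist := h @ [?f]\<rparr>"
      unfolding run_step[OF r] h(1) using True lt
      by (simp add: vnext_def step_run_def Let_def del: add_2_eq_Suc)
    moreover have "h @ [?f] = s_hist A n E' (Suc r) v" if "P v"
      using run_inbox[OF r Suc.IH[OF r] that] h(2) that by (simp del: add_2_eq_Suc)
    ultimately show ?thesis by (intro exI[of _ "h @ [?f]"]) blast
  qed
qed

section \<open>Outcome of the run\<close>

definition W where "W v \<longleftrightarrow> P v \<and> v \<in> s_result A n V E' (T n)"

definition F :: gstate where "F = S (2 + T n)"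

lemma PV: "P v \<Longrightarrow> v \<in> V"
  using flag_awake(3,4)[of 0 v] a_awV[of v] by (auto simp: P_def)

lemma
  shows clsF: "cls (F v) = (if cv v \<and> W v then 2 else cls (S 2 v))"
    and annF: "ann (F v) \<longleftrightarrow> cv v \<and> W v"
    and hmF: "hm (F v) \<longleftrightarrow> hm (S 2 v) \<or> uc v \<and> W v"
    and restF: "left (F v) = left (S 2 v)" "lroot (F v) = lroot (S 2 v)" "nbc (F v) = nbc (S 2 v)"
      "coord (F v) = coord (S 0 v)" "cands (F v) = cands (S 0 v)" "awake (F v) = awake (S 2 v)" "\<not> ask (F v)"
proof -
  obtain r where r: "T n = Suc r" using T by (cases "T n") auto
  then have r': "r < T n" by simp
  obtain h where h: "S (2 + r) v = (S 2 v)\<lparr>hist := h\<rparr>" "P v \<longrightarrow> h = s_hist A n E' r v"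
    using run_inv[OF r', of v] by (elim exE conjE)
  have s: "F v = vnext A T n (11 + r) v (S (2 + r) v) (G (11 + r) (S (2 + r)) v)"
    unfolding F_def r by (rule run_step[OF r'])
  have "cls (F v) = (if cv v \<and> W v then 2 else cls (S 2 v)) \<and> (ann (F v) \<longleftrightarrow> cv v \<and> W v) \<and>
    (hm (F v) \<longleftrightarrow> hm (S 2 v) \<or> uc v \<and> W v) \<and> left (F v) = left (S 2 v) \<and> lroot (F v) = lroot (S 2 v) \<and>
    nbc (F v) = nbc (S 2 v) \<and> coord (F v) = coord (S 2 v) \<and> cands (F v) = cands (S 2 v) \<and>
    awake (F v) = awake (S 2 v) \<and> \<not> ask (F v)"
  proof (cases "awake (S 2 v)")
    case False
    then have "\<not> P v" "\<not> cv v" using flag_awake(6,3)[of 2 v] part2 conv2 by auto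
    moreover have "F v = (S 2 v)\<lparr>hist := h\<rparr>" unfolding s h(1) using False by (simp add: vnext_def)
    moreover have "\<not> uc v" using False flag_awake(4)[of 2 v] unc2 by auto
    ultimately show ?thesis using ann2[of v] ask2[of v] by simp
  next
    case True
    let ?f = "\<lambda>u. if u \<in> rnbs (S 2 v) then map_option (snd \<circ> snd) (G (11 + r) (S (2 + r)) v u) else None"
    have out: "part (S 2 v) \<and> s_out A n v (rnbs (S 2 v)) (h @ [?f]) \<longleftrightarrow> W v"
    proof (cases "P v")
      case True
      then have "h @ [?f] = s_hist A n E' (T n) v"
        using run_inbox[OF r' run_inv[OF r'] True] h(2) by (simp add: r del: add_2_eq_Suc)
      then show ?thesis using True part2 P_rnbs PV by (simp add: W_def s_result_def)
    qed (simp add: W_def part2)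
    then show ?thesis
      unfolding s h(1) using True ann2[of v] ask2[of v]
      by (simp add: vnext_def step_run_def Let_def r conv2 unc2 del: add_2_eq_Suc)
  qed
  then show "cls (F v) = (if cv v \<and> W v then 2 else cls (S 2 v))" "ann (F v) \<longleftrightarrow> cv v \<and> W v"
    "hm (F v) \<longleftrightarrow> hm (S 2 v) \<or> uc v \<and> W v" "left (F v) = left (S 2 v)" "lroot (F v) = lroot (S 2 v)"
    "nbc (F v) = nbc (S 2 v)" "coord (F v) = coord (S 0 v)" "cands (F v) = cands (S 0 v)"
    "awake (F v) = awake (S 2 v)" "\<not> ask (F v)"
    using coord2 cands2 by simp_all
qed

lemma W_ind: "W u \<Longrightarrow> W v \<Longrightarrow> u \<in> N v \<Longrightarrow> cv u \<noteq> cv v"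
  using mis by (auto simp: W_def is_mis_def independent_set_def E'_iff)

lemma W_max: "P v \<Longrightarrow> \<not> W v \<Longrightarrow> \<exists>u\<in>N v. W u \<and> cv u = cv v"
proof (rule ccontr)
  let ?R = "s_result A n V E' (T n)"
  assume a: "P v" "\<not> W v" "\<not> (\<exists>u\<in>N v. W u \<and> cv u = cv v)"
  have v: "v \<notin> ?R" "v \<in> V" using a PV by (auto simp: W_def)
  have i: "independent_set V E' ?R" using mis by (simp add: is_mis_def)
  have no: "{u, v} \<notin> E'" if "u \<in> ?R" for u using a(3) that by (auto simp: E'_iff W_def)
  have no': "{v, u} \<notin> E'" if "u \<in> ?R" for u using no[OF that] by (simp add: insert_commute)
  have "{v, v} \<notin> E'" using N_irrefl E'_iff by blast
  then have "independent_set V E' (insert v ?R)"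
    using i no no' v unfolding independent_set_def by blast
  moreover have "?R \<subset> insert v ?R" using v by blast
  ultimately show False using mis unfolding is_mis_def by blast
qed

lemma old2: "C u = 2 \<Longrightarrow> cls (F u) = 2"
  using a_conv[of u] by (auto simp: clsF cls2)

lemma stateBF: "stateB V E F"
proof
  fix u v c c'
  show "nbc (F v) u = (if u \<in> N v then if ann (F u) then if cls (F u) = 2 then 1 else 2 else cls (F u) else 0)"
    using a_conv[of u] by (auto simp: restF nbc2 annF clsF cls2)
  show "cls (F v) \<in> {1, 2, 3}" using a_cls[of v] by (auto simp: clsF cls2)
  show "hm (F v) \<Longrightarrow> cls (F v) = 3"
    using a_hm3[of v] a_unc[of v] by (auto simp: hmF clsF cls2 hm2)
  show "ask (F v) \<Longrightarrow> cls (F v) = 3 \<and> apar (F v) = v \<and> aroot (F v) = v" by (simp add: restF)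
  show "left (F v) \<Longrightarrow> lroot (F v) = v \<or> lroot (F v) \<in> N v" using lroot2[of v] by (auto simp: restF)
  show "awake (F v) \<Longrightarrow> v \<in> V" using a_awV[of v] N_V' by (auto simp: restF aw2)
  show "okay (F v)" unfolding F_def by (rule ok) simp
  show "u \<in> N v \<Longrightarrow> cls (F u) = 2 \<Longrightarrow> cls (F v) \<noteq> 2"
  proof
    assume a: "u \<in> N v" "cls (F u) = 2" "cls (F v) = 2"
    have *: "C x = 2 \<or> cv x \<and> W x" if "cls (F x) = 2" for x
      using that by (simp add: clsF cls2 split: if_splits)
    have "v \<in> N u" using a(1) N_sym by blast
    moreover have "\<not> ml x" if "W x" for x using that by (simp add: W_def P_def)
    ultimately show False
      using *[OF a(2)] *[OF a(3)] a(1) a_ml[of u v] W_ind[of u v] by blast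
  qed
  show "cls (F v) = 1 \<Longrightarrow> coord (F v) \<noteq> None \<or> (\<exists>u\<in>N v. cls (F u) = 2 \<or> ann (F u) \<and> cls (F u) = 3)"
  proof -
    assume a: "cls (F v) = 1"
    show ?thesis
    proof (cases "cv v")
      case False
      then have "C v = 1" using a by (simp add: clsF cls2)
      then show ?thesis using a_ln[of v] old2 by (auto simp: restF)
    next
      case True
      then have "\<not> W v" using a by (auto simp: clsF)
      show ?thesis
      proof (cases "ml v")
        case m: True
        then show ?thesis using old2 by blast
      next
        case False
        then have "P v" using True by (simp add: P_def)
        then obtain w where "w \<in> N v" "W w" "cv w" using W_max[of v] \<open>\<not> W v\<close> True by blast
        then have "cls (F w) = 2" by (simp add: clsF)
        then show ?thesis using \<open>w \<in> N v\<close> by blast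
      qed
    qed
  qed
  show "hm (F v) \<Longrightarrow> u \<in> N v \<Longrightarrow> \<not> hm (F u) \<and> (cls (F u) = 2 \<longrightarrow> ann (F u))"
  proof -
    assume h: "hm (F v)" and u: "u \<in> N v"
    have nm: "\<not> ml v" using h by (auto simp: hmF hm2 W_def P_def)
    \<comment> \<open>New heavy members were uncovered, hence by \<open>a_unc\<close> not adjacent
      to old ones; two new ones are not adjacent by \<open>W_ind\<close>.\<close>
    have "\<not> hm (F u)"
      using h u a_hm[of v u] a_unc[of u] a_unc[of v] W_ind[of u v] N_sym[of u v]
      by (auto simp: hmF hm2)
    \<comment> \<open>The two groups were run separately, so a new light member may be adjacent to a
      heavy one. This is tolerated while its announcement is pending; the announcement evicts the
      heavy one.\<close>
    moreover have "cls (F u) = 2 \<longrightarrow> ann (F u)" using nm u by (auto simp: clsF cls2 annF)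
    ultimately show ?thesis by blast
  qed
  show "cls (F v) = 3 \<Longrightarrow> \<not> hm (F v) \<Longrightarrow> ask (F v) \<or> (\<exists>u\<in>N v. cls (F u) = 2 \<or> hm (F u) \<or> left (F u))"
  proof -
    assume a: "cls (F v) = 3" "\<not> hm (F v)"
    have v: "C v = 3" "\<not> cv v" using a(1) by (auto simp: clsF cls2 split: if_splits)
    show ?thesis
    proof (cases "ml v")
      case True
      then show ?thesis using old2 by blast
    next
      case False
      then have "\<not> hm (S 0 v)" using a(2) v by (auto simp: hmF hm2)
      then consider "uc v" | u where "u \<in> N v" "hm (S 0 u)" using a_h[of v] v False by auto
      then show ?thesis
      proof cases
        case 1
        then have "P v" "\<not> W v" using False a(2) by (auto simp: P_def hmF)
        then obtain w where w: "w \<in> N v" "W w" "\<not> cv w" using W_max[of v] v by blast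
        then have "hm (F w)" by (auto simp: hmF W_def P_def)
        then show ?thesis using w by blast
      next
        case 2
        then have "hm (F u) \<or> left (F u)" by (auto simp: hmF hm2 restF left2)
        then show ?thesis using 2 by blast
      qed
    qed
  qed
  show "coord (F v) = Some c \<Longrightarrow> cls (F v) = 1 \<and> \<not> left (F v) \<and> c \<in> N v"
    using a_co[of v c] a_conv[of v] a_hm3[of v] by (auto simp: restF clsF cls2 left2)
  show "coord (F v) = Some c \<longleftrightarrow> v \<in> cands (F c)" using a_cands by (simp add: restF)
  show "cands (F c) \<noteq> {} \<Longrightarrow> cands (F c') \<noteq> {} \<Longrightarrow> c = c'" using a_uniq by (simp add: restF)
  show "ann (F u) \<Longrightarrow> cls (F u) = 3 \<Longrightarrow> (\<forall>c. cands (F c) = {}) \<and>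
       (\<forall>w. ann (F w) \<and> cls (F w) = 3 \<longrightarrow> w = u) \<and> (\<forall>w. left (F w) \<longrightarrow> cls (F w) = 3)"
    by (simp add: annF clsF)
  show "coord (F v) \<noteq> None \<Longrightarrow> u \<in> N v \<Longrightarrow> cls (F u) = 2 \<Longrightarrow> \<not> ann (F u) \<Longrightarrow> awake (F v)"
  proof -
    assume a: "coord (F v) \<noteq> None" "u \<in> N v" "cls (F u) = 2" "\<not> ann (F u)"
    then have "C u = 2" by (simp add: clsF cls2 annF split: if_splits)
    moreover obtain w where "coord (S 0 v) = Some w" using a(1) by (auto simp: restF)
    ultimately have "ann (S 0 u)" using a_co[of v w] a(2) by blast
    then show ?thesis using a(2) by (auto simp: restF aw2)
  qed
qed

end

section \<open>Message cost of a run\<close>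

context phaseA
begin

definition DA where "DA = (\<Sum>v | ann (S 0 v). d v)"
definition DC where "DC = (\<Sum>v | cv v. d v)"
definition DU where "DU = (\<Sum>v | uc v. hdeg E (S 0) v)"

lemma fin: "finite {v. ann (S 0 v)}" "finite {v. cv v}" "finite {v. uc v}"
proof -
  have "{v. awake (S 0 v)} \<subseteq> V" using a_awV by blast
  then have f: "finite {v. awake (S 0 v)}" using finV finite_subset by blast
  show "finite {v. ann (S 0 v)}" "finite {v. cv v}" "finite {v. uc v}"
    by (rule finite_subset[OF _ f], use flag_awake[of 0] in auto)+
qed

lemma g9: "gcount A T n E 9 (S 0) \<le> DA"
  unfolding DA_def using fin finN N_sym
  by (intro gcount_le) (auto simp: in9 split: if_splits)

abbreviation tg :: "nat \<Rightarrow> nat set" where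
  "tg u \<equiv> (if cv u then N u else {w \<in> N u. C w = 3})"

lemma sum_tg: "(\<Sum>u\<in>{v. cv v} \<union> {v. uc v}. card (tg u)) = DC + DU"
proof -
  have "{v. cv v} \<inter> {v. uc v} = {}" using a_unc by auto
  then have "(\<Sum>u\<in>{v. cv v} \<union> {v. uc v}. card (tg u)) = (\<Sum>u | cv u. card (tg u)) + (\<Sum>u | uc u. card (tg u))"
    using fin by (intro sum.union_disjoint) auto
  moreover have "(\<Sum>u | cv u. card (tg u)) = DC" unfolding DC_def by (rule sum.cong) auto
  moreover have "(\<Sum>u | uc u. card (tg u)) = DU"
    unfolding DU_def hdeg_def using a_unc by (intro sum.cong) auto
  ultimately show ?thesis by simp
qed

lemma g10: "gcount A T n E 10 (S 1) \<le> DC + DU"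
proof -
  have "gcount A T n E 10 (S 1) \<le> (\<Sum>u\<in>{v. cv v} \<union> {v. uc v}. card (tg u))"
  proof (rule gcount_le)
    fix u v assume "G 10 (S 1) v u \<noteq> None"
    then show "u \<in> {v. cv v} \<union> {v. uc v} \<and> v \<in> tg u"
      using N_sym[of u v] by (auto simp: in10 split: if_splits)
  qed (use fin finN in auto)
  then show ?thesis using sum_tg by simp
qed

lemma grun_count: "r < T n \<Longrightarrow> gcount A T n E (11 + r) (S (2 + r)) \<le> DC + DU"
proof -
  assume r: "r < T n"
  have "gcount A T n E (11 + r) (S (2 + r)) \<le> (\<Sum>u\<in>{v. cv v} \<union> {v. uc v}. card (tg u))"
  proof (rule gcount_le)
    fix u v assume "G (11 + r) (S (2 + r)) v u \<noteq> None"
    then have "u \<in> neighbors E' v"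
      unfolding in_run[OF r run_inv[OF r]] by (auto simp: s_inbox_def split: if_splits)
    then have "u \<in> N v" "P u" "P v" "cv u = cv v" by (auto simp: E'_N split: if_splits)
    then show "u \<in> {v. cv v} \<union> {v. uc v} \<and> v \<in> tg u"
      using N_sym[of u v] a_unc[of v] by (auto simp: P_def)
  qed (use fin finN in auto)
  then show ?thesis using sum_tg by simp
qed

lemma card_UN_N: "finite B \<Longrightarrow> card (\<Union>u\<in>B. N u) \<le> (\<Sum>v\<in>B. d v)"
  by (rule card_UN_le)

lemma card_conv: "card {v. cv v} \<le> DC"
proof -
  have "card {v. cv v} = (\<Sum>v | cv v. 1)" by simp
  also have "\<dots> \<le> DC" unfolding DC_def
    using a_conv finN by (intro sum_mono) (auto simp: One_nat_def Suc_le_eq card_gt_0_iff)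
  finally show ?thesis .
qed

lemma pendF: "pend E F \<le> 2 * DA + 4 * DC"
proof -
  have 1: "(\<Sum>v | ann (F v). d v) \<le> DC"
    unfolding DC_def using fin by (intro sum_mono2) (auto simp: annF)
  have 2: "card {v. awake (F v) \<and> coord (F v) \<noteq> None} \<le> DA + DC"
  proof -
    have "{v. awake (F v) \<and> coord (F v) \<noteq> None} \<subseteq> (\<Union>u\<in>{v. ann (S 0 v)}. N u) \<union> (\<Union>u\<in>{v. cv v}. N u)"
    proof
      fix v assume "v \<in> {v. awake (F v) \<and> coord (F v) \<noteq> None}"
      then obtain w where aw: "awake (S 2 v)" and w: "coord (S 0 v) = Some w" by (auto simp: restF)
      have C1: "C v = 1" "w \<in> N v" using a_co[OF w] by auto
      \<comment> \<open>After the decisions only coordinators and announcing, converting or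
        uncovered vertices are awake. A candidate is none of these, since a second coordinator is
        excluded and no vertex is its own neighbor. So an announcing or converting neighbor woke it,
        and the degree of that neighbor is charged.\<close>
      have "\<not> awake (S 0 v)"
      proof
        assume "awake (S 0 v)"
        then have "cands (S 0 v) \<noteq> {}" using a_awake[of v] a_conv[of v] a_unc[of v] a_ann[of v] C1 w by auto
        moreover have "v \<in> cands (S 0 w)" using a_cands w by blast
        ultimately have "w = v" using a_uniq[of w v] by auto
        then show False using C1 N_irrefl by simp
      qed
      then obtain u where "u \<in> N v" "ann (S 0 u) \<or> cv u" using aw C1 by (auto simp: aw2)
      then show "v \<in> (\<Union>u\<in>{v. ann (S 0 v)}. N u) \<union> (\<Union>u\<in>{v. cv v}. N u)"
        using N_sym[of u v] by blast
    qed
    then have "card {v. awake (F v) \<and> coord (F v) \<noteq> None} \<le>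
        card ((\<Union>u\<in>{v. ann (S 0 v)}. N u) \<union> (\<Union>u\<in>{v. cv v}. N u))"
      using fin finN by (intro card_mono) auto
    also have "\<dots> \<le> card (\<Union>u\<in>{v. ann (S 0 v)}. N u) + card (\<Union>u\<in>{v. cv v}. N u)" by (rule card_Un_le)
    finally show ?thesis using card_UN_N[OF fin(1)] card_UN_N[OF fin(2)] by (simp add: DA_def DC_def)
  qed
  have 3: "card {v. left (F v)} \<le> DA + DC"
  proof -
    have "{v. left (F v)} \<subseteq> (\<Union>u\<in>{v. ann (S 0 v)}. N u) \<union> {v. cv v}"
    proof
      fix v assume "v \<in> {v. left (F v)}"
      then have "lroot (S 2 v) = v \<and> cv v \<or> lroot (S 2 v) \<in> N v \<and> ann (S 0 (lroot (S 2 v)))"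
        using lroot2[of v] by (simp add: restF)
      then show "v \<in> (\<Union>u\<in>{v. ann (S 0 v)}. N u) \<union> {v. cv v}" using N_sym by blast
    qed
    then have "card {v. left (F v)} \<le> card ((\<Union>u\<in>{v. ann (S 0 v)}. N u) \<union> {v. cv v})"
      using fin finN by (intro card_mono) auto
    also have "\<dots> \<le> card (\<Union>u\<in>{v. ann (S 0 v)}. N u) + card {v. cv v}" by (rule card_Un_le)
    finally show ?thesis using card_UN_N[OF fin(1)] card_conv by (simp add: DA_def)
  qed
  have 4: "(\<Sum>v | left (F v) \<and> cls (F v) \<noteq> 3. d v) \<le> DC"
    unfolding DC_def using fin a_hm3
    by (intro sum_mono2) (auto simp: restF left2 clsF cls2 split: if_splits)
  show ?thesis unfolding pend_def using 1 2 3 4 by linarith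
qed

lemma rootsF: "rootsB F \<subseteq> {v. ann (S 0 v)} \<union> {v. cv v}"
proof
  fix z assume "z \<in> rootsB F"
  then consider "ann (F z)" | v where "z = lroot (F v)" "left (F v)" by (auto simp: rootsB_def restF)
  then show "z \<in> {v. ann (S 0 v)} \<union> {v. cv v}"
  proof cases
    case 1
    then show ?thesis by (simp add: annF)
  next
    case 2
    then show ?thesis using lroot2[of v] by (auto simp: restF)
  qed
qed

lemma fitsA:
  shows "gfits (ce + 3) (be + 1) A T n E 9 (S 0)" "gfits (ce + 3) (be + 1) A T n E 10 (S 1)"
    and "r < T n \<Longrightarrow> gfits (ce + 3) (be + 1) A T n E (11 + r) (S (2 + r))"
proof -
  have L: "0 \<le> real be * log 2 (real n)" "0 \<le> log 2 (real n)" using log_n by auto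
  have L0: "0 \<le> (real be + 1) * log 2 (real n)" using L by (simp add: algebra_simps)
  note c = const_lt[of 0] const_lt[of 1] const_lt[of 2] const_lt[of 4] const_lt[of 5]
  show "gfits (ce + 3) (be + 1) A T n E 9 (S 0)" "gfits (ce + 3) (be + 1) A T n E 10 (S 1)"
    unfolding gfits_def using c L0 by (auto simp: in9 in10 split: if_splits)
  assume r: "r < T n"
  show "gfits (ce + 3) (be + 1) A T n E (11 + r) (S (2 + r))"
    unfolding gfits_def
  proof (intro allI impI)
    fix v u i j bs assume "G (11 + r) (S (2 + r)) v u = Some (i, j, bs)"
    then have m: "i = 0" "j = 0" "s_inbox A n E' (s_hist A n E' r) v u = Some bs"
      unfolding in_run[OF r run_inv[OF r]] by auto
    have "real (length bs) \<le> real be * log 2 (real n)" using sfits[OF r m(3)] by (simp add: fits_def)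
    also have "\<dots> \<le> real (be + 1) * log 2 (real n)" using L(2) by (intro mult_right_mono) auto
    finally have "real (length bs) \<le> real (be + 1) * log 2 (real n)" .
    then show "i < n ^ (ce + 3) \<and> j < n ^ (ce + 3) \<and> real (length bs) \<le> real (be + 1) * log 2 (real n)"
      using m(1,2) c(1) by simp
  qed
qed

end

section \<open>The two halves of a phase as statements about runs\<close>

context net
begin

abbreviation run :: "nat \<Rightarrow> nat \<times> gstate \<Rightarrow> nat \<times> gstate" where "run \<equiv> grun A T n E"
abbreviation msgs :: "nat \<Rightarrow> nat \<times> gstate \<Rightarrow> nat" where "msgs \<equiv> gmsgs A T n E"
abbreviation fit :: "nat \<Rightarrow> nat \<times> gstate \<Rightarrow> bool" where
  "fit K x \<equiv> \<forall>k<K. gfits (ce + 3) (be + 1) A T n E (fst (run k x)) (snd (run k x))"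

lemma run_Suc: "run (Suc k) x = (next_pos (T n) (fst (run k x)), ground A T n E (fst (run k x)) (snd (run k x)))"
  by (simp add: grun_def gstep_def)

lemma run_0 [simp]: "run 0 x = x" by (simp add: grun_def)

lemma fit_add: "fit j x \<Longrightarrow> fit k (run j x) \<Longrightarrow> fit (j + k) x"
proof (intro allI impI)
  fix i assume a: "fit j x" "fit k (run j x)" "i < j + k"
  show "gfits (ce + 3) (be + 1) A T n E (fst (run i x)) (snd (run i x))"
  proof (cases "i < j")
    case False
    then obtain l where "i = j + l" using le_Suc_ex[of j i] by auto
    then show ?thesis using a by (simp add: grun_add)
  qed (use a in simp)
qed

lemma fst_run_B: "k \<le> 9 \<Longrightarrow> fst (run k (0, \<sigma>)) = k"
proof (induction k)
  case (Suc k)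
  then show ?case using T by (simp add: run_Suc next_pos_def)
qed simp

lemma fst_run_A: "k < 2 + T n \<Longrightarrow> fst (run k (9, \<sigma>)) = 9 + k"
proof (induction k)
  case (Suc k)
  then show ?case by (simp add: run_Suc next_pos_def)
qed simp

text \<open>The existential \<open>K\<close> hides the number of pings. It bounds both the messages
  of this half and the heavy degrees of the uncovered vertices, which determine their share of the
  next run.\<close>

lemma segB:
  assumes B: "stateB V E \<sigma>"
  defines "\<sigma>' \<equiv> snd (run 9 (0, \<sigma>))"
  shows "run 9 (0, \<sigma>) = (9, \<sigma>')" and "stateA V E \<sigma>'"
    and "cls (\<sigma> v) = (if ann (\<sigma>' v) then 1 else cls (\<sigma>' v))"
    and "conv (\<sigma>' v) \<Longrightarrow> d v ^ 3 \<le> (4 * card E) ^ 2"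
    and "\<exists>K. msgs 9 (0, \<sigma>) \<le> 6 * K + 4 * pend E \<sigma> + card {v. ann (\<sigma>' v)} \<and>
      (\<Sum>v | unc (\<sigma>' v). hdeg E \<sigma>' v) \<le> K \<and>
      real K \<le> 2 * real (\<Sum>v | conv (\<sigma>' v). d v) + 3 * real (card (rootsB \<sigma>)) * real (card E) powr (2/3)"
    and "unc (\<sigma>' v) \<Longrightarrow> rootsB \<sigma> \<noteq> {}"
    and "fit 9 (0, \<sigma>)"
proof -
  define S where "S k = snd (run k (0, \<sigma>))" for k
  have st0: "S 0 = \<sigma>" and st9: "S 9 = \<sigma>'" by (simp_all add: S_def \<sigma>'_def)
  interpret phaseB A T n ce be V E S
  proof (intro phaseB.intro phaseB_axioms.intro)
    show "S (Suc k) = ground A T n E k (S k)" if "k < 9" for k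
      using that fst_run_B[of k \<sigma>] by (simp add: S_def run_Suc)
  qed (use B net_axioms in \<open>simp_all only: st0\<close>)
  show "run 9 (0, \<sigma>) = (9, \<sigma>')" using fst_run_B[of 9 \<sigma>] by (simp add: \<sigma>'_def prod_eq_iff)
  show "stateA V E \<sigma>'" using stateA9 by (simp add: st9)
  show "cls (\<sigma> v) = (if ann (\<sigma>' v) then 1 else cls (\<sigma>' v))"
    using picked_C[of v] by (simp add: st9[symmetric] st0[symmetric] cls9 ann9)
  show "conv (\<sigma>' v) \<Longrightarrow> d v ^ 3 \<le> (4 * card E) ^ 2"
    using cv_deg by (simp add: st9[symmetric] conv9)
  have "msgs 9 (0, \<sigma>) = (\<Sum>k<9. gc k)"
    unfolding gmsgs_def by (rule sum.cong) (auto simp: fst_run_B S_def)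
  then have "msgs 9 (0, \<sigma>) \<le> 6 * KR + 4 * pend E \<sigma> + card {v. ann (\<sigma>' v)}"
    using msgs9 by (simp add: st9[symmetric] st0 ann9)
  moreover have "(\<Sum>v | unc (\<sigma>' v). hdeg E \<sigma>' v) \<le> KR" using unc9_sum by (simp add: st9)
  moreover have "real KR \<le> 2 * real (\<Sum>v | conv (\<sigma>' v). d v) + 3 * real (card (rootsB \<sigma>)) * real (card E) powr (2/3)"
    using KR_bound by (simp add: st9[symmetric] st0 conv9)
  ultimately show "\<exists>K. msgs 9 (0, \<sigma>) \<le> 6 * K + 4 * pend E \<sigma> + card {v. ann (\<sigma>' v)} \<and>
      (\<Sum>v | unc (\<sigma>' v). hdeg E \<sigma>' v) \<le> K \<and>
      real K \<le> 2 * real (\<Sum>v | conv (\<sigma>' v). d v) + 3 * real (card (rootsB \<sigma>)) * real (card E) powr (2/3)"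
    by blast
  show "unc (\<sigma>' v) \<Longrightarrow> rootsB \<sigma> \<noteq> {}" using unc9_roots by (simp add: st9 st0)
  show "fit 9 (0, \<sigma>)" using fits9 by (simp add: fst_run_B S_def)
qed

lemma segA:
  assumes Ast: "stateA V E \<sigma>"
  defines "\<sigma>' \<equiv> snd (run (2 + T n) (9, \<sigma>))"
  shows "run (2 + T n) (9, \<sigma>) = (0, \<sigma>')" and "stateB V E \<sigma>'"
    and "cls (\<sigma>' v) = cls (\<sigma> v) \<or> conv (\<sigma> v) \<and> cls (\<sigma>' v) \<in> {1, 2}"
    and "conv (\<sigma> v) \<Longrightarrow> cls (\<sigma>' v) \<in> {1, 2}"
    and "msgs (2 + T n) (9, \<sigma>) \<le> (\<Sum>v | ann (\<sigma> v). d v) +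
      (1 + T n) * ((\<Sum>v | conv (\<sigma> v). d v) + (\<Sum>v | unc (\<sigma> v). hdeg E \<sigma> v))"
    and "pend E \<sigma>' \<le> 2 * (\<Sum>v | ann (\<sigma> v). d v) + 4 * (\<Sum>v | conv (\<sigma> v). d v)"
    and "rootsB \<sigma>' \<subseteq> {v. ann (\<sigma> v)} \<union> {v. conv (\<sigma> v)}"
    and "fit (2 + T n) (9, \<sigma>)"
proof -
  define S where "S k = snd (run k (9, \<sigma>))" for k
  have st0: "S 0 = \<sigma>" by (simp add: S_def)
  interpret phaseA A T n ce be V E S
  proof (intro phaseA.intro phaseA_axioms.intro)
    show "S (Suc k) = ground A T n E (9 + k) (S k)" if "k < 2 + T n" for k
      using that fst_run_A[of k \<sigma>] by (simp add: S_def run_Suc)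
  qed (use Ast net_axioms in \<open>simp_all only: st0\<close>)
  have F: "F = \<sigma>'" by (simp only: F_def S_def \<sigma>'_def)
  have "run (Suc (1 + T n)) (9, \<sigma>) = (0, snd (run (Suc (1 + T n)) (9, \<sigma>)))"
    unfolding run_Suc using fst_run_A[of "1 + T n" \<sigma>] by (simp add: next_pos_def)
  then show "run (2 + T n) (9, \<sigma>) = (0, \<sigma>')" by (simp add: \<sigma>'_def One_nat_def)
  show "stateB V E \<sigma>'" using stateBF by (simp only: F)
  show "cls (\<sigma>' v) = cls (\<sigma> v) \<or> conv (\<sigma> v) \<and> cls (\<sigma>' v) \<in> {1, 2}"
    unfolding F[symmetric] st0[symmetric] by (simp add: clsF cls2)
  show "conv (\<sigma> v) \<Longrightarrow> cls (\<sigma>' v) \<in> {1, 2}"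
    unfolding F[symmetric] st0[symmetric] by (simp add: clsF cls2)
  show "pend E \<sigma>' \<le> 2 * (\<Sum>v | ann (\<sigma> v). d v) + 4 * (\<Sum>v | conv (\<sigma> v). d v)"
    using pendF unfolding F DA_def DC_def st0 .
  show "rootsB \<sigma>' \<subseteq> {v. ann (\<sigma> v)} \<union> {v. conv (\<sigma> v)}" using rootsF unfolding F st0 .
  have s: "(\<Sum>k<2 + T n. f k) = f 0 + f 1 + (\<Sum>r<T n. f (2 + r))" for f :: "nat \<Rightarrow> nat"
    by (simp add: sum.lessThan_Suc_shift One_nat_def del: sum.lessThan_Suc)
  have "msgs (2 + T n) (9, \<sigma>) = (\<Sum>k<2 + T n. gcount A T n E (9 + k) (S k))"
    unfolding gmsgs_def by (rule sum.cong) (auto simp: fst_run_A S_def)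
  also have "\<dots> = gcount A T n E 9 (S 0) + gcount A T n E 10 (S 1) +
      (\<Sum>r<T n. gcount A T n E (11 + r) (S (2 + r)))"
    unfolding s by (simp add: add.assoc[symmetric] del: add_2_eq_Suc)
  also have "\<dots> \<le> DA + (DC + DU) + (\<Sum>r<T n. DC + DU)"
    using g9 g10 grun_count by (intro add_mono sum_mono) auto
  also have "\<dots> = DA + (1 + T n) * (DC + DU)" by (simp add: algebra_simps)
  finally show "msgs (2 + T n) (9, \<sigma>) \<le> (\<Sum>v | ann (\<sigma> v). d v) +
      (1 + T n) * ((\<Sum>v | conv (\<sigma> v). d v) + (\<Sum>v | unc (\<sigma> v). hdeg E \<sigma> v))"
    by (simp add: DA_def DC_def DU_def st0)
  show "fit (2 + T n) (9, \<sigma>)"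
  proof (intro allI impI)
    fix k assume k: "k < 2 + T n"
    consider "k = 0" | "k = 1" | r where "k = 2 + r" "r < T n"
      using k by (metis One_nat_def add_2_eq_Suc less_Suc_eq_0_disj plus_1_eq_Suc add_less_cancel_left)
    then have "gfits (ce + 3) (be + 1) A T n E (9 + k) (S k)"
    proof cases
      case 3
      then show ?thesis using fitsA(3)[of r] by (simp add: add.assoc[symmetric] del: add_2_eq_Suc)
    qed (use fitsA in simp_all)
    then show "gfits (ce + 3) (be + 1) A T n E (fst (run k (9, \<sigma>))) (snd (run k (9, \<sigma>)))"
      using fst_run_A[OF k] by (simp add: S_def)
  qed
qed

end

section \<open>The potential\<close>

text \<open>
  A light vertex whose degree exceeds \<open>3 m powr (2/3)\<close> saves the excess: it pays when the vertex is forced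
  out of the MIS and becomes heavy. The deletion of an edge lowers \<open>m powr (2/3)\<close> by at most
  \<open>m powr (-1/3)\<close> and affects the excess of only \<open>O(m powr (1/3))\<close> vertices.
\<close>

definition rk :: "nat \<Rightarrow> nat" where
  "rk k = (if k = 2 then 0 else if k = 1 then 1 else 3)"

definition gpow :: "graph \<Rightarrow> real" where
  "gpow E = real (card E) powr (2/3)"

text \<open>Isolated vertices weigh nothing: thus a change of \<open>gpow\<close> affects at most
  \<open>2 * card E\<close> vertices, and the size of \<open>V\<close> does not enter.\<close>

definition wt :: "graph \<Rightarrow> nat \<Rightarrow> real" where
  "wt E v = (if neighbors E v = {} then 0 else real (card (neighbors E v)) + gpow E)"

definition excess :: "graph \<Rightarrow> nat \<Rightarrow> real" where
  "excess E v = max 0 (real (card (neighbors E v)) - 3 * gpow E)"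

definition base :: "nat set \<Rightarrow> graph \<Rightarrow> gstate \<Rightarrow> real" where
  "base V E \<sigma> = (\<Sum>v\<in>V. real (rk (cls (\<sigma> v))) * wt E v + (if cls (\<sigma> v) \<noteq> 3 then 4 * excess E v else 0))"

text \<open>Rank 2 lies between heavy and light. The decision to convert releases one unit of
  weight, for the exploration; the conversion releases at least one more, for the run.\<close>

definition rankA :: "gstate \<Rightarrow> nat \<Rightarrow> nat" where
  "rankA \<sigma> v = (if conv (\<sigma> v) then 2 else rk (cls (\<sigma> v)))"

definition potB :: "nat set \<Rightarrow> graph \<Rightarrow> gstate \<Rightarrow> real" where
  "potB V E \<sigma> = base V E \<sigma> + real (pend E \<sigma>) / 8 + real (card (rootsB \<sigma>)) * gpow E / 2"

text \<open>The picked vertex has already dropped from rank 1 to 0. Half of its weight is held back,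
  because its announcement and the clusters rooted at it are still to come.\<close>

definition potA :: "nat set \<Rightarrow> graph \<Rightarrow> gstate \<Rightarrow> real" where
  "potA V E \<sigma> =
     (\<Sum>v\<in>V. real (rankA \<sigma> v) * wt E v + (if cls (\<sigma> v) \<noteq> 3 \<or> conv (\<sigma> v) then 4 * excess E v else 0)) +
     (\<Sum>v | ann (\<sigma> v). wt E v) / 2 + real (\<Sum>v | unc (\<sigma> v). hdeg E \<sigma> v) / 12"

text \<open>This measures the remaining phases instead of messages, so the ranks are not weighted.
  They are doubled so that the drop of one rank outweighs the unit for remaining roots. A forced
  departure adds at most 6, which together with that unit makes 7 per update.\<close>

definition muB :: "nat set \<Rightarrow> gstate \<Rightarrow> nat" where
  "muB V \<sigma> = 2 * (\<Sum>v\<in>V. rk (cls (\<sigma> v))) + (if rootsB \<sigma> = {} then 0 else 1)"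

definition muA :: "nat set \<Rightarrow> gstate \<Rightarrow> nat" where
  "muA V \<sigma> = 2 * (\<Sum>v\<in>V. rankA \<sigma> v) + 2 * card {v. ann (\<sigma> v)} + (if \<exists>v. unc (\<sigma> v) then 1 else 0)"

lemma gpow_nonneg [simp]: "0 \<le> gpow E" by (simp add: gpow_def)

lemma wt_nonneg [simp]: "0 \<le> wt E v" by (simp add: wt_def)

lemma excess_nonneg [simp]: "0 \<le> excess E v" by (simp add: excess_def)

section \<open>Amortization over the phases of one update\<close>

context net
begin

lemma T_mult: "(0::real) \<le> x \<Longrightarrow> x \<le> real (T n) * x"
  using T mult_right_mono[of 1 "real (T n)" x] by (simp add: One_nat_def)

lemma d_le_wt: "real (d v) \<le> wt E v"
  by (simp add: wt_def)

lemma stateA_sub: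
  assumes "stateA V E \<sigma>"
  shows "{v. ann (\<sigma> v)} \<subseteq> V" "{v. conv (\<sigma> v)} \<subseteq> V" "{v. unc (\<sigma> v)} \<subseteq> V"
    "finite {v. ann (\<sigma> v)}" "finite {v. conv (\<sigma> v)}" "finite {v. unc (\<sigma> v)}"
proof -
  interpret stateA V E \<sigma> by (rule assms)
  have aw: "awake (\<sigma> v)" if "ann (\<sigma> v) \<or> conv (\<sigma> v) \<or> unc (\<sigma> v)" for v
    using a_ok[of v] clean_sel[of "\<sigma> v"] that by (auto simp: okay_def)
  then show "{v. ann (\<sigma> v)} \<subseteq> V" "{v. conv (\<sigma> v)} \<subseteq> V" "{v. unc (\<sigma> v)} \<subseteq> V" using a_awV by blast+
  then show "finite {v. ann (\<sigma> v)}" "finite {v. conv (\<sigma> v)}" "finite {v. unc (\<sigma> v)}"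
    using finV finite_subset by blast+
qed

text \<open>The origin of the 3 in \<open>excess\<close>: a vertex converts only up to degree
  \<open>(4 * card E) powr (2/3)\<close>, so it starts its time as a light vertex without
  savings.\<close>

lemma excess_conv: "d v ^ 3 \<le> (4 * card E) ^ 2 \<Longrightarrow> excess E v = 0"
proof -
  assume "d v ^ 3 \<le> (4 * card E) ^ 2"
  then have "real (d v) \<le> real (4 * card E) powr (2/3)" by (rule cube_le_imp_powr)
  also have "\<dots> \<le> 3 * gpow E" using four_powr_le[of "real (card E)"] by (simp add: gpow_def)
  finally show ?thesis by (simp add: excess_def)
qed

lemma sum_indicator: "B \<subseteq> V \<Longrightarrow> (\<Sum>v\<in>V. if v \<in> B then f v else 0) = (\<Sum>v\<in>B. f v :: real)"
  using finV by (simp add: sum.inter_restrict[symmetric] Int_absorb1)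

lemma sum_indicator_nat: "B \<subseteq> V \<Longrightarrow> (\<Sum>v\<in>V. if v \<in> B then 1 else 0) = (card B :: nat)"
  using finV by (simp add: sum.inter_restrict[symmetric] Int_absorb1)

lemma costB:
  assumes B: "stateB V E \<sigma>"
  defines "\<sigma>' \<equiv> snd (run 9 (0, \<sigma>))"
  shows "real (msgs 9 (0, \<sigma>)) + 72 * real (T n) * potA V E \<sigma>' \<le> 72 * real (T n) * potB V E \<sigma>"
    and "muA V \<sigma>' \<le> muB V \<sigma>"
proof -
  note sb = segB[OF B, folded \<sigma>'_def]
  interpret stateA V E \<sigma>' by (rule sb(2))
  note sub = stateA_sub[OF sb(2)]
  let ?Q = "{v. conv (\<sigma>' v)}" and ?Y = "{v. ann (\<sigma>' v)}"
  have rk: "rk (cls (\<sigma> v)) = rankA \<sigma>' v + (if v \<in> ?Q then 1 else 0) + (if v \<in> ?Y then 1 else 0)" for v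
    using sb(3)[of v] a_conv[of v] a_ann[of v] by (auto simp: rankA_def rk_def)
  have ex: "(if cls (\<sigma>' v) \<noteq> 3 \<or> conv (\<sigma>' v) then 4 * excess E v else 0) =
      (if cls (\<sigma> v) \<noteq> 3 then 4 * excess E v else 0)" for v
    using sb(3)[of v] a_conv[of v] a_ann[of v] excess_conv[OF sb(4)[of v]] by auto
  have "(\<Sum>v\<in>V. real (rk (cls (\<sigma> v))) * wt E v + (if cls (\<sigma> v) \<noteq> 3 then 4 * excess E v else 0)) =
      (\<Sum>v\<in>V. (real (rankA \<sigma>' v) * wt E v + (if cls (\<sigma>' v) \<noteq> 3 \<or> conv (\<sigma>' v) then 4 * excess E v else 0))
        + (if v \<in> ?Q then wt E v else 0) + (if v \<in> ?Y then wt E v else 0))"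
    unfolding rk ex by (rule sum.cong) (auto simp: algebra_simps)
  also have "\<dots> = (\<Sum>v\<in>V. real (rankA \<sigma>' v) * wt E v + (if cls (\<sigma>' v) \<noteq> 3 \<or> conv (\<sigma>' v) then 4 * excess E v else 0))
      + (\<Sum>v\<in>?Q. wt E v) + (\<Sum>v\<in>?Y. wt E v)"
    using sum_indicator[OF sub(2), of "wt E"] sum_indicator[OF sub(1), of "wt E"]
    by (simp add: sum.distrib)
  finally have base: "base V E \<sigma> = potA V E \<sigma>' - real (\<Sum>v | unc (\<sigma>' v). hdeg E \<sigma>' v) / 12
      + (\<Sum>v\<in>?Q. wt E v) + (\<Sum>v\<in>?Y. wt E v) / 2"
    by (simp add: potA_def base_def)
  obtain K where K: "msgs 9 (0, \<sigma>) \<le> 6 * K + 4 * pend E \<sigma> + card ?Y"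
      "(\<Sum>v | unc (\<sigma>' v). hdeg E \<sigma>' v) \<le> K"
      "real K \<le> 2 * real (\<Sum>v\<in>?Q. d v) + 3 * real (card (rootsB \<sigma>)) * gpow E"
    using sb(5) unfolding gpow_def by blast
  have Y: "real (card ?Y) \<le> (\<Sum>v\<in>?Y. wt E v)"
  proof -
    have "real (card ?Y) = (\<Sum>v\<in>?Y. 1)" by simp
    also have "\<dots> \<le> (\<Sum>v\<in>?Y. wt E v)"
    proof (rule sum_mono)
      fix v assume "v \<in> ?Y"
      then have "N v \<noteq> {}" using a_ann by blast
      then have "real (d v) \<ge> 1" using finN by (simp add: One_nat_def Suc_le_eq card_gt_0_iff)
      then show "1 \<le> wt E v" using d_le_wt[of v] by linarith
    qed
    finally show ?thesis .
  qed
  have Q: "real (\<Sum>v\<in>?Q. d v) \<le> (\<Sum>v\<in>?Q. wt E v)" using d_le_wt by (simp add: sum_mono)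
  have nn: "0 \<le> (\<Sum>v\<in>?Q. wt E v)" by (simp add: sum_nonneg)
  have m: "real (msgs 9 (0, \<sigma>)) \<le> 6 * real K + 4 * real (pend E \<sigma>) + real (card ?Y)"
    using K(1) by linarith
  also have "\<dots> \<le> real (T n) * (6 * real K + 4 * real (pend E \<sigma>) + real (card ?Y))"
    by (rule T_mult) simp
  finally have m: "real (msgs 9 (0, \<sigma>)) \<le> real (T n) * (6 * real K + 4 * real (pend E \<sigma>) + real (card ?Y))" .
  have "6 * real K + 4 * real (pend E \<sigma>) + real (card ?Y) \<le> 72 * (potB V E \<sigma> - potA V E \<sigma>')"
  proof -
    define q y h r where "q = (\<Sum>v\<in>?Q. wt E v)" "y = (\<Sum>v\<in>?Y. wt E v)"
      "h = real (\<Sum>v | unc (\<sigma>' v). hdeg E \<sigma>' v)" "r = real (card (rootsB \<sigma>)) * gpow E"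
    note D = q_y_h_r_def
    have "potB V E \<sigma> - potA V E \<sigma>' = q + y / 2 - h / 12 + real (pend E \<sigma>) / 8 + r / 2"
      unfolding potB_def base D by simp
    moreover have "h \<le> real K" unfolding D using K(2) by (simp only: of_nat_le_iff)
    \<comment> \<open>Scaled by 72, each ping needs 12: six for messages and six because
      \<open>h / 12\<close> is put aside for the uncovered vertices. This amounts to
      \<open>24 * q + 36 * r\<close>, within the available \<open>72 * q\<close> and exhausting the
      \<open>36 * r\<close>.\<close>
    moreover have "real K \<le> 2 * q + 3 * r" using K(3) Q unfolding D by linarith
    ultimately show ?thesis using Y nn unfolding D(1,2)[symmetric] by simp
  qed
  then have "real (T n) * (6 * real K + 4 * real (pend E \<sigma>) + real (card ?Y)) \<le>
      real (T n) * (72 * (potB V E \<sigma> - potA V E \<sigma>'))" by (rule mult_left_mono) simp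
  with m show "real (msgs 9 (0, \<sigma>)) + 72 * real (T n) * potA V E \<sigma>' \<le> 72 * real (T n) * potB V E \<sigma>"
    by (simp add: algebra_simps)
  have "(\<Sum>v\<in>V. rk (cls (\<sigma> v))) = (\<Sum>v\<in>V. rankA \<sigma>' v) + card ?Q + card ?Y"
    unfolding rk using sum_indicator_nat[OF sub(2)] sum_indicator_nat[OF sub(1)]
    by (simp add: sum.distrib)
  moreover have "(if \<exists>v. unc (\<sigma>' v) then 1 else 0) \<le> (if rootsB \<sigma> = {} then 0 else (1::nat))"
    using sb(6) by auto
  ultimately show "muA V \<sigma>' \<le> muB V \<sigma>" unfolding muA_def muB_def by linarith
qed

lemma costA:
  assumes Ast: "stateA V E \<sigma>"
  defines "\<sigma>' \<equiv> snd (run (2 + T n) (9, \<sigma>))"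
  shows "real (msgs (2 + T n) (9, \<sigma>)) + 72 * real (T n) * potB V E \<sigma>' \<le> 72 * real (T n) * potA V E \<sigma>"
    and "awake (\<sigma> v) \<Longrightarrow> muB V \<sigma>' < muA V \<sigma>"
proof -
  note sa = segA[OF Ast, folded \<sigma>'_def]
  interpret stateA V E \<sigma> by (rule Ast)
  note sub = stateA_sub[OF Ast]
  let ?Q = "{v. conv (\<sigma> v)}" and ?Y = "{v. ann (\<sigma> v)}"
  have rk: "rk (cls (\<sigma>' v)) + (if v \<in> ?Q then 1 else 0) \<le> rankA \<sigma> v" for v
    using sa(3)[of v] sa(4)[of v] by (auto simp: rankA_def rk_def)
  have ex: "(if cls (\<sigma>' v) \<noteq> 3 then 4 * excess E v else 0) \<le>
      (if cls (\<sigma> v) \<noteq> 3 \<or> conv (\<sigma> v) then 4 * excess E v else 0)" for v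
    using sa(3)[of v] by auto
  have "base V E \<sigma>' + (\<Sum>v\<in>?Q. wt E v) =
     (\<Sum>v\<in>V. real (rk (cls (\<sigma>' v)) + (if v \<in> ?Q then 1 else 0)) * wt E v +
       (if cls (\<sigma>' v) \<noteq> 3 then 4 * excess E v else 0))"
  proof -
    have "(\<Sum>v\<in>V. real (rk (cls (\<sigma>' v)) + (if v \<in> ?Q then 1 else 0)) * wt E v +
       (if cls (\<sigma>' v) \<noteq> 3 then 4 * excess E v else 0)) =
       (\<Sum>v\<in>V. (real (rk (cls (\<sigma>' v))) * wt E v + (if cls (\<sigma>' v) \<noteq> 3 then 4 * excess E v else 0))
         + (if v \<in> ?Q then wt E v else 0))"
      by (rule sum.cong) (auto simp: algebra_simps)
    then show ?thesis unfolding base_def using sum_indicator[OF sub(2), of "wt E"] by (simp add: sum.distrib)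
  qed
  also have "\<dots> \<le> (\<Sum>v\<in>V. real (rankA \<sigma> v) * wt E v +
      (if cls (\<sigma> v) \<noteq> 3 \<or> conv (\<sigma> v) then 4 * excess E v else 0))"
  proof (intro sum_mono add_mono mult_right_mono ex)
    fix v
    show "real (rk (cls (\<sigma>' v)) + (if v \<in> ?Q then 1 else 0)) \<le> real (rankA \<sigma> v)"
      using rk[of v] by (simp only: of_nat_le_iff)
  qed simp
  finally have base: "base V E \<sigma>' + (\<Sum>v\<in>?Q. wt E v) + (\<Sum>v\<in>?Y. wt E v) / 2 +
      real (\<Sum>v | unc (\<sigma> v). hdeg E \<sigma> v) / 12 \<le> potA V E \<sigma>" by (simp add: potA_def)
  define a c u where "a = real (\<Sum>v\<in>?Y. d v)" "c = real (\<Sum>v\<in>?Q. d v)" "u = real (\<Sum>v | unc (\<sigma> v). hdeg E \<sigma> v)"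
  note acu = a_c_u_def
  have nn: "a \<ge> 0" "c \<ge> 0" "u \<ge> 0" by (simp_all add: acu sum_nonneg)
  have Y: "(\<Sum>v\<in>?Y. wt E v) = a + real (card ?Y) * gpow E"
  proof -
    have "(\<Sum>v\<in>?Y. wt E v) = (\<Sum>v\<in>?Y. real (d v) + gpow E)"
      by (rule sum.cong) (use a_ann in \<open>auto simp: wt_def\<close>)
    then show ?thesis by (simp add: acu sum.distrib)
  qed
  have Q: "(\<Sum>v\<in>?Q. wt E v) = c + real (card ?Q) * gpow E"
  proof -
    have "(\<Sum>v\<in>?Q. wt E v) = (\<Sum>v\<in>?Q. real (d v) + gpow E)"
      by (rule sum.cong) (use a_conv in \<open>auto simp: wt_def\<close>)
    then show ?thesis by (simp add: acu sum.distrib)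
  qed
  have "real (msgs (2 + T n) (9, \<sigma>)) \<le> real ((\<Sum>v\<in>?Y. d v) +
      (1 + T n) * ((\<Sum>v\<in>?Q. d v) + (\<Sum>v | unc (\<sigma> v). hdeg E \<sigma> v)))"
    using sa(5) by (simp only: of_nat_le_iff)
  also have "\<dots> = a + (1 + real (T n)) * (c + u)" by (simp add: acu)
  also have "\<dots> \<le> real (T n) * a + 2 * real (T n) * (c + u)"
  proof (intro add_mono mult_right_mono)
    show "a \<le> real (T n) * a" using nn by (intro T_mult)
    show "1 + real (T n) \<le> 2 * real (T n)" using T by simp
  qed (use nn in auto)
  finally have m: "real (msgs (2 + T n) (9, \<sigma>)) \<le> real (T n) * (a + 2 * c + 2 * u)"
    by (simp add: algebra_simps)
  have pend: "real (pend E \<sigma>') \<le> 2 * a + 4 * c"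
  proof -
    have "real (pend E \<sigma>') \<le> real (2 * (\<Sum>v\<in>?Y. d v) + 4 * (\<Sum>v\<in>?Q. d v))"
      using sa(6) by (simp only: of_nat_le_iff)
    then show ?thesis by (simp add: acu)
  qed
  have "card (rootsB \<sigma>') \<le> card (?Y \<union> ?Q)" using sub sa(7) by (intro card_mono) auto
  then have "real (card (rootsB \<sigma>')) \<le> real (card ?Y) + real (card ?Q)"
    using card_Un_le[of ?Y ?Q] by linarith
  then have roots: "real (card (rootsB \<sigma>')) * gpow E \<le> (real (card ?Y) + real (card ?Q)) * gpow E"
    by (rule mult_right_mono) simp
  have gQ: "0 \<le> real (card ?Q) * gpow E" by simp
  have "a + 2 * c + 2 * u \<le> 72 * (potA V E \<sigma> - potB V E \<sigma>')"
  proof -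
    define p r k q where "p = real (pend E \<sigma>')" "r = real (card (rootsB \<sigma>')) * gpow E"
      "k = real (card ?Y) * gpow E" "q = real (card ?Q) * gpow E"
    note D = p_r_k_q_def
    have "potB V E \<sigma>' + (c + q) + (a + k) / 2 + u / 12 \<le> potA V E \<sigma> + p / 8 + r / 2"
      using base unfolding Y Q acu(3)[symmetric] potB_def D by simp
    \<comment> \<open>Each new root is an entering or a converting vertex. An entering one has kept
      half of its \<open>gpow E\<close>, which is what \<open>potB\<close> demands for a root; a
      converting one releases all of it. Similarly \<open>p / 8\<close> is at most
      \<open>a / 4 + c / 2\<close>.\<close>
    moreover have "r \<le> k + q" using roots unfolding D by (simp add: algebra_simps)
    moreover have "p \<le> 2 * a + 4 * c" "0 \<le> q" using pend gQ unfolding D by simp_all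
    ultimately show ?thesis using nn by argo
  qed
  then have "real (T n) * (a + 2 * c + 2 * u) \<le> real (T n) * (72 * (potA V E \<sigma> - potB V E \<sigma>'))"
    by (rule mult_left_mono) simp
  with m show "real (msgs (2 + T n) (9, \<sigma>)) + 72 * real (T n) * potB V E \<sigma>' \<le> 72 * real (T n) * potA V E \<sigma>"
    by (simp add: algebra_simps)
  assume "awake (\<sigma> v)"
  then have aw: "(\<exists>v. conv (\<sigma> v)) \<or> (\<exists>v. unc (\<sigma> v)) \<or> (\<exists>v. ann (\<sigma> v))"
    using a_awake[of v] a_pick[of v] by blast
  have "(\<Sum>v\<in>V. rk (cls (\<sigma>' v))) + card ?Q \<le> (\<Sum>v\<in>V. rankA \<sigma> v)"
  proof -
    have "(\<Sum>v\<in>V. rk (cls (\<sigma>' v)) + (if v \<in> ?Q then 1 else 0)) \<le> (\<Sum>v\<in>V. rankA \<sigma> v)"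
      by (rule sum_mono) (rule rk)
    then show ?thesis unfolding sum.distrib sum_indicator_nat[OF sub(2)] .
  qed
  \<comment> \<open>If no vertex enters or converts, no root remains and the unit for uncovered
    vertices is lost. Otherwise 2 is lost, which outweighs the unit for new roots.\<close>
  moreover have "(if rootsB \<sigma>' = {} then 0 else 1) < 2 * card ?Q + 2 * card ?Y + (if \<exists>v. unc (\<sigma> v) then 1 else (0::nat))"
  proof (cases "?Q = {} \<and> ?Y = {}")
    case True
    then have "rootsB \<sigma>' = {}" using sa(7) by auto
    then show ?thesis using True aw by auto
  next
    case False
    then have "card ?Q \<ge> 1 \<or> card ?Y \<ge> 1" using sub by (auto simp: One_nat_def Suc_le_eq card_gt_0_iff)
    then show ?thesis by auto
  qed
  ultimately show "muB V \<sigma>' < muA V \<sigma>" unfolding muA_def muB_def by linarith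
qed

text \<open>Induction on \<open>muA\<close>: while a vertex is awake, one run followed by one
  exploration lowers it. The number \<open>j\<close> of repetitions is thus paid by the
  decrease.\<close>

lemma phases:
  assumes "stateA V E \<sigma>"
  shows "\<exists>j \<sigma>'. run (j * (11 + T n)) (9, \<sigma>) = (9, \<sigma>') \<and> stateA V E \<sigma>' \<and> asleep \<sigma>' \<and>
    real (msgs (j * (11 + T n)) (9, \<sigma>)) + 72 * real (T n) * potA V E \<sigma>' \<le> 72 * real (T n) * potA V E \<sigma> \<and>
    j + muA V \<sigma>' \<le> muA V \<sigma> \<and> fit (j * (11 + T n)) (9, \<sigma>)"
  using assms
proof (induction "muA V \<sigma>" arbitrary: \<sigma> rule: less_induct)
  case less
  show ?case
  proof (cases "\<exists>v. awake (\<sigma> v)")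
    case False
    then have "asleep \<sigma>" using stateA.a_ok[OF less.prems] by (auto simp: asleep_def okay_def)
    then show ?thesis using less.prems by (intro exI[of _ 0] exI[of _ \<sigma>]) (simp add: gmsgs_def)
  next
    case True
    then obtain v where v: "awake (\<sigma> v)" by blast
    define \<sigma>1 where "\<sigma>1 = snd (run (2 + T n) (9, \<sigma>))"
    define \<sigma>2 where "\<sigma>2 = snd (run 9 (0, \<sigma>1))"
    note a = segA[OF less.prems, folded \<sigma>1_def] and ca = costA[OF less.prems, folded \<sigma>1_def]
    note b = segB[OF a(2), folded \<sigma>2_def] and cb = costB[OF a(2), folded \<sigma>2_def]
    have lt: "muA V \<sigma>2 < muA V \<sigma>" using ca(2)[OF v] cb(2) by simp
    from less.hyps[OF lt b(2)] obtain j \<sigma>' where j: "run (j * (11 + T n)) (9, \<sigma>2) = (9, \<sigma>')"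
      "stateA V E \<sigma>'" "asleep \<sigma>'"
      "real (msgs (j * (11 + T n)) (9, \<sigma>2)) + 72 * real (T n) * potA V E \<sigma>' \<le> 72 * real (T n) * potA V E \<sigma>2"
      "j + muA V \<sigma>' \<le> muA V \<sigma>2" "fit (j * (11 + T n)) (9, \<sigma>2)" by blast
    have e: "Suc j * (11 + T n) = (2 + T n) + (9 + j * (11 + T n))" by simp
    have "run (Suc j * (11 + T n)) (9, \<sigma>) = (9, \<sigma>')"
      unfolding e grun_add[of A T n E "2 + T n"] a(1) grun_add[of A T n E 9] b(1) by (rule j(1))
    moreover have "msgs (Suc j * (11 + T n)) (9, \<sigma>) =
        msgs (2 + T n) (9, \<sigma>) + msgs 9 (0, \<sigma>1) + msgs (j * (11 + T n)) (9, \<sigma>2)"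
      unfolding e gmsgs_add[of A T n E "2 + T n"] a(1) gmsgs_add[of A T n E 9] b(1) by simp
    then have "real (msgs (Suc j * (11 + T n)) (9, \<sigma>)) + 72 * real (T n) * potA V E \<sigma>' \<le> 72 * real (T n) * potA V E \<sigma>"
      using ca(1) cb(1) j(4) by simp
    moreover have "fit (Suc j * (11 + T n)) (9, \<sigma>)"
    proof -
      have "fit (9 + j * (11 + T n)) (0, \<sigma>1)" by (rule fit_add[OF b(7)]) (use b(1) j(6) in simp)
      then show ?thesis unfolding e by (intro fit_add[OF a(8)]) (use a(1) in simp)
    qed
    moreover have "Suc j + muA V \<sigma>' \<le> muA V \<sigma>" using j(5) lt by simp
    ultimately show ?thesis using j(2,3) by blast
  qed
qed

text \<open>An update enters the cycle at position 0, halfway through a phase. When all are asleep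
  nothing is pending, so the potential has shrunk to \<open>base\<close>.\<close>

lemma from_stateB:
  assumes B: "stateB V E \<sigma>"
  shows "\<exists>j \<sigma>'. run (9 + j * (11 + T n)) (0, \<sigma>) = (9, \<sigma>') \<and> stateA V E \<sigma>' \<and> asleep \<sigma>' \<and>
    real (msgs (9 + j * (11 + T n)) (0, \<sigma>)) + 72 * real (T n) * base V E \<sigma>' \<le> 72 * real (T n) * potB V E \<sigma> \<and>
    j + 2 * (\<Sum>v\<in>V. rk (cls (\<sigma>' v))) \<le> muB V \<sigma> \<and> fit (9 + j * (11 + T n)) (0, \<sigma>)"
proof -
  define \<sigma>1 where "\<sigma>1 = snd (run 9 (0, \<sigma>))"
  note b = segB[OF B, folded \<sigma>1_def] and cb = costB[OF B, folded \<sigma>1_def]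
  from phases[OF b(2)] obtain j \<sigma>' where j: "run (j * (11 + T n)) (9, \<sigma>1) = (9, \<sigma>')"
      "stateA V E \<sigma>'" "asleep \<sigma>'"
      "real (msgs (j * (11 + T n)) (9, \<sigma>1)) + 72 * real (T n) * potA V E \<sigma>' \<le> 72 * real (T n) * potA V E \<sigma>1"
      "j + muA V \<sigma>' \<le> muA V \<sigma>1" "fit (j * (11 + T n)) (9, \<sigma>1)" by blast
  have cl: "\<not> ann (\<sigma>' v)" "\<not> conv (\<sigma>' v)" "\<not> unc (\<sigma>' v)" for v
    using j(3) clean_sel[of "\<sigma>' v"] by (auto simp: asleep_def)
  have pa: "potA V E \<sigma>' = base V E \<sigma>'" "muA V \<sigma>' = 2 * (\<Sum>v\<in>V. rk (cls (\<sigma>' v)))"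
    by (simp_all add: potA_def base_def muA_def rankA_def cl)
  have "run (9 + j * (11 + T n)) (0, \<sigma>) = (9, \<sigma>')" unfolding grun_add b(1) by (rule j(1))
  moreover have "real (msgs (9 + j * (11 + T n)) (0, \<sigma>)) + 72 * real (T n) * base V E \<sigma>' \<le> 72 * real (T n) * potB V E \<sigma>"
    using cb(1) j(4) unfolding gmsgs_add b(1) pa by simp
  moreover have "fit (9 + j * (11 + T n)) (0, \<sigma>)"
    by (rule fit_add[OF b(7)]) (use b(1) j(6) in simp)
  moreover have "j + 2 * (\<Sum>v\<in>V. rk (cls (\<sigma>' v))) \<le> muB V \<sigma>" using j(5) cb(2) pa by simp
  ultimately show ?thesis using j(2,3) by blast
qed

end

section \<open>Processing an update\<close>

text \<open>What the update itself may do before the first phase: a light vertex enters after a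
  deletion, or a light member is forced out and becomes heavy. The set \<open>B\<close> is meant to
  be the pair of endpoints.\<close>

definition touched :: "nat set \<Rightarrow> gstate \<Rightarrow> gstate \<Rightarrow> bool" where
  "touched B \<sigma> \<sigma>' \<longleftrightarrow>
    (\<forall>v. if ann (\<sigma>' v) then cls (\<sigma> v) = 1 \<and> cls (\<sigma>' v) = 2 \<or> cls (\<sigma> v) = 2 \<and> cls (\<sigma>' v) = 3
         else cls (\<sigma>' v) = cls (\<sigma> v)) \<and>
    (\<forall>v. ann (\<sigma>' v) \<or> left (\<sigma>' v) \<or> ask (\<sigma>' v) \<longrightarrow> v \<in> B) \<and>
    (\<forall>v. left (\<sigma>' v) \<longrightarrow> lroot (\<sigma>' v) = v \<and> cls (\<sigma>' v) = 3) \<and>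
    (\<forall>v. coord (\<sigma>' v) = None)"

text \<open>The situation between two updates. No candidate is left then, as its coordinator would
  not be clean.\<close>

locale quiet = stateA +
  assumes asleep: "asleep \<sigma>"
begin

lemma q_flags: "\<not> awake (\<sigma> v)" "clean (\<sigma> v)" "\<not> ann (\<sigma> v)" "\<not> conv (\<sigma> v)" "\<not> unc (\<sigma> v)" "\<not> left (\<sigma> v)"
  "\<not> ask (\<sigma> v)" "cands (\<sigma> v) = {}"
  using asleep clean_sel[of "\<sigma> v"] by (auto simp: asleep_def)

lemma q_coord: "coord (\<sigma> v) = None"
proof (rule ccontr)
  assume "coord (\<sigma> v) \<noteq> None"
  then obtain c where "v \<in> cands (\<sigma> c)" using a_cands by blast
  then show False using q_flags by simp
qed

lemma q_nbc: "nbc (\<sigma> v) u = (if u \<in> neighbors E v then cls (\<sigma> u) else 0)"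
  using a_nbc q_flags by simp

lemma q_ln: "cls (\<sigma> v) = 1 \<Longrightarrow> \<exists>u\<in>neighbors E v. cls (\<sigma> u) = 2"
  using a_ln q_coord by blast

lemma q_hm: "hm (\<sigma> v) \<Longrightarrow> u \<in> neighbors E v \<Longrightarrow> \<not> hm (\<sigma> u) \<and> cls (\<sigma> u) \<noteq> 2"
  using a_hm q_flags by blast

lemma q_h: "cls (\<sigma> v) = 3 \<Longrightarrow> \<not> hm (\<sigma> v) \<Longrightarrow> \<exists>u\<in>neighbors E v. cls (\<sigma> u) = 2 \<or> hm (\<sigma> u)"
  using a_h q_flags by blast

end

context net
begin

lemma run_PX: "run 1 (11 + T n, \<sigma>) = (0, ground A T n E (11 + T n) \<sigma>)"
  using run_Suc[of 0 "(11 + T n, \<sigma>)"] by (simp add: next_pos_def One_nat_def)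

lemma vsend_PX: "vsend A T n (11 + T n) u s v =
    (if awake s \<and> nbc s v = 9 then Some (cls s, if hm s then 1 else 0, []) else None)"
  by (simp add: vsend_def)

lemma vnext_PX: "vnext A T n (11 + T n) v s ib = (if awake s then step_exchange v s ib else s)"
  by (simp add: vnext_def)

lemma insertion:
  assumes q: "quiet V E0 \<sigma>" and ab: "a \<in> V" "b \<in> V" "a \<noteq> b" "{a, b} \<notin> E0" and E: "E = insert {a, b} E0"
  defines "\<sigma>' \<equiv> ground A T n E (11 + T n) (gevent (Ins a b) \<sigma>)"
  shows "stateB V E \<sigma>'" and "touched {a, b} \<sigma> \<sigma>'"
    and "gcount A T n E (11 + T n) (gevent (Ins a b) \<sigma>) \<le> 2"
    and "gfits (ce + 3) (be + 1) A T n E (11 + T n) (gevent (Ins a b) \<sigma>)"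
proof -
  interpret q: quiet V E0 \<sigma> by (rule q)
  define \<tau> where "\<tau> = gevent (Ins a b) \<sigma>"
  define oth where "oth v = (if v = a then b else a)" for v
  have oth: "oth a = b" "oth b = a" using ab by (auto simp: oth_def)
  have Niff: "u \<in> N v \<longleftrightarrow> u \<in> neighbors E0 v \<or> (v = a \<and> u = b \<or> v = b \<and> u = a)" for u v
    unfolding E neighbors_def by (auto simp: doubleton_eq_iff)
  have n0: "b \<notin> neighbors E0 a" "a \<notin> neighbors E0 b"
    using ab(4) by (auto simp: neighbors_def insert_commute)
  have \<tau>: "\<tau> v = (if v = a \<or> v = b then ev_ins (oth v) (\<sigma> v) else \<sigma> v)" for v
    using ab by (auto simp: \<tau>_def oth_def)
  have nine: "nbc (\<tau> v) u = 9 \<longleftrightarrow> (v = a \<and> u = b \<or> v = b \<and> u = a)" for u v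
  proof -
    have "nbc (\<sigma> v) u \<noteq> 9" using q.a_cls[of u] by (auto simp: q.q_nbc)
    then show ?thesis using oth by (auto simp: \<tau> ev_ins_def)
  qed
  have aw\<tau>: "awake (\<tau> v) \<longleftrightarrow> v = a \<or> v = b" for v using q.q_flags by (simp add: \<tau> ev_ins_def)
  have c\<tau>: "cls (\<tau> v) = cls (\<sigma> v)" "hm (\<tau> v) = hm (\<sigma> v)" "ann (\<tau> v) = False" "left (\<tau> v) = False"
    "ask (\<tau> v) = False" "coord (\<tau> v) = None" "cands (\<tau> v) = {}" for v
    using q.q_flags q.q_coord by (simp_all add: \<tau> ev_ins_def)
  have gin: "G (11 + T n) \<tau> v u = (if v = a \<and> u = b \<or> v = b \<and> u = a
      then Some (cls (\<sigma> u), if hm (\<sigma> u) then 1 else 0, []) else None)" for u v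
    unfolding gin_in vsend_PX using nine[of u v] aw\<tau> Niff by (auto simp: c\<tau>)
  define cf where "cf v \<longleftrightarrow> (v = a \<or> v = b) \<and>
     (cls (\<sigma> v) = 2 \<and> cls (\<sigma> (oth v)) = 2 \<and> oth v < v \<or>
      hm (\<sigma> v) \<and> (cls (\<sigma> (oth v)) = 2 \<or> hm (\<sigma> (oth v)) \<and> oth v < v))" for v
  have conflict: "(\<exists>u k j m. nbc (\<tau> v) u = 9 \<and> G (11 + T n) \<tau> v u = Some (k, j, m) \<and>
           (cls (\<tau> v) = 2 \<and> k = 2 \<and> u < v \<or> hm (\<tau> v) \<and> (k = 2 \<or> j = 1 \<and> u < v))) \<longleftrightarrow> cf v" for v
    unfolding nine gin cf_def c\<tau> using oth ab(3) by auto
  have f: "(if nbc (\<tau> v) u = 9 then (case G (11 + T n) \<tau> v u of None \<Rightarrow> 0 | Some x \<Rightarrow> fst x) else nbc (\<tau> v) u)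
      = (if u \<in> N v then cls (\<sigma> u) else 0)" if "v = a \<or> v = b" for u v
    using that nine[of v u] oth n0 ab(3) by (auto simp: gin Niff \<tau> ev_ins_def q.q_nbc)
  have s: "\<sigma>' v = (if v = a \<or> v = b then
      if cf v then (\<tau> v)\<lparr>nbc := \<lambda>u. if u \<in> N v then cls (\<sigma> u) else 0, left := True, lroot := v,
         ann := cls (\<sigma> v) = 2, cls := 3, hm := False\<rparr>
      else fresh (cls (\<sigma> v)) (hm (\<sigma> v)) (\<lambda>u. if u \<in> N v then cls (\<sigma> u) else 0) None
     else \<sigma> v)" for v
  proof (cases "v = a \<or> v = b")
    case True
    then show ?thesis
      unfolding \<sigma>'_def ground_def \<tau>_def[symmetric] vnext_PX aw\<tau> step_exchange_def Let_def conflict f[OF True]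
      by (simp add: c\<tau>)
  next
    case False
    then show ?thesis unfolding \<sigma>'_def ground_def \<tau>_def[symmetric] vnext_PX aw\<tau> by (simp add: \<tau>)
  qed
  have C: "cls (\<sigma>' v) = (if cf v then 3 else cls (\<sigma> v))" for v
    using cf_def[of v] by (auto simp: s)
  have H: "hm (\<sigma>' v) \<longleftrightarrow> hm (\<sigma> v) \<and> \<not> cf v" for v using cf_def[of v] by (auto simp: s)
  \<comment> \<open>The views hold the classes from before the update: a vertex forced out is still
    seen in class 2, as \<open>b_nbc\<close> demands until its announcement.\<close>
  have Nb: "nbc (\<sigma>' v) u = (if u \<in> N v then cls (\<sigma> u) else 0)" for v u
    using Niff[of u v] by (auto simp: s q.q_nbc)
  have "cf v \<Longrightarrow> v = a \<or> v = b" for v by (simp add: cf_def)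
  then have Fl0: "(ann (\<sigma>' v) \<longleftrightarrow> cf v \<and> cls (\<sigma> v) = 2) \<and> (left (\<sigma>' v) \<longleftrightarrow> cf v) \<and> (left (\<sigma>' v) \<longrightarrow> lroot (\<sigma>' v) = v) \<and>
    \<not> ask (\<sigma>' v) \<and> coord (\<sigma>' v) = None \<and> cands (\<sigma>' v) = {} \<and> (awake (\<sigma>' v) \<longleftrightarrow> cf v)" for v
    by (cases "v = a \<or> v = b"; cases "cf v") (simp_all add: s c\<tau> aw\<tau> q.q_flags q.q_coord)
  have Fl: "ann (\<sigma>' v) \<longleftrightarrow> cf v \<and> cls (\<sigma> v) = 2" "left (\<sigma>' v) \<longleftrightarrow> cf v" "left (\<sigma>' v) \<Longrightarrow> lroot (\<sigma>' v) = v"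
    "\<not> ask (\<sigma>' v)" "coord (\<sigma>' v) = None" "cands (\<sigma>' v) = {}" "awake (\<sigma>' v) \<longleftrightarrow> cf v" for v
    using Fl0[of v] by blast+
  have cf3: "cls (\<sigma> v) = 2 \<or> hm (\<sigma> v) \<and> cls (\<sigma> v) = 3" if "cf v" for v
    using that q.a_hm3[of v] by (auto simp: cf_def)
  \<comment> \<open>Only one endpoint yields, and the other one stays in the MIS and covers
    it.\<close>
  have cf_oth: "\<not> cf (oth v) \<and> (cls (\<sigma> (oth v)) = 2 \<or> hm (\<sigma> (oth v))) \<and> oth v \<in> N v" if "cf v" for v
    using that oth ab(3) q.a_hm3[of v] q.a_hm3[of "oth v"] Niff[of "oth v" v] by (auto simp: cf_def)
  have cf_u: "v = w" if "cf v" "cf w" for v w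
    using that cf_oth[of v] oth by (auto simp: cf_def)
  have cl2: "cls (\<sigma>' u) = 2 \<longleftrightarrow> cls (\<sigma> u) = 2 \<and> \<not> cf u" for u by (simp add: C)
  show "stateB V E \<sigma>'"
  proof
    fix u v c c'
    show "nbc (\<sigma>' v) u = (if u \<in> N v then if ann (\<sigma>' u) then if cls (\<sigma>' u) = 2 then 1 else 2 else cls (\<sigma>' u) else 0)"
      using cf3[of u] by (auto simp: Nb Fl C)
    show "cls (\<sigma>' v) \<in> {1, 2, 3}" using q.a_cls[of v] by (simp add: C)
    show "hm (\<sigma>' v) \<Longrightarrow> cls (\<sigma>' v) = 3" using q.a_hm3[of v] by (simp add: C H)
    show "ask (\<sigma>' v) \<Longrightarrow> cls (\<sigma>' v) = 3 \<and> apar (\<sigma>' v) = v \<and> aroot (\<sigma>' v) = v" by (simp add: Fl)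
    show "left (\<sigma>' v) \<Longrightarrow> lroot (\<sigma>' v) = v \<or> lroot (\<sigma>' v) \<in> N v" using Fl(3) by simp
    show "awake (\<sigma>' v) \<Longrightarrow> v \<in> V" using ab by (auto simp: Fl cf_def)
    have "okay (\<tau> v)" using aw\<tau>[of v] q.a_ok[of v] by (auto simp: okay_def \<tau>)
    then show "okay (\<sigma>' v)" unfolding \<sigma>'_def ground_def \<tau>_def[symmetric] by (rule okay_vnext)
    show "u \<in> N v \<Longrightarrow> cls (\<sigma>' u) = 2 \<Longrightarrow> cls (\<sigma>' v) \<noteq> 2"
    proof
      assume a: "u \<in> N v" "cls (\<sigma>' u) = 2" "cls (\<sigma>' v) = 2"
      then have c: "cls (\<sigma> u) = 2" "cls (\<sigma> v) = 2" "\<not> cf u" "\<not> cf v" by (auto simp: cl2)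
      then have "u \<notin> neighbors E0 v" using q.a_ml by blast
      then have "v = a \<and> u = b \<or> v = b \<and> u = a" using a Niff by blast
      then show False using c oth ab(3) by (auto simp: cf_def)
    qed
    show "cls (\<sigma>' v) = 1 \<Longrightarrow> coord (\<sigma>' v) \<noteq> None \<or> (\<exists>u\<in>N v. cls (\<sigma>' u) = 2 \<or> ann (\<sigma>' u) \<and> cls (\<sigma>' u) = 3)"
    proof -
      assume "cls (\<sigma>' v) = 1"
      then have "cls (\<sigma> v) = 1" by (auto simp: C split: if_splits)
      then obtain u where "u \<in> neighbors E0 v" "cls (\<sigma> u) = 2" using q.q_ln by blast
      then have "u \<in> N v" using Niff by blast
      moreover have "cls (\<sigma>' u) = 2 \<or> ann (\<sigma>' u) \<and> cls (\<sigma>' u) = 3"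
        using \<open>cls (\<sigma> u) = 2\<close> by (cases "cf u") (simp_all add: C Fl(1))
      ultimately show ?thesis by blast
    qed
    show "hm (\<sigma>' v) \<Longrightarrow> u \<in> N v \<Longrightarrow> \<not> hm (\<sigma>' u) \<and> (cls (\<sigma>' u) = 2 \<longrightarrow> ann (\<sigma>' u))"
    proof -
      assume h: "hm (\<sigma>' v)" "u \<in> N v"
      then have hv: "hm (\<sigma> v)" "\<not> cf v" by (auto simp: H)
      show ?thesis
      proof (cases "u \<in> neighbors E0 v")
        case True
        then show ?thesis using q.q_hm[OF hv(1)] by (auto simp: H cl2)
      next
        case False
        then have "v = a \<and> u = b \<or> v = b \<and> u = a" using h Niff by blast
        then have vu: "v = a \<or> v = b" "u = a \<or> u = b" "u \<noteq> v" and ov: "oth v = u" "oth u = v"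
          using oth ab(3) by auto
        have "cls (\<sigma> u) \<noteq> 2" "\<not> (hm (\<sigma> u) \<and> u < v)" using hv vu(1) unfolding cf_def ov by blast+
        moreover have "hm (\<sigma> u) \<Longrightarrow> v < u \<Longrightarrow> cf u" using vu hv unfolding cf_def ov by blast
        ultimately show ?thesis using vu(3) H[of u] cl2[of u] by fastforce
      qed
    qed
    show "cls (\<sigma>' v) = 3 \<Longrightarrow> \<not> hm (\<sigma>' v) \<Longrightarrow> ask (\<sigma>' v) \<or> (\<exists>u\<in>N v. cls (\<sigma>' u) = 2 \<or> hm (\<sigma>' u) \<or> left (\<sigma>' u))"
    proof -
      assume a: "cls (\<sigma>' v) = 3" "\<not> hm (\<sigma>' v)"
      show ?thesis
      proof (cases "cf v")
        case True
        have "oth v \<in> N v" "cls (\<sigma>' (oth v)) = 2 \<or> hm (\<sigma>' (oth v))"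
          using cf_oth[OF True] cl2[of "oth v"] H[of "oth v"] by blast+
        then show ?thesis by blast
      next
        case False
        then have "cls (\<sigma> v) = 3" "\<not> hm (\<sigma> v)" using a by (auto simp: C H)
        then obtain u where "u \<in> neighbors E0 v" "cls (\<sigma> u) = 2 \<or> hm (\<sigma> u)" using q.q_h by blast
        then have "u \<in> N v" "cls (\<sigma>' u) = 2 \<or> hm (\<sigma>' u) \<or> left (\<sigma>' u)"
          using Niff[of u v] cl2[of u] H[of u] Fl(2)[of u] by blast+
        then show ?thesis by blast
      qed
    qed
    show "coord (\<sigma>' v) = Some c \<Longrightarrow> cls (\<sigma>' v) = 1 \<and> \<not> left (\<sigma>' v) \<and> c \<in> N v" by (simp add: Fl)
    show "coord (\<sigma>' v) = Some c \<longleftrightarrow> v \<in> cands (\<sigma>' c)" by (simp add: Fl)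
    show "cands (\<sigma>' c) \<noteq> {} \<Longrightarrow> cands (\<sigma>' c') \<noteq> {} \<Longrightarrow> c = c'" by (simp add: Fl)
    show "ann (\<sigma>' u) \<Longrightarrow> cls (\<sigma>' u) = 3 \<Longrightarrow> (\<forall>c. cands (\<sigma>' c) = {}) \<and>
       (\<forall>w. ann (\<sigma>' w) \<and> cls (\<sigma>' w) = 3 \<longrightarrow> w = u) \<and> (\<forall>w. left (\<sigma>' w) \<longrightarrow> cls (\<sigma>' w) = 3)"
      using cf_u by (auto simp: Fl C)
    show "coord (\<sigma>' v) \<noteq> None \<Longrightarrow> u \<in> N v \<Longrightarrow> cls (\<sigma>' u) = 2 \<Longrightarrow> \<not> ann (\<sigma>' u) \<Longrightarrow> awake (\<sigma>' v)"
      by (simp add: Fl)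
  qed
  show "touched {a, b} \<sigma> \<sigma>'"
    unfolding touched_def using cf3 Fl(3) by (auto simp: Fl C cf_def)
  have "{(u, v). G (11 + T n) \<tau> v u \<noteq> None} \<subseteq> {(a, b), (b, a)}" by (auto simp: gin split: if_splits)
  then have "gcount A T n E (11 + T n) \<tau> \<le> card {(a, b), (b, a)}"
    unfolding gcount_def by (intro card_mono) auto
  then show "gcount A T n E (11 + T n) (gevent (Ins a b) \<sigma>) \<le> 2"
    unfolding \<tau>_def[symmetric] using ab(3) by simp
  have L0: "0 \<le> real (be + 1) * log 2 (real n)" using log_n by (intro mult_nonneg_nonneg) auto
  show "gfits (ce + 3) (be + 1) A T n E (11 + T n) (gevent (Ins a b) \<sigma>)"
    unfolding gfits_def \<tau>_def[symmetric]
  proof (intro allI impI)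
    fix v u i j bs assume "G (11 + T n) \<tau> v u = Some (i, j, bs)"
    then have "i = cls (\<sigma> u)" "j \<le> 1" "bs = []" by (auto simp: gin split: if_splits)
    then show "i < n ^ (ce + 3) \<and> j < n ^ (ce + 3) \<and> real (length bs) \<le> real (be + 1) * log 2 (real n)"
      using const_lt[of i] const_lt[of j] q.a_cls[of u] L0 by auto
  qed
qed

lemma deletion:
  assumes q: "quiet V E0 \<sigma>" and ab: "a \<in> V" "b \<in> V" "a \<noteq> b" "{a, b} \<in> E0" and E: "E = E0 - {{a, b}}"
  defines "\<sigma>' \<equiv> ground A T n E (11 + T n) (gevent (Del a b) \<sigma>)"
  shows "stateB V E \<sigma>'" and "touched {a, b} \<sigma> \<sigma>'"
    and "gcount A T n E (11 + T n) (gevent (Del a b) \<sigma>) \<le> 2"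
    and "gfits (ce + 3) (be + 1) A T n E (11 + T n) (gevent (Del a b) \<sigma>)"
proof -
  interpret q: quiet V E0 \<sigma> by (rule q)
  define \<tau> where "\<tau> = gevent (Del a b) \<sigma>"
  define oth where "oth v = (if v = a then b else a)" for v
  have oth: "oth a = b" "oth b = a" using ab by (auto simp: oth_def)
  have Niff: "u \<in> N v \<longleftrightarrow> u \<in> neighbors E0 v \<and> \<not> (v = a \<and> u = b \<or> v = b \<and> u = a)" for u v
    unfolding E neighbors_def by (auto simp: doubleton_eq_iff)
  have \<tau>: "\<tau> v = (if v = a \<or> v = b then ev_del v (oth v) (\<sigma> v) else \<sigma> v)" for v
    using ab by (auto simp: \<tau>_def oth_def)
  have f: "((nbc (\<sigma> v))(oth v := 0)) u = (if u \<in> N v then cls (\<sigma> u) else 0)" if "v = a \<or> v = b" for u v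
    using that oth ab(3) Niff[of u v] by (auto simp: q.q_nbc)
  define bare where "bare v \<longleftrightarrow> (\<forall>u\<in>N v. cls (\<sigma> u) \<noteq> 2)" for v
  have bare: "(\<forall>w. ((nbc (\<sigma> v))(oth v := 0)) w \<noteq> 2) \<longleftrightarrow> bare v" if "v = a \<or> v = b" for v
    unfolding f[OF that] bare_def by auto
  define up where "up v \<longleftrightarrow> (v = a \<or> v = b) \<and> cls (\<sigma> v) = 1 \<and> bare v" for v
  define aq where "aq v \<longleftrightarrow> (v = a \<or> v = b) \<and> cls (\<sigma> v) = 3 \<and> \<not> hm (\<sigma> v) \<and> bare v" for v
  have nine: "nbc (\<tau> v) u \<noteq> 9" for u v
  proof -
    have "nbc (\<sigma> v) u \<noteq> 9" using q.a_cls[of u] by (auto simp: q.q_nbc)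
    moreover have "v = a \<or> v = b \<Longrightarrow> nbc (\<tau> v) = (nbc (\<sigma> v))(oth v := 0)"
      by (simp add: \<tau> ev_del_def Let_def)
    moreover have "\<not> (v = a \<or> v = b) \<Longrightarrow> \<tau> v = \<sigma> v" by (simp add: \<tau>)
    ultimately show ?thesis by (cases "v = a \<or> v = b") simp_all
  qed
  have aw\<tau>: "awake (\<tau> v) \<longleftrightarrow> v = a \<or> v = b" for v using q.q_flags by (simp add: \<tau> ev_del_def Let_def)
  have gin: "G (11 + T n) \<tau> v u = None" for u v
    unfolding gin_in vsend_PX using nine by simp
  have \<tau>f: "nbc (\<tau> v) = (nbc (\<sigma> v))(oth v := 0)" "ann (\<tau> v) = up v" "ask (\<tau> v) = aq v" "\<not> left (\<tau> v)"
    "cls (\<tau> v) = (if up v then 2 else cls (\<sigma> v))" "hm (\<tau> v) = hm (\<sigma> v)" "coord (\<tau> v) = None"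
    "cands (\<tau> v) = {}" "aq v \<Longrightarrow> apar (\<tau> v) = v \<and> aroot (\<tau> v) = v"
    if "v = a \<or> v = b" for v
    using that bare[OF that] q.q_flags[of v] q.q_coord[of v]
    by (simp_all add: \<tau> ev_del_def Let_def up_def aq_def)
  have s: "\<sigma>' v = (if v = a \<or> v = b then
      if up v \<or> aq v then (\<tau> v)\<lparr>nbc := nbc (\<tau> v)\<rparr> else fresh (cls (\<tau> v)) (hm (\<tau> v)) (nbc (\<tau> v)) None
     else \<sigma> v)" for v
  proof (cases "v = a \<or> v = b")
    case True
    have no: "(\<exists>u k j m. nbc (\<tau> v) u = 9 \<and> G (11 + T n) \<tau> v u = Some (k, j, m) \<and>
           (cls (\<tau> v) = 2 \<and> k = 2 \<and> u < v \<or> hm (\<tau> v) \<and> (k = 2 \<or> j = 1 \<and> u < v))) \<longleftrightarrow> False"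
      using nine by blast
    have f9: "(if nbc (\<tau> v) u = 9 then (case G (11 + T n) \<tau> v u of None \<Rightarrow> 0 | Some x \<Rightarrow> fst x) else nbc (\<tau> v) u)
        = nbc (\<tau> v) u" for u using nine by simp
    show ?thesis
      unfolding \<sigma>'_def ground_def \<tau>_def[symmetric] vnext_PX aw\<tau> step_exchange_def Let_def no f9
      using True \<tau>f(2,3,4,7)[OF True] by simp
  next
    case False
    then show ?thesis unfolding \<sigma>'_def ground_def \<tau>_def[symmetric] vnext_PX aw\<tau> by (simp add: \<tau>)
  qed
  have C: "cls (\<sigma>' v) = (if up v then 2 else cls (\<sigma> v))" for v
    using \<tau>f[of v] by (auto simp: s up_def)
  have H: "hm (\<sigma>' v) = hm (\<sigma> v)" for v using \<tau>f[of v] by (auto simp: s)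
  have Nb: "nbc (\<sigma>' v) u = (if u \<in> N v then cls (\<sigma> u) else 0)" for v u
    using Niff[of u v] \<tau>f(1)[of v] f[of v u] by (auto simp: s q.q_nbc)
  have ends: "up v \<or> aq v \<Longrightarrow> v = a \<or> v = b" for v by (auto simp: up_def aq_def)
  have Fl0: "(ann (\<sigma>' v) \<longleftrightarrow> up v) \<and> \<not> left (\<sigma>' v) \<and> (ask (\<sigma>' v) \<longleftrightarrow> aq v) \<and>
    (ask (\<sigma>' v) \<longrightarrow> apar (\<sigma>' v) = v \<and> aroot (\<sigma>' v) = v) \<and> coord (\<sigma>' v) = None \<and> cands (\<sigma>' v) = {} \<and>
    (awake (\<sigma>' v) \<longrightarrow> v = a \<or> v = b)" for v
  proof (cases "v = a \<or> v = b")
    case True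
    then show ?thesis using \<tau>f[OF True] by (cases "up v \<or> aq v") (simp_all add: s)
  next
    case False
    then have "\<not> up v" "\<not> aq v" using ends by blast+
    then show ?thesis using False q.q_flags[of v] q.q_coord[of v] by (simp add: s)
  qed
  have Fl: "ann (\<sigma>' v) \<longleftrightarrow> up v" "\<not> left (\<sigma>' v)" "ask (\<sigma>' v) \<longleftrightarrow> aq v"
    "ask (\<sigma>' v) \<Longrightarrow> apar (\<sigma>' v) = v \<and> aroot (\<sigma>' v) = v" "coord (\<sigma>' v) = None" "cands (\<sigma>' v) = {}"
    "awake (\<sigma>' v) \<Longrightarrow> v = a \<or> v = b" for v
    using Fl0[of v] by blast+
  have cl2: "cls (\<sigma> u) = 2 \<Longrightarrow> cls (\<sigma>' u) = 2" for u by (simp add: C)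
  show "stateB V E \<sigma>'"
  proof
    fix u v c c'
    show "nbc (\<sigma>' v) u = (if u \<in> N v then if ann (\<sigma>' u) then if cls (\<sigma>' u) = 2 then 1 else 2 else cls (\<sigma>' u) else 0)"
      by (auto simp: Nb Fl C up_def)
    show "cls (\<sigma>' v) \<in> {1, 2, 3}" using q.a_cls[of v] by (simp add: C)
    show "hm (\<sigma>' v) \<Longrightarrow> cls (\<sigma>' v) = 3" using q.a_hm3[of v] by (auto simp: C H up_def)
    show "ask (\<sigma>' v) \<Longrightarrow> cls (\<sigma>' v) = 3 \<and> apar (\<sigma>' v) = v \<and> aroot (\<sigma>' v) = v"
      using Fl(4)[of v] by (auto simp: Fl C aq_def up_def)
    show "left (\<sigma>' v) \<Longrightarrow> lroot (\<sigma>' v) = v \<or> lroot (\<sigma>' v) \<in> N v" using Fl(2) by simp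
    show "awake (\<sigma>' v) \<Longrightarrow> v \<in> V" using ab Fl(7) by blast
    have "okay (\<tau> v)" using aw\<tau>[of v] q.a_ok[of v] by (auto simp: okay_def \<tau>)
    then show "okay (\<sigma>' v)" unfolding \<sigma>'_def ground_def \<tau>_def[symmetric] by (rule okay_vnext)
    show "u \<in> N v \<Longrightarrow> cls (\<sigma>' u) = 2 \<Longrightarrow> cls (\<sigma>' v) \<noteq> 2"
    proof
      assume a: "u \<in> N v" "cls (\<sigma>' u) = 2" "cls (\<sigma>' v) = 2"
      have "v \<in> N u" using a(1) N_sym by blast
      moreover have "up x \<or> cls (\<sigma> x) = 2" if "cls (\<sigma>' x) = 2" for x
        using that by (auto simp: C split: if_splits)
      moreover have "\<not> (cls (\<sigma> u) = 2 \<and> cls (\<sigma> v) = 2)" using a(1) Niff q.a_ml by blast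
      \<comment> \<open>An entering vertex has no neighbor that was in the light MIS, so both would
        have to enter now. Then they are the two ends of the deleted edge and no longer
        adjacent.\<close>
      ultimately have "up u" "up v" using a by (auto simp: up_def bare_def)
      then show False using a(1) Niff[of u v] N_irrefl by (auto simp: up_def)
    qed
    show "cls (\<sigma>' v) = 1 \<Longrightarrow> coord (\<sigma>' v) \<noteq> None \<or> (\<exists>u\<in>N v. cls (\<sigma>' u) = 2 \<or> ann (\<sigma>' u) \<and> cls (\<sigma>' u) = 3)"
    proof -
      assume "cls (\<sigma>' v) = 1"
      then have v: "cls (\<sigma> v) = 1" "\<not> up v" by (auto simp: C split: if_splits)
      have "\<exists>u\<in>N v. cls (\<sigma> u) = 2"
      proof (cases "v = a \<or> v = b")
        case True
        then show ?thesis using v by (auto simp: up_def bare_def)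
      next
        case False
        then show ?thesis using q.q_ln[OF v(1)] Niff by blast
      qed
      then show ?thesis using cl2 by blast
    qed
    show "hm (\<sigma>' v) \<Longrightarrow> u \<in> N v \<Longrightarrow> \<not> hm (\<sigma>' u) \<and> (cls (\<sigma>' u) = 2 \<longrightarrow> ann (\<sigma>' u))"
      using q.q_hm[of v u] Niff[of u v] by (auto simp: H C Fl)
    show "cls (\<sigma>' v) = 3 \<Longrightarrow> \<not> hm (\<sigma>' v) \<Longrightarrow> ask (\<sigma>' v) \<or> (\<exists>u\<in>N v. cls (\<sigma>' u) = 2 \<or> hm (\<sigma>' u) \<or> left (\<sigma>' u))"
    proof -
      assume "cls (\<sigma>' v) = 3" "\<not> hm (\<sigma>' v)"
      then have v: "cls (\<sigma> v) = 3" "\<not> hm (\<sigma> v)" by (auto simp: C H split: if_splits)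
      show ?thesis
      proof (cases "v = a \<or> v = b")
        case True
        then show ?thesis using v cl2 by (auto simp: Fl aq_def bare_def)
      next
        case False
        then obtain u where "u \<in> N v" "cls (\<sigma> u) = 2 \<or> hm (\<sigma> u)" using q.q_h[OF v] Niff by blast
        then show ?thesis using cl2[of u] H[of u] by blast
      qed
    qed
    show "coord (\<sigma>' v) = Some c \<Longrightarrow> cls (\<sigma>' v) = 1 \<and> \<not> left (\<sigma>' v) \<and> c \<in> N v" by (simp add: Fl)
    show "coord (\<sigma>' v) = Some c \<longleftrightarrow> v \<in> cands (\<sigma>' c)" by (simp add: Fl)
    show "cands (\<sigma>' c) \<noteq> {} \<Longrightarrow> cands (\<sigma>' c') \<noteq> {} \<Longrightarrow> c = c'" by (simp add: Fl)
    show "ann (\<sigma>' u) \<Longrightarrow> cls (\<sigma>' u) = 3 \<Longrightarrow> (\<forall>c. cands (\<sigma>' c) = {}) \<and>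
       (\<forall>w. ann (\<sigma>' w) \<and> cls (\<sigma>' w) = 3 \<longrightarrow> w = u) \<and> (\<forall>w. left (\<sigma>' w) \<longrightarrow> cls (\<sigma>' w) = 3)"
      by (auto simp: Fl C)
    show "coord (\<sigma>' v) \<noteq> None \<Longrightarrow> u \<in> N v \<Longrightarrow> cls (\<sigma>' u) = 2 \<Longrightarrow> \<not> ann (\<sigma>' u) \<Longrightarrow> awake (\<sigma>' v)"
      by (simp add: Fl)
  qed
  show "touched {a, b} \<sigma> \<sigma>'"
    unfolding touched_def by (auto simp: Fl C up_def aq_def)
  show "gcount A T n E (11 + T n) (gevent (Del a b) \<sigma>) \<le> 2"
    unfolding \<tau>_def[symmetric] gcount_def gin by simp
  show "gfits (ce + 3) (be + 1) A T n E (11 + T n) (gevent (Del a b) \<sigma>)"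
    unfolding \<tau>_def[symmetric] gfits_def gin by simp
qed

end

section \<open>Change of the potential by the update itself\<close>

context net
begin

text \<open>A forced departure raises the rank from 0 to 3, which costs \<open>3 * wt E v\<close>,
  and its announcement costs \<open>d v / 8\<close>. The released \<open>4 * excess E v\<close> is
  at least \<open>4 * d v - 12 * gpow E\<close> and covers all degree terms, so
  \<open>15 * gpow E\<close> remain. At most two roots add one more \<open>gpow E\<close>, and the
  reports of departed endpoints less than 1.\<close>

lemma start_pot:
  assumes B: "stateB V E \<sigma>'" and t: "touched B \<sigma> \<sigma>'" and cB: "finite B" "card B \<le> 2" "B \<subseteq> V"
  shows "potB V E \<sigma>' \<le> base V E \<sigma> + 16 * gpow E + 1"
    and "muB V \<sigma>' \<le> 2 * (\<Sum>v\<in>V. rk (cls (\<sigma> v))) + 7"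
proof -
  interpret stateB V E \<sigma>' by (rule B)
  let ?Y = "{v. ann (\<sigma>' v)}" and ?f = "{v. ann (\<sigma>' v) \<and> cls (\<sigma>' v) = 3}"
  have YB: "?Y \<subseteq> B" "{v. left (\<sigma>' v)} \<subseteq> B" "{v. ask (\<sigma>' v)} \<subseteq> B" using t by (auto simp: touched_def)
  then have fin: "finite ?Y" "?Y \<subseteq> V" "?f \<subseteq> V" using cB finite_subset by auto
  have f1: "card ?f \<le> 1"
  proof (cases "?f = {}")
    case False
    then obtain u where "u \<in> ?f" by blast
    then have "?f \<subseteq> {u}" using b_forced[of u] by blast
    then show ?thesis using card_mono[of "{u}" ?f] by simp
  qed (simp only: card.empty)
  have tr: "ann (\<sigma>' v) \<Longrightarrow> cls (\<sigma> v) = 1 \<and> cls (\<sigma>' v) = 2 \<or> cls (\<sigma> v) = 2 \<and> cls (\<sigma>' v) = 3"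
    "\<not> ann (\<sigma>' v) \<Longrightarrow> cls (\<sigma>' v) = cls (\<sigma> v)" for v
    using t unfolding touched_def by metis+
  have v: "real (rk (cls (\<sigma>' v))) * wt E v + (if cls (\<sigma>' v) \<noteq> 3 then 4 * excess E v else 0)
        + (if v \<in> ?Y then real (d v) / 8 else 0)
      \<le> real (rk (cls (\<sigma> v))) * wt E v + (if cls (\<sigma> v) \<noteq> 3 then 4 * excess E v else 0)
        + (if v \<in> ?f then 15 * gpow E else 0)" for v
  proof (cases "ann (\<sigma>' v)")
    case True
    then consider "cls (\<sigma> v) = 1" "cls (\<sigma>' v) = 2" | "cls (\<sigma> v) = 2" "cls (\<sigma>' v) = 3" using tr by blast
    then show ?thesis
    proof cases
      case 1
      then show ?thesis using True d_le_wt[of v] by (simp add: rk_def)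
    next
      case 2
      have "wt E v \<le> real (d v) + gpow E" by (simp add: wt_def)
      moreover have "real (d v) - 3 * gpow E \<le> excess E v" by (simp add: excess_def)
      ultimately show ?thesis using 2 True by (simp add: rk_def)
    qed
  next
    case False
    then show ?thesis using tr(2)[of v] by simp
  qed
  have "(\<Sum>v\<in>V. real (rk (cls (\<sigma>' v))) * wt E v + (if cls (\<sigma>' v) \<noteq> 3 then 4 * excess E v else 0)
        + (if v \<in> ?Y then real (d v) / 8 else 0))
      \<le> (\<Sum>v\<in>V. real (rk (cls (\<sigma> v))) * wt E v + (if cls (\<sigma> v) \<noteq> 3 then 4 * excess E v else 0)
        + (if v \<in> ?f then 15 * gpow E else 0))"
    by (rule sum_mono) (rule v)
  then have "base V E \<sigma>' + (\<Sum>v\<in>?Y. real (d v) / 8) \<le> base V E \<sigma> + (\<Sum>v\<in>?f. 15 * gpow E)"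
    unfolding base_def sum.distrib sum_indicator[OF fin(2)] sum_indicator[OF fin(3)] by simp
  moreover have "(\<Sum>v\<in>?f. 15 * gpow E) \<le> 15 * gpow E"
  proof -
    have "real (card ?f) * (15 * gpow E) \<le> 1 * (15 * gpow E)" using f1 by (intro mult_right_mono) auto
    then show ?thesis by simp
  qed
  ultimately have b: "base V E \<sigma>' + (\<Sum>v\<in>?Y. real (d v)) / 8 \<le> base V E \<sigma> + 15 * gpow E"
    by (simp add: sum_divide_distrib)
  have pend: "real (pend E \<sigma>') \<le> (\<Sum>v\<in>?Y. real (d v)) + 2"
  proof -
    have e: "{v. awake (\<sigma>' v) \<and> coord (\<sigma>' v) \<noteq> None} = {}" "{v. left (\<sigma>' v) \<and> cls (\<sigma>' v) \<noteq> 3} = {}"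
      using t by (auto simp: touched_def)
    have "card {v. left (\<sigma>' v)} \<le> 2" using card_mono[OF cB(1) YB(2)] cB(2) by linarith
    then show ?thesis unfolding pend_def e by simp
  qed
  have "rootsB \<sigma>' \<subseteq> B" using YB t by (auto simp: rootsB_def touched_def)
  then have "card (rootsB \<sigma>') \<le> 2" using card_mono[OF cB(1)] cB(2) by (meson le_trans)
  then have r: "real (card (rootsB \<sigma>')) * gpow E \<le> 2 * gpow E" by (intro mult_right_mono) auto
  show "potB V E \<sigma>' \<le> base V E \<sigma> + 16 * gpow E + 1"
    unfolding potB_def using b pend r by argo
  have "(\<Sum>v\<in>V. rk (cls (\<sigma>' v))) \<le> (\<Sum>v\<in>V. rk (cls (\<sigma> v)) + 3 * (if v \<in> ?f then 1 else 0))"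
  proof (rule sum_mono)
    fix v
    show "rk (cls (\<sigma>' v)) \<le> rk (cls (\<sigma> v)) + 3 * (if v \<in> ?f then 1 else 0)"
      using tr[of v] by (cases "ann (\<sigma>' v)") (auto simp: rk_def)
  qed
  also have "\<dots> = (\<Sum>v\<in>V. rk (cls (\<sigma> v))) + 3 * card ?f"
    unfolding sum.distrib sum_distrib_left[symmetric] sum_indicator_nat[OF fin(3)] by simp
  finally show "muB V \<sigma>' \<le> 2 * (\<Sum>v\<in>V. rk (cls (\<sigma> v))) + 7" unfolding muB_def using f1 by auto
qed

text \<open>The 26 consists of 6 for the non-isolated vertices, at most \<open>2 * m\<close> of rank
  at most 3, which gain \<open>m powr (-1/3)\<close> each; of 6 for the \<open>gpow E\<close> in the
  weights of two endpoints; and of 14 for the added degrees, absorbed by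
  \<open>gpow E \<ge> 1\<close>.\<close>

lemma base_insert:
  assumes old: "net A T n ce be V E0" and ab: "a \<in> V" "b \<in> V" "a \<noteq> b" "{a, b} \<notin> E0" and E: "E = insert {a, b} E0"
  shows "base V E \<sigma> \<le> base V E0 \<sigma> + 26 * gpow E"
proof -
  interpret o: net A T n ce be V E0 by (rule old)
  have fE0: "finite E0" using o.gr finV unfolding graph_on_def
    by (meson PowI finite_Pow_iff finite_subset subsetI)
  have m: "card E = Suc (card E0)" using ab(4) fE0 by (simp add: E)
  have Niff: "N v = o.N v \<union> (if v = a then {b} else if v = b then {a} else {})" for v
    unfolding E neighbors_def using ab(3) by (auto simp: doubleton_eq_iff)
  have nin: "b \<notin> o.N a" "a \<notin> o.N b" using ab(4) by (auto simp: neighbors_def insert_commute)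
  have dd: "d v = o.d v + (if v \<in> {a, b} then 1 else 0)" for v
    using nin o.finN ab(3) by (auto simp: Niff)
  let ?m = "real (card E)"
  have gE: "gpow E \<ge> 1" unfolding gpow_def m using ge_one_powr_ge_zero[of "real (Suc (card E0))" "2/3"] by simp
  have g0: "gpow E0 \<le> gpow E" unfolding gpow_def m by (intro powr_mono2) auto
  have gs: "gpow E \<le> gpow E0 + ?m powr (-1/3)"
    using powr_step[of "card E"] by (simp add: gpow_def m One_nat_def)
  have w: "wt E v \<le> wt E0 v + (if v \<in> {v \<in> V. N v \<noteq> {}} then ?m powr (-1/3) else 0) +
      (if v \<in> {a, b} then 1 + gpow E else 0)" for v
  proof (cases "v \<in> {a, b}")
    case True
    then show ?thesis using dd[of v] gE by (auto simp: wt_def)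
  next
    case False
    then have e: "N v = o.N v" using Niff by auto
    have "N v \<noteq> {} \<Longrightarrow> v \<in> V" using N_V' by blast
    then show ?thesis using False gs by (auto simp: wt_def e)
  qed
  have x: "excess E v \<le> excess E0 v + (if v \<in> {a, b} then 1 else 0)" for v
    using dd[of v] g0 by (auto simp: excess_def)
  have per: "real (rk (cls (\<sigma> v))) * wt E v + (if cls (\<sigma> v) \<noteq> 3 then 4 * excess E v else 0)
     \<le> (real (rk (cls (\<sigma> v))) * wt E0 v + (if cls (\<sigma> v) \<noteq> 3 then 4 * excess E0 v else 0))
      + (if v \<in> {v \<in> V. N v \<noteq> {}} then 3 * ?m powr (-1/3) else 0) + (if v \<in> {a, b} then 7 + 3 * gpow E else 0)" for v
  proof -
    define k where "k = real (rk (cls (\<sigma> v)))"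
    define y where "y = (if v \<in> {v \<in> V. N v \<noteq> {}} then ?m powr (-1/3) else 0)"
    define z where "z = (if v \<in> {a, b} then 1 + gpow E else 0)"
    define q where "q = (if v \<in> {a, b} then 4 else 0 :: real)"
    have k: "0 \<le> k" "k \<le> 3" by (auto simp: k_def rk_def)
    have yz: "0 \<le> y" "0 \<le> z" using gE by (simp_all add: y_def z_def)
    have "k * wt E v \<le> k * (wt E0 v + y + z)" using w[of v] k unfolding y_def z_def by (intro mult_left_mono)
    also have "\<dots> = k * wt E0 v + k * y + k * z" by (simp only: distrib_left)
    also have "\<dots> \<le> k * wt E0 v + 3 * y + 3 * z" using k yz by (intro add_mono mult_right_mono) auto
    finally have "k * wt E v \<le> k * wt E0 v + 3 * y + 3 * z" .
    moreover have "(if cls (\<sigma> v) \<noteq> 3 then 4 * excess E v else 0) \<le>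
      (if cls (\<sigma> v) \<noteq> 3 then 4 * excess E0 v else 0) + q"
      using x[of v] unfolding q_def by auto
    moreover have "(if v \<in> {v \<in> V. N v \<noteq> {}} then 3 * ?m powr (-1/3) else 0) = 3 * y" by (simp add: y_def)
    moreover have "(if v \<in> {a, b} then 7 + 3 * gpow E else 0) = 3 * z + q" by (simp add: z_def q_def)
    ultimately show ?thesis unfolding k_def[symmetric] by argo
  qed
  let ?I = "{v \<in> V. N v \<noteq> {}}"
  have "base V E \<sigma> \<le> (\<Sum>v\<in>V. (real (rk (cls (\<sigma> v))) * wt E0 v + (if cls (\<sigma> v) \<noteq> 3 then 4 * excess E0 v else 0))
      + (if v \<in> ?I then 3 * ?m powr (-1/3) else 0) + (if v \<in> {a, b} then 7 + 3 * gpow E else 0))"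
    unfolding base_def by (rule sum_mono) (rule per)
  also have "\<dots> = base V E0 \<sigma> + (\<Sum>v\<in>?I. 3 * ?m powr (-1/3)) + (\<Sum>v\<in>{a, b}. 7 + 3 * gpow E)"
    unfolding base_def sum.distrib[of _ _ V] using ab(1,2)
    by (subst sum_indicator, blast)+ simp
  also have "(\<Sum>v\<in>?I. 3 * ?m powr (-1/3)) \<le> 6 * gpow E"
  proof -
    have "card ?I = (\<Sum>v\<in>?I. 1)" by simp
    also have "\<dots> \<le> (\<Sum>v\<in>?I. d v)" using finN by (intro sum_mono) (auto simp: One_nat_def Suc_le_eq card_gt_0_iff)
    also have "\<dots> \<le> 2 * card E" by (rule sum_d_le) auto
    finally have "real (card ?I) \<le> 2 * ?m" by linarith
    then have "real (card ?I) * (3 * ?m powr (-1/3)) \<le> 2 * ?m * (3 * ?m powr (-1/3))"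
      by (intro mult_right_mono) auto
    moreover have "?m * ?m powr (-1/3) = gpow E"
      using powr_add[of ?m 1 "-1/3"] by (simp add: gpow_def m)
    ultimately show ?thesis by simp
  qed
  also have "(\<Sum>v\<in>{a, b}. 7 + 3 * gpow E) = 14 + 6 * gpow E" using ab(3) by simp
  finally show ?thesis using gE by linarith
qed

text \<open>Weights do not increase. Only the excess can grow, by at most
  \<open>3 * m powr (-1/3)\<close> and only at degrees above \<open>3 * gpow E\<close>; the degree
  sum admits at most \<open>2/3 * m powr (1/3)\<close> such vertices. With the coefficient 4 this
  gives the constant 8.\<close>

lemma base_delete:
  assumes old: "net A T n ce be V E0" and e: "e \<in> E0" and E: "E = E0 - {e}"
  shows "base V E \<sigma> \<le> base V E0 \<sigma> + 8 * gpow E0"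
proof -
  interpret o: net A T n ce be V E0 by (rule old)
  have fE0: "finite E0" using o.gr finV unfolding graph_on_def
    by (meson PowI finite_Pow_iff finite_subset subsetI)
  have m: "card E0 = Suc (card E)" unfolding E using card_Suc_Diff1[OF fE0 e] by simp
  have Ns: "N v \<subseteq> o.N v" for v unfolding E neighbors_def by auto
  have dd: "d v \<le> o.d v" for v using Ns o.finN by (intro card_mono)
  have g0: "gpow E \<le> gpow E0" unfolding gpow_def m by (intro powr_mono2) auto
  have gE0: "gpow E0 \<ge> 1" unfolding gpow_def m using ge_one_powr_ge_zero[of "real (Suc (card E))" "2/3"] by simp
  have gs: "gpow E0 - gpow E \<le> real (card E0) powr (-1/3)"
    using powr_step[of "card E0"] by (simp add: gpow_def m One_nat_def)
  let ?I = "{v \<in> V. real (d v) > 3 * gpow E}" and ?x = "12 * real (card E0) powr (-1/3)"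
  have w: "wt E v \<le> wt E0 v" for v
    using dd[of v] g0 Ns[of v] by (auto simp: wt_def)
  have x: "excess E v \<le> excess E0 v + (if v \<in> ?I then 3 * real (card E0) powr (-1/3) else 0)" if "v \<in> V" for v
    using dd[of v] gs that by (auto simp: excess_def)
  have "base V E \<sigma> \<le> (\<Sum>v\<in>V. (real (rk (cls (\<sigma> v))) * wt E0 v + (if cls (\<sigma> v) \<noteq> 3 then 4 * excess E0 v else 0))
      + (if v \<in> ?I then ?x else 0))"
    unfolding base_def
  proof (rule sum_mono)
    fix v assume v: "v \<in> V"
    have "real (rk (cls (\<sigma> v))) * wt E v \<le> real (rk (cls (\<sigma> v))) * wt E0 v"
      using w by (intro mult_left_mono) auto
    moreover have "(if cls (\<sigma> v) \<noteq> 3 then 4 * excess E v else 0) \<le>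
      (if cls (\<sigma> v) \<noteq> 3 then 4 * excess E0 v else 0) + (if v \<in> ?I then ?x else 0)"
      using x[OF v] by (auto split: if_splits)
    ultimately show "real (rk (cls (\<sigma> v))) * wt E v + (if cls (\<sigma> v) \<noteq> 3 then 4 * excess E v else 0) \<le>
      (real (rk (cls (\<sigma> v))) * wt E0 v + (if cls (\<sigma> v) \<noteq> 3 then 4 * excess E0 v else 0)) +
      (if v \<in> ?I then ?x else 0)" by linarith
  qed
  also have "\<dots> = base V E0 \<sigma> + real (card ?I) * ?x"
    unfolding base_def sum.distrib[of _ _ V] by (subst sum_indicator) auto
  also have "real (card ?I) * ?x \<le> 8"
  proof (cases "card E = 0")
    case True
    have "?I = {}"
    proof -
      have "(\<Sum>v\<in>V. d v) = 0" using True sum_d by simp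
      then have "d v = 0" if "v \<in> V" for v using that finV by (simp add: sum_eq_0_iff)
      then show ?thesis by (auto simp: gpow_def)
    qed
    then show ?thesis by (simp only: card.empty of_nat_0 mult_zero_left zero_le_numeral)
  next
    case False
    let ?m = "real (card E)"
    have "real (card ?I) * (3 * gpow E) = (\<Sum>v\<in>?I. 3 * gpow E)" by simp
    also have "\<dots> \<le> (\<Sum>v\<in>?I. real (d v))" by (intro sum_mono) auto
    also have "\<dots> = real (\<Sum>v\<in>?I. d v)" by simp
    also have "\<dots> \<le> real (2 * card E)" by (subst of_nat_le_iff, rule sum_d_le) auto
    finally have "real (card ?I) * (3 * gpow E) \<le> 2 * ?m" by simp
    moreover have "gpow E = ?m * ?m powr (-1/3)"
      using powr_add[of ?m 1 "-1/3"] False by (simp add: gpow_def)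
    ultimately have "?m * (3 * (real (card ?I) * ?m powr (-1/3))) \<le> ?m * 2" by (simp add: algebra_simps)
    then have "3 * (real (card ?I) * ?m powr (-1/3)) \<le> 2" using False by (simp add: mult_le_cancel_left)
    moreover have "real (card E0) powr (-1/3) \<le> ?m powr (-1/3)"
      using False m by (intro powr_mono2') auto
    then have "real (card ?I) * real (card E0) powr (-1/3) \<le> real (card ?I) * ?m powr (-1/3)"
      by (intro mult_left_mono) auto
    moreover have "real (card ?I) * ?x = 12 * (real (card ?I) * real (card E0) powr (-1/3))" by simp
    ultimately show ?thesis by argo
  qed
  finally show ?thesis using gE0 by linarith
qed

lemma update_step:
  assumes q: "quiet V E0 \<sigma>" and g0: "graph_on V E0" and val: "valid_update V E0 x" and E: "E = apply_update x E0"
  shows "\<exists>K \<sigma>'. snd (run K (11 + T n, gevent x \<sigma>)) = \<sigma>' \<and> quiet V E \<sigma>' \<and> fit K (11 + T n, gevent x \<sigma>) \<and>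
    real (msgs K (11 + T n, gevent x \<sigma>)) + 72 * real (T n) * base V E \<sigma>' \<le>
      72 * real (T n) * (base V E0 \<sigma> + 46 * (gpow E0 + gpow E)) \<and>
    K + (11 + T n) * (2 * (\<Sum>v\<in>V. rk (cls (\<sigma>' v)))) \<le> 10 + (11 + T n) * (2 * (\<Sum>v\<in>V. rk (cls (\<sigma> v))) + 7)"
proof -
  have old: "net A T n ce be V E0"
    using net_axioms g0 unfolding net_def by simp
  define \<sigma>1 where "\<sigma>1 = ground A T n E (11 + T n) (gevent x \<sigma>)"
  have ends: "\<exists>B. finite B \<and> card B \<le> 2 \<and> B \<subseteq> V \<and> touched B \<sigma> \<sigma>1 \<and> stateB V E \<sigma>1 \<and>
     gcount A T n E (11 + T n) (gevent x \<sigma>) \<le> 2 \<and>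
     gfits (ce + 3) (be + 1) A T n E (11 + T n) (gevent x \<sigma>) \<and>
     base V E \<sigma> \<le> base V E0 \<sigma> + 26 * (gpow E0 + gpow E) \<and> 1 \<le> gpow E0 + gpow E"
  proof (cases x)
    case (Ins a b)
    then have ab: "a \<in> V" "b \<in> V" "a \<noteq> b" "{a, b} \<notin> E0" and E': "E = insert {a, b} E0" using val E by auto
    have fE: "finite E" using gr finV unfolding graph_on_def
      by (meson PowI finite_Pow_iff finite_subset subsetI)
    then have "card E \<ge> 1" using E' by (simp add: One_nat_def Suc_le_eq card_gt_0_iff)
    then have "gpow E \<ge> 1" unfolding gpow_def using ge_one_powr_ge_zero[of "real (card E)" "2/3"] by simp
    then have "base V E \<sigma> \<le> base V E0 \<sigma> + 26 * (gpow E0 + gpow E)" "1 \<le> gpow E0 + gpow E"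
      using base_insert[OF old ab E', of \<sigma>] gpow_nonneg[of E0] by argo+
    then show ?thesis
      using insertion[OF q ab E'] ab
      unfolding \<sigma>1_def Ins by (intro exI[of _ "{a, b}"]) (simp del: gevent.simps)
  next
    case (Del a b)
    then have e: "{a, b} \<in> E0" and E': "E = E0 - {{a, b}}" using val E by auto
    have "{a, b} \<subseteq> V" "card {a, b} = 2" using e g0 by (auto simp: graph_on_def)
    then have ab: "a \<in> V" "b \<in> V" "a \<noteq> b" by auto
    have fE: "finite E0" using g0 finV unfolding graph_on_def
      by (meson PowI finite_Pow_iff finite_subset subsetI)
    then have "card E0 \<ge> 1" using e by (auto simp: One_nat_def Suc_le_eq card_gt_0_iff)
    then have "gpow E0 \<ge> 1" unfolding gpow_def using ge_one_powr_ge_zero[of "real (card E0)" "2/3"] by simp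
    then have "base V E \<sigma> \<le> base V E0 \<sigma> + 26 * (gpow E0 + gpow E)" "1 \<le> gpow E0 + gpow E"
      using base_delete[OF old e E', of \<sigma>] gpow_nonneg[of E] by argo+
    then show ?thesis
      using deletion[OF q ab e E'] ab
      unfolding \<sigma>1_def Del by (intro exI[of _ "{a, b}"]) (simp del: gevent.simps)
  qed
  then obtain B where B: "finite B" "card B \<le> 2" "B \<subseteq> V" "touched B \<sigma> \<sigma>1" "stateB V E \<sigma>1"
    "gcount A T n E (11 + T n) (gevent x \<sigma>) \<le> 2"
    "gfits (ce + 3) (be + 1) A T n E (11 + T n) (gevent x \<sigma>)"
    "base V E \<sigma> \<le> base V E0 \<sigma> + 26 * (gpow E0 + gpow E)" "1 \<le> gpow E0 + gpow E" by blast
  note sp = start_pot[OF B(5,4,1,2,3)]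
  from from_stateB[OF B(5)] obtain j \<sigma>' where j: "run (9 + j * (11 + T n)) (0, \<sigma>1) = (9, \<sigma>')"
    "stateA V E \<sigma>'" "asleep \<sigma>'"
    "real (msgs (9 + j * (11 + T n)) (0, \<sigma>1)) + 72 * real (T n) * base V E \<sigma>' \<le> 72 * real (T n) * potB V E \<sigma>1"
    "j + 2 * (\<Sum>v\<in>V. rk (cls (\<sigma>' v))) \<le> muB V \<sigma>1" "fit (9 + j * (11 + T n)) (0, \<sigma>1)" by blast
  let ?x = "(11 + T n, gevent x \<sigma>)"
  let ?K = "1 + (9 + j * (11 + T n))"
  have r1: "run 1 ?x = (0, \<sigma>1)" by (simp add: run_PX \<sigma>1_def)
  have "snd (run ?K ?x) = \<sigma>'" unfolding grun_add[of A T n E 1] r1 j(1) by simp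
  moreover have "quiet V E \<sigma>'" using j(2,3) by (simp add: quiet_def quiet_axioms_def)
  moreover have "fit ?K ?x"
  proof (rule fit_add)
    show "fit 1 ?x" using B(7) by (simp add: One_nat_def)
    show "fit (9 + j * (11 + T n)) (run 1 ?x)" unfolding r1 by (rule j(6))
  qed
  moreover have "real (msgs ?K ?x) + 72 * real (T n) * base V E \<sigma>' \<le>
      72 * real (T n) * (base V E0 \<sigma> + 46 * (gpow E0 + gpow E))"
  proof -
    have "msgs 1 ?x \<le> 2" using B(6) by (simp add: gmsgs_def One_nat_def)
    then have "real (msgs ?K ?x) \<le> 2 + real (msgs (9 + j * (11 + T n)) (0, \<sigma>1))"
      unfolding gmsgs_add[of A T n E 1] r1 by linarith
    also have "(2::real) \<le> 72 * real (T n)" using T by simp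
    finally have "real (msgs ?K ?x) + 72 * real (T n) * base V E \<sigma>' \<le> 72 * real (T n) * (potB V E \<sigma>1 + 1)"
      using j(4) by (simp add: algebra_simps)
    also have "\<dots> \<le> 72 * real (T n) * (base V E0 \<sigma> + 46 * (gpow E0 + gpow E))"
    proof (rule mult_left_mono)
      have "gpow E \<ge> 0" "gpow E0 \<ge> 0" by (simp_all add: gpow_def)
      \<comment> \<open>The change of the graph takes 26 and \<open>start_pot\<close> takes 16; the
        two additive units are absorbed because one of the two graphs has an edge.\<close>
      then show "potB V E \<sigma>1 + 1 \<le> base V E0 \<sigma> + 46 * (gpow E0 + gpow E)" using sp(1) B(8,9) by argo
    qed simp
    finally show ?thesis .
  qed
  moreover have "?K + (11 + T n) * (2 * (\<Sum>v\<in>V. rk (cls (\<sigma>' v)))) \<le> 10 + (11 + T n) * (2 * (\<Sum>v\<in>V. rk (cls (\<sigma> v))) + 7)"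
  proof -
    have "?K + (11 + T n) * (2 * (\<Sum>v\<in>V. rk (cls (\<sigma>' v)))) = 10 + (11 + T n) * (j + 2 * (\<Sum>v\<in>V. rk (cls (\<sigma>' v))))"
      by (simp add: algebra_simps)
    also have "\<dots> \<le> 10 + (11 + T n) * (2 * (\<Sum>v\<in>V. rk (cls (\<sigma> v))) + 7)"
      using j(5) sp(2) by (intro add_left_mono mult_left_mono) auto
    finally show ?thesis .
  qed
  ultimately show ?thesis by blast
qed

lemma quiet_mis:
  assumes "quiet V E \<sigma>"
  shows "is_mis V E {v \<in> V. cls (\<sigma> v) = 2 \<or> hm (\<sigma> v)}"
proof -
  interpret q: quiet V E \<sigma> by (rule assms)
  let ?S = "{v \<in> V. cls (\<sigma> v) = 2 \<or> hm (\<sigma> v)}"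
  have cov: "\<exists>u\<in>N v. u \<in> ?S" if "v \<in> V" "v \<notin> ?S" for v
  proof -
    have "cls (\<sigma> v) = 1 \<or> cls (\<sigma> v) = 3" "\<not> hm (\<sigma> v)" using that q.a_cls[of v] by auto
    then have "\<exists>u\<in>N v. cls (\<sigma> u) = 2 \<or> hm (\<sigma> u)" using q.q_ln[of v] q.q_h[of v] by blast
    then show ?thesis using N_V by blast
  qed
  have "independent_set V E ?S"
    unfolding independent_set_def
  proof (intro conjI ballI)
    fix u v assume a: "u \<in> ?S" "v \<in> ?S"
    show "{u, v} \<notin> E"
    proof
      assume "{u, v} \<in> E"
      then have "u \<in> N v" "v \<in> N u" by (auto simp: neighbors_def insert_commute)
      then show False using a q.a_ml[of u v] q.q_hm[of v u] q.q_hm[of u v] by auto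
    qed
  qed auto
  moreover have "\<not> ?S \<subset> S'" if S': "independent_set V E S'" for S'
  proof
    assume "?S \<subset> S'"
    then obtain v where v: "v \<in> S'" "v \<notin> ?S" by blast
    then have "v \<in> V" using S' by (auto simp: independent_set_def)
    then obtain u where "u \<in> N v" "u \<in> ?S" using cov v by blast
    then show False using S' v \<open>?S \<subset> S'\<close> by (auto simp: independent_set_def neighbors_def)
  qed
  ultimately show ?thesis by (simp add: is_mis_def)
qed

end

section \<open>Update sequences\<close>

lemma zero_round_mis:
  assumes st: "static_mis c b A T" and T: "T n = 0" and V: "vertex_set c n V" and E: "graph_on V E"
  defines "q \<equiv> \<lambda>v. s_out A n v (neighbors E v) []"
  shows "{u, v} \<in> E \<Longrightarrow> \<not> (q u \<and> q v)" and "v \<in> V \<Longrightarrow> \<not> q v \<Longrightarrow> \<exists>u\<in>neighbors E v. q u"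
proof -
  let ?S = "{v \<in> V. q v}"
  have "vertex_set c n V \<and> graph_on V E" using V E by simp
  then have "is_mis V E (s_result A n V E (T n))" using st unfolding static_mis_def by blast
  then have mis: "is_mis V E ?S" by (simp add: T s_result_def q_def)
  have ind: "independent_set V E ?S" using mis by (simp add: is_mis_def)
  show "{u, v} \<in> E \<Longrightarrow> \<not> (q u \<and> q v)"
  proof
    assume uv: "{u, v} \<in> E" "q u \<and> q v"
    then have "{u, v} \<subseteq> V" using E unfolding graph_on_def by blast
    then have "u \<in> ?S" "v \<in> ?S" using uv by auto
    then show False using ind uv(1) unfolding independent_set_def by blast
  qed
  show "v \<in> V \<Longrightarrow> \<not> q v \<Longrightarrow> \<exists>u\<in>neighbors E v. q u"
  proof (rule ccontr)
    assume v: "v \<in> V" "\<not> q v" "\<not> (\<exists>u\<in>neighbors E v. q u)"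
    have "{v, v} \<notin> E" using E by (auto simp: graph_on_def)
    moreover have "{u, v} \<notin> E" if "u \<in> ?S" for u using v(3) that by (auto simp: neighbors_def)
    moreover from this have "{v, u} \<notin> E" if "u \<in> ?S" for u using that by (simp add: insert_commute)
    ultimately have "independent_set V E (insert v ?S)"
      using v(1) ind unfolding independent_set_def by blast
    moreover have "?S \<subset> insert v ?S" using v by blast
    ultimately show False using mis unfolding is_mis_def by blast
  qed
qed

lemma neighbors_insert:
  "neighbors (insert {a, b} E) v = (if v = a then {b} else {}) \<union> (if v = b then {a} else {}) \<union> neighbors E v"
  by (auto simp: neighbors_def doubleton_eq_iff)

lemma neighbors_empty: "neighbors {} v = {}"
  by (simp add: neighbors_def)

text \<open>Without rounds the answer depends only on the own ID and those of the neighbors, so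
  answers in different graphs can be compared. If \<open>x\<close> joins when seeing
  \<open>{y, z}\<close>, then in the triangle \<open>y\<close> and \<open>z\<close> do not join when
  seeing both others. On the path with center \<open>y\<close>, vertex \<open>z\<close> must then
  join when seeing \<open>{y}\<close>; by symmetry \<open>y\<close> joins when seeing
  \<open>{z}\<close>; so both join on the single edge between them.\<close>

lemma zero_round_triangle:
  assumes st: "static_mis c b A T" and T: "T n = 0" and V: "vertex_set c n V"
    and xyz: "x \<in> V" "y \<in> V" "z \<in> V" "x \<noteq> y" "x \<noteq> z" "y \<noteq> z"
  shows "\<not> s_out A n x {y, z} []"
proof
  assume x: "s_out A n x {y, z} []"
  note Z = zero_round_mis[OF st T V]
  define q where "q v B = s_out A n v B []" for v B
  have g: "graph_on V E" if "E \<subseteq> {{x, y}, {x, z}, {y, z}}" for E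
    using that xyz by (auto simp: graph_on_def)
  have s: "neighbors {{x, y}, {x, z}} x = {y, z}" "neighbors {{x, y}, {x, z}} y = {x}"
    "neighbors {{x, y}, {x, z}} z = {x}" "neighbors {{x, y}} x = {y}" "neighbors {{x, y}} y = {x}"
    "neighbors {{x, z}} x = {z}" "neighbors {{x, z}} z = {x}" "neighbors {{y, z}} y = {z}" "neighbors {{y, z}} z = {y}"
    "neighbors {{x, y}, {y, z}} x = {y}" "neighbors {{x, y}, {y, z}} y = {x, z}" "neighbors {{x, y}, {y, z}} z = {y}"
    "neighbors {{x, z}, {y, z}} x = {z}" "neighbors {{x, z}, {y, z}} z = {x, y}" "neighbors {{x, z}, {y, z}} y = {z}"
    "neighbors {{x, y}, {x, z}, {y, z}} x = {y, z}" "neighbors {{x, y}, {x, z}, {y, z}} y = {x, z}"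
    "neighbors {{x, y}, {x, z}, {y, z}} z = {x, y}"
    using xyz by (simp_all add: neighbors_insert neighbors_empty insert_commute)
  have "\<not> q y {x}" "\<not> q z {x}"
    using Z(1)[OF g[of "{{x, y}, {x, z}}"], of x y] Z(1)[OF g[of "{{x, y}, {x, z}}"], of x z] x
    by (simp_all add: s q_def)
  then have 1: "q x {y}" "q x {z}"
    using Z(2)[OF g[of "{{x, y}}"], of y] Z(2)[OF g[of "{{x, z}}"], of z] xyz by (simp_all add: s q_def)
  have 2: "\<not> q y {x, z}" "\<not> q z {x, y}"
    using Z(1)[OF g[of "{{x, y}, {x, z}, {y, z}}"], of x y] Z(1)[OF g[of "{{x, y}, {x, z}, {y, z}}"], of x z] x
    by (simp_all add: s q_def)
  have "q z {y}" using Z(2)[OF g[of "{{x, y}, {y, z}}"], of z] xyz 2 by (auto simp: s q_def)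
  moreover have "q y {z}" using Z(2)[OF g[of "{{x, z}, {y, z}}"], of y] xyz 2 by (auto simp: s q_def)
  ultimately show False using Z(1)[OF g[of "{{y, z}}"], of y z] by (simp add: s q_def)
qed

text \<open>In a triangle none of the three could join, although an MIS needs one. It justifies
  charging messages and rounds outside the runs to \<open>T n\<close>.\<close>

lemma static_rounds_pos:
  assumes st: "static_mis c b A T" and c: "c \<ge> 1" and n: "n > 2"
  shows "T n \<ge> 1"
proof (rule ccontr)
  assume "\<not> T n \<ge> 1"
  then have T: "T n = 0" by simp
  have "n ^ 1 \<le> n ^ c" using n c by (intro power_increasing) auto
  then have V: "vertex_set c n {..<n}" by (auto simp: vertex_set_def)
  let ?E = "{{0, 1}, {0, 2}, {1, 2}} :: nat set set"
  have g: "graph_on {..<n} ?E" using n by (auto simp: graph_on_def)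
  have s: "neighbors ?E 0 = {1, 2}" "neighbors ?E 1 = {0, 2}" "neighbors ?E 2 = {0, 1}"
    by (simp_all add: neighbors_insert neighbors_empty insert_commute)
  note tr = zero_round_triangle[OF st T V]
  have "\<not> s_out A n 0 {1, 2} []" "\<not> s_out A n 1 {0, 2} []" "\<not> s_out A n 2 {0, 1} []"
    using tr[of 0 1 2] tr[of 1 0 2] tr[of 2 0 1] n by auto
  moreover have "0 \<in> {..<n}" using n by simp
  ultimately show False using zero_round_mis(2)[OF st T V g, of 0] by (auto simp: s)
qed

section \<open>Amortization over the update sequence\<close>

lemma graph_at_Suc: "i < length us \<Longrightarrow> graph_at us (Suc i) = apply_update (us ! i) (graph_at us i)"
  by (simp add: graph_at_def take_Suc_conv_app_nth)

lemma graph_at_0 [simp]: "graph_at us 0 = {}"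
  by (simp add: graph_at_def)

lemma graph_at_on:
  assumes "update_seq V us"
  shows "i \<le> length us \<Longrightarrow> graph_on V (graph_at us i)"
proof (induction i)
  case 0
  then show ?case by (simp add: graph_on_def)
next
  case (Suc i)
  then have "valid_update V (graph_at us i) (us ! i)" "graph_on V (graph_at us i)"
    using assms by (auto simp: update_seq_def)
  then show ?case using Suc.prems
    by (cases "us ! i") (auto simp: graph_at_Suc graph_on_def)
qed

locale dynamic =
  fixes c b n :: nat and A :: static_alg and T :: "nat \<Rightarrow> nat" and V :: "nat set" and us :: "update list"
  assumes c: "c \<ge> 1" and st: "static_mis c b A T" and vs: "vertex_set c n V" and us: "update_seq V us"
    and n: "n > 2"
begin

abbreviation D :: dyn_alg where "D \<equiv> mis_alg A T"
abbreviation E :: "nat \<Rightarrow> graph" where "E \<equiv> graph_at us"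
abbreviation rounds :: "nat \<Rightarrow> nat" where "rounds i \<equiv> d_rounds D n (E (Suc i)) (d_hist D n us i) (us ! i)"
abbreviation messages :: "nat \<Rightarrow> nat" where "messages i \<equiv> d_messages D n (E (Suc i)) (d_hist D n us i) (us ! i)"
abbreviation fine :: "nat \<Rightarrow> bool" where
  "fine i \<equiv> (\<exists>k. snd (d_config D n (E (Suc i)) (d_hist D n us i) (us ! i) k) = {}) \<and>
     (\<forall>k<rounds i. \<forall>u v m. d_inbox D n (E (Suc i)) (d_config D n (E (Suc i)) (d_hist D n us i) (us ! i) k) v u
        = Some m \<longrightarrow> fits (b + 4 * c + 30) n m)"

lemma T: "T n \<ge> 1" using static_rounds_pos[OF st c n] .

lemma net: "i \<le> length us \<Longrightarrow> net A T n c b V (E i)"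
  using vs graph_at_on[OF us] n T st by unfold_locales auto

text \<open>The telescoped accounts: messages with the weighted potential, rounds with the
  unweighted ranks. Both start at 0, since all vertices start in the light MIS and are
  isolated.\<close>

definition reached :: "nat \<Rightarrow> gstate \<Rightarrow> bool" where
  "reached i \<sigma> \<longleftrightarrow> (\<exists>p. represents A T n (d_hist D n us i, {}) (p, \<sigma>)) \<and> quiet V (E i) \<sigma> \<and>
     real (\<Sum>j<i. messages j) + 72 * real (T n) * base V (E i) \<sigma> \<le>
       72 * real (T n) * (46 * (\<Sum>j<i. gpow (E j) + gpow (E (Suc j)))) \<and>
     (\<Sum>j<i. rounds j) + (11 + T n) * (2 * (\<Sum>v\<in>V. rk (cls (\<sigma> v)))) \<le> i * (10 + (11 + T n) * 7) \<and>
     (\<forall>j<i. fine j)"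

lemma reached_0: "reached 0 (\<lambda>v. vstart)"
proof -
  have cl: "clean vstart" by (simp add: clean_def vstart_def has_ml_def)
  have aw: "\<not> awake vstart" by (simp add: vstart_def)
  have nb: "neighbors {} v = {}" for v by (simp add: neighbors_def)
  have "represents A T n (d_hist D n us 0, {}) (0, \<lambda>v. vstart)"
    using cl aw by (simp add: represents_def vlocal_def okay_def)
  moreover have "quiet V (E 0) (\<lambda>v. vstart)"
    using cl aw by unfold_locales (auto simp: nb asleep_def okay_def vstart_def)
  moreover have "base V (E 0) (\<lambda>v. vstart) = 0"
    by (simp add: base_def rk_def excess_def nb vstart_def gpow_def)
  ultimately show ?thesis
    unfolding reached_def by (auto simp: vstart_def rk_def)
qed

lemma reached_Suc:
  assumes i: "i < length us" and r: "reached i \<sigma>"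
  shows "\<exists>\<sigma>'. reached (Suc i) \<sigma>'"
proof -
  interpret net A T n c b V "E (Suc i)" using net i by simp
  obtain p where rep: "represents A T n (d_hist D n us i, {}) (p, \<sigma>)" and q: "quiet V (E i) \<sigma>"
    and m: "real (\<Sum>j<i. messages j) + 72 * real (T n) * base V (E i) \<sigma> \<le>
       72 * real (T n) * (46 * (\<Sum>j<i. gpow (E j) + gpow (E (Suc j))))"
    and ro: "(\<Sum>j<i. rounds j) + (11 + T n) * (2 * (\<Sum>v\<in>V. rk (cls (\<sigma> v)))) \<le> i * (10 + (11 + T n) * 7)"
    and fi: "\<forall>j<i. fine j"
    using r unfolding reached_def by blast
  have g0: "graph_on V (E i)" using graph_at_on[OF us] i by simp
  have val: "valid_update V (E i) (us ! i)" using us i by (simp add: update_seq_def)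
  let ?x = "(11 + T n, gevent (us ! i) \<sigma>)"
  from update_step[OF q g0 val graph_at_Suc[OF i]] obtain K \<sigma>' where
    K: "snd (run K ?x) = \<sigma>'" "quiet V (E (Suc i)) \<sigma>'" "fit K ?x"
    "real (msgs K ?x) + 72 * real (T n) * base V (E (Suc i)) \<sigma>' \<le>
      72 * real (T n) * (base V (E i) \<sigma> + 46 * (gpow (E i) + gpow (E (Suc i))))"
    "K + (11 + T n) * (2 * (\<Sum>v\<in>V. rk (cls (\<sigma>' v)))) \<le> 10 + (11 + T n) * (2 * (\<Sum>v\<in>V. rk (cls (\<sigma> v))) + 7)"
    by blast
  have as: "asleep (snd (run K ?x))" using K(1,2) by (simp add: quiet_def quiet_axioms_def)
  note ue = update_execution[OF n rep as]
  have h: "d_hist D n us (Suc i) = fst (d_config D n (E (Suc i)) (d_hist D n us i) (us ! i) (rounds i))"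
    by (simp add: Let_def)
  have rep': "\<exists>p. represents A T n (d_hist D n us (Suc i), {}) (p, \<sigma>')"
    using ue(4) unfolding h K(1) .
  have e: "b + 1 + 4 * (c + 3) + 17 = b + 4 * c + 30" by simp
  have fine: "fine i" using ue(1) ue(5)[of "c + 3" "b + 1", unfolded e] K(3) by blast
  have "real (messages i) \<le> real (msgs K ?x)" using ue(3) by simp
  then have "real (messages i) + 72 * real (T n) * base V (E (Suc i)) \<sigma>' \<le>
      72 * real (T n) * base V (E i) \<sigma> + 72 * real (T n) * (46 * (gpow (E i) + gpow (E (Suc i))))"
    using K(4) by (simp only: distrib_left)
  then have "real (\<Sum>j<Suc i. messages j) + 72 * real (T n) * base V (E (Suc i)) \<sigma>' \<le>
       72 * real (T n) * (46 * (\<Sum>j<Suc i. gpow (E j) + gpow (E (Suc j))))"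
    using m by (simp add: distrib_left)
  moreover have "(\<Sum>j<Suc i. rounds j) + (11 + T n) * (2 * (\<Sum>v\<in>V. rk (cls (\<sigma>' v)))) \<le> Suc i * (10 + (11 + T n) * 7)"
  proof -
    have "(\<Sum>j<Suc i. rounds j) + (11 + T n) * (2 * (\<Sum>v\<in>V. rk (cls (\<sigma>' v)))) \<le>
        (\<Sum>j<i. rounds j) + (K + (11 + T n) * (2 * (\<Sum>v\<in>V. rk (cls (\<sigma>' v)))))" using ue(2) by simp
    also have "\<dots> \<le> (\<Sum>j<i. rounds j) + (10 + (11 + T n) * (2 * (\<Sum>v\<in>V. rk (cls (\<sigma> v))) + 7))"
      using K(5) by simp
    also have "\<dots> = ((\<Sum>j<i. rounds j) + (11 + T n) * (2 * (\<Sum>v\<in>V. rk (cls (\<sigma> v))))) + (10 + (11 + T n) * 7)"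
      by (simp only: distrib_left add.assoc add.left_commute)
    also have "\<dots> \<le> i * (10 + (11 + T n) * 7) + (10 + (11 + T n) * 7)" using ro by (rule add_right_mono)
    finally show ?thesis by simp
  qed
  moreover have "\<forall>j<Suc i. fine j" using fi fine less_Suc_eq by auto
  ultimately have "reached (Suc i) \<sigma>'" unfolding reached_def using rep' K(2) by blast
  then show ?thesis by blast
qed

lemma reached: "i \<le> length us \<Longrightarrow> \<exists>\<sigma>. reached i \<sigma>"
proof (induction i)
  case 0
  then show ?case using reached_0 by blast
next
  case (Suc i)
  then show ?case using reached_Suc by auto
qed

lemma maintains: "maintains_mis (b + 4 * c + 30) D n V us"
  unfolding maintains_mis_def Let_def
proof (intro conjI allI impI)
  fix i assume i: "i \<le> length us"
  then obtain \<sigma> where r: "reached i \<sigma>" using reached by blast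
  interpret net A T n c b V "E i" using net i by simp
  obtain p where rep: "represents A T n (d_hist D n us i, {}) (p, \<sigma>)" and q: "quiet V (E i) \<sigma>"
    using r unfolding reached_def by blast
  have "d_result D n V us i = {v \<in> V. cls (\<sigma> v) = 2 \<or> hm (\<sigma> v)}"
    using rep n by (simp add: d_result_def mis_alg_def represents_def)
  then show "is_mis V (E i) (d_result D n V us i)" using quiet_mis[OF q] by simp
next
  fix i assume i: "i < length us"
  then obtain \<sigma> where "reached (Suc i) \<sigma>" using reached[of "Suc i"] by auto
  then have "fine i" unfolding reached_def by blast
  then show "\<exists>k. snd (d_config D n (E (Suc i)) (d_hist D n us i) (us ! i) k) = {}"
    "\<And>k u v m. k < rounds i \<Longrightarrow> d_inbox D n (E (Suc i)) (d_config D n (E (Suc i)) (d_hist D n us i) (us ! i) k) v u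
        = Some m \<Longrightarrow> fits (b + 4 * c + 30) n m" by blast+
qed

lemma base_nonneg: "0 \<le> base V F \<sigma>"
  unfolding base_def by (intro sum_nonneg add_nonneg_nonneg) auto

text \<open>For messages, \<open>26496 = 72 * 46 * 2 * 2 * 2\<close>: a graph occurs both before and
  after an update, the averaging inequality loses a factor 2, and there are at most twice as many
  graphs as updates. For rounds the same constant is merely generous.\<close>

lemma amortized:
  shows "amortized_rounds D n us \<le> 26496 * real (T n)"
    and "amortized_messages D n us \<le> 26496 * (avg_edges us powr (2/3) * real (T n))"
proof -
  let ?N = "length us"
  obtain \<sigma> where r: "reached ?N \<sigma>" using reached by blast
  have T1: "real (T n) \<ge> 1" using T by simp
  have ro: "(\<Sum>j<?N. rounds j) \<le> ?N * (10 + (11 + T n) * 7)"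
    using r unfolding reached_def by linarith
  show "amortized_rounds D n us \<le> 26496 * real (T n)"
  proof (cases "?N = 0")
    case True
    then show ?thesis by (simp add: amortized_rounds_def)
  next
    case False
    have "real (\<Sum>j<?N. rounds j) \<le> real (?N * (10 + (11 + T n) * 7))" using ro by (simp only: of_nat_le_iff)
    also have "\<dots> = real ?N * (87 + 7 * real (T n))" by simp
    also have "\<dots> \<le> real ?N * (26496 * real (T n))" using T1 by (intro mult_left_mono) auto
    finally show ?thesis using False by (simp add: amortized_rounds_def field_simps)
  qed
  have "72 * real (T n) * base V (E ?N) \<sigma> \<ge> 0" using base_nonneg by simp
  then have me: "real (\<Sum>j<?N. messages j) \<le> 72 * real (T n) * (46 * (\<Sum>j<?N. gpow (E j) + gpow (E (Suc j))))"
    using r unfolding reached_def by linarith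
  have "(\<Sum>j<?N. gpow (E j)) \<le> (\<Sum>i\<le>?N. gpow (E i))" by (rule sum_mono2) auto
  moreover have "(\<Sum>j<?N. gpow (E (Suc j))) \<le> (\<Sum>i\<le>?N. gpow (E i))"
  proof -
    have "(\<Sum>j<?N. gpow (E (Suc j))) = (\<Sum>i\<in>Suc ` {..<?N}. gpow (E i))" by (subst sum.reindex) auto
    also have "\<dots> \<le> (\<Sum>i\<le>?N. gpow (E i))" by (rule sum_mono2) auto
    finally show ?thesis .
  qed
  ultimately have "(\<Sum>j<?N. gpow (E j) + gpow (E (Suc j))) \<le> 2 * (\<Sum>i\<le>?N. gpow (E i))"
    by (simp add: sum.distrib)
  also have "(\<Sum>i\<le>?N. gpow (E i)) \<le> 2 * real (?N + 1) * avg_edges us powr (2/3)"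
    using sum_powr_le_avg[of ?N "\<lambda>i. real (card (E i))"] by (simp add: gpow_def avg_edges_def)
  finally have s: "(\<Sum>j<?N. gpow (E j) + gpow (E (Suc j))) \<le> 4 * real (?N + 1) * avg_edges us powr (2/3)"
    by (simp add: algebra_simps)
  show "amortized_messages D n us \<le> 26496 * (avg_edges us powr (2/3) * real (T n))"
  proof (cases "?N = 0")
    case True
    then show ?thesis by (simp add: amortized_messages_def)
  next
    case False
    have "real (\<Sum>j<?N. messages j) \<le> 72 * real (T n) * (46 * (4 * real (?N + 1) * avg_edges us powr (2/3)))"
      using me s T1 by (smt (verit) mult_left_mono)
    also have "\<dots> = 13248 * real (T n) * avg_edges us powr (2/3) * real (?N + 1)" by simp
    also have "\<dots> \<le> 13248 * real (T n) * avg_edges us powr (2/3) * (2 * real ?N)"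
      using False by (intro mult_left_mono) (auto simp: One_nat_def Suc_le_eq)
    finally show ?thesis using False by (simp add: amortized_messages_def field_simps)
  qed
qed

end

section \<open>Average against maximum, at most two vertices, and the theorem\<close>

lemma avg_le_max: "avg_edges us \<le> max_edges us"
proof -
  let ?I = "{..length us}" and ?f = "\<lambda>i. card (graph_at us i)"
  have "(\<Sum>i\<in>?I. ?f i) \<le> (\<Sum>i\<in>?I. Max (?f ` ?I))" by (intro sum_mono Max_ge) auto
  then have "real (\<Sum>i\<in>?I. ?f i) \<le> real (Suc (length us) * Max (?f ` ?I))"
    by (simp only: of_nat_le_iff sum_constant card_atMost of_nat_id)
  then show ?thesis unfolding avg_edges_def max_edges_def
    by (simp add: divide_le_eq algebra_simps)
qed

text \<open>Every update concerns both vertices, so the last event tells each of them whether the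
  edge is present: after an insertion the larger ID leaves, after a deletion both are members.
  Nobody stays awake, so the costs are 0, as required in case \<open>T n = 0\<close>.\<close>

lemma few_vertices:
  fixes A :: static_alg and T :: "nat \<Rightarrow> nat"
  assumes V: "finite V" "card V \<le> 2" and us: "update_seq V us" and n: "n \<le> 2"
  defines "D \<equiv> mis_alg A T"
  shows "maintains_mis b D n V us" "amortized_rounds D n us = 0" "amortized_messages D n us = 0"
proof -
  have W: "snd (wakeup D n h x) = {}" for h x
    using n by (cases x) (auto simp: observe_def Let_def D_def mis_alg_def)
  have c0: "snd (d_config D n E h x 0) = {}" for E h x by (simp add: d_config_def W)
  have r0: "d_rounds D n E h x = 0" for E h x
    unfolding d_rounds_def by (rule Least_eq_0) (rule c0)
  have m0: "d_messages D n E h x = 0" for E h x by (simp add: d_messages_def r0)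
  show "amortized_rounds D n us = 0" "amortized_messages D n us = 0"
    by (simp_all add: amortized_rounds_def amortized_messages_def r0 m0)
  have pair: "V = {u, v}" if "u \<in> V" "v \<in> V" "u \<noteq> v" for u v
    using that V by (intro card_seteq[symmetric]) auto
  have hs: "d_hist D n us (Suc i) = fst (wakeup D n (d_hist D n us i) (us ! i))" for i
    by (simp add: Let_def r0 d_config_def)
  have mis: "is_mis V (graph_at us i) (d_result D n V us i)" if i: "i \<le> length us" for i
  proof (cases i)
    case 0
    then have "d_result D n V us i = V" using n by (auto simp: d_result_def D_def mis_alg_def)
    then show ?thesis using 0 by (auto simp: is_mis_def independent_set_def)
  next
    case (Suc j)
    then have j: "j < length us" using i by simp
    have val: "valid_update V (graph_at us j) (us ! j)" using us j by (simp add: update_seq_def)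
    have gj: "graph_on V (graph_at us j)" using graph_at_on[OF us] j by simp
    have E: "graph_at us i = apply_update (us ! j) (graph_at us j)" using graph_at_Suc[OF j] Suc by simp
    show ?thesis
    proof (cases "us ! j")
      case (Ins u v)
      then have uv: "u \<in> V" "v \<in> V" "u \<noteq> v" using val by auto
      note P = pair[OF uv]
      have "d_result D n V us i = {x \<in> V. \<not> (if x = u then v else u) < x}"
        unfolding Suc d_result_def hs Ins using n P
        by (auto simp: observe_def Let_def D_def mis_alg_def)
      then have R: "d_result D n V us i = {min u v}" using uv P by (auto simp: min_def)
      have e: "{u, v} \<in> graph_at us i" by (simp add: E Ins)
      have l: "{x, x} \<notin> graph_at us i" for x using graph_at_on[OF us i] by (auto simp: graph_on_def)
      show ?thesis unfolding R is_mis_def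
      proof (intro conjI allI impI notI)
        show "independent_set V (graph_at us i) {min u v}" using l uv by (auto simp: independent_set_def min_def)
        fix S' assume S': "independent_set V (graph_at us i) S'" "{min u v} \<subset> S'"
        then have "S' \<subseteq> {u, v}" using P by (auto simp: independent_set_def)
        then have "u \<in> S'" "v \<in> S'" using S'(2) by (auto simp: min_def split: if_splits)
        then show False using S'(1) e by (auto simp: independent_set_def)
      qed
    next
      case (Del u v)
      then have e: "{u, v} \<in> graph_at us j" using val by simp
      have "{u, v} \<subseteq> V" "card {u, v} = 2" using e gj by (auto simp: graph_on_def)
      then have uv: "u \<in> V" "v \<in> V" "u \<noteq> v" by auto
      note P = pair[OF uv]
      have "e = {u, v}" if "e \<in> graph_at us j" for e
      proof -
        have "e \<subseteq> {u, v}" "card e = 2" using gj that P by (auto simp: graph_on_def)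
        then show ?thesis using uv by (intro card_seteq) auto
      qed
      then have G: "graph_at us i = {}" using E Del by auto
      have "d_result D n V us i = V"
        unfolding Suc d_result_def hs Del using n P
        by (auto simp: observe_def Let_def D_def mis_alg_def)
      then show ?thesis using G by (auto simp: is_mis_def independent_set_def)
    qed
  qed
  show "maintains_mis b D n V us"
    unfolding maintains_mis_def Let_def r0 using mis c0 by blast
qed

theorem theorem1:
  fixes c b :: nat
  assumes "c \<ge> 1"
  shows "\<exists>(F :: static_alg \<Rightarrow> (nat \<Rightarrow> nat) \<Rightarrow> dyn_alg) (b' :: nat) (C :: real).
    \<forall>A T. static_mis c b A T \<longrightarrow>
      (\<forall>n V us. vertex_set c n V \<and> update_seq V us \<longrightarrow>
         maintains_mis b' (F A T) n V us \<and>
         amortized_rounds (F A T) n us \<le> C * real (T n) \<and>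
         amortized_messages (F A T) n us \<le> C * (max_edges us powr (2/3) * real (T n)) \<and>
         amortized_messages (F A T) n us \<le> C * (avg_edges us powr (2/3) * real (T n)))"
proof (intro exI allI impI, elim conjE)
  fix A T n V us
  assume st: "static_mis c b A T" and V: "vertex_set c n V" and us: "update_seq V us"
  have "maintains_mis (b + 4 * c + 30) (mis_alg A T) n V us \<and>
    amortized_rounds (mis_alg A T) n us \<le> 26496 * real (T n) \<and>
    amortized_messages (mis_alg A T) n us \<le> 26496 * (avg_edges us powr (2/3) * real (T n))"
  proof (cases "n > 2")
    case True
    interpret dynamic c b n A T V us using assms st V us True by unfold_locales
    show ?thesis using maintains amortized by blast
  next
    case False
    then show ?thesis using few_vertices[of V us n] V us by (simp add: vertex_set_def)
  qed
  moreover have "avg_edges us powr (2/3) \<le> max_edges us powr (2/3)"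
    using avg_le_max by (intro powr_mono2) (auto simp: avg_edges_def intro!: divide_nonneg_nonneg sum_nonneg)
  then have "26496 * (avg_edges us powr (2/3) * real (T n)) \<le> 26496 * (max_edges us powr (2/3) * real (T n))"
    by (intro mult_left_mono mult_right_mono) auto
  ultimately show "maintains_mis (b + 4 * c + 30) (mis_alg A T) n V us \<and>
    amortized_rounds (mis_alg A T) n us \<le> 26496 * real (T n) \<and>
    amortized_messages (mis_alg A T) n us \<le> 26496 * (max_edges us powr (2/3) * real (T n)) \<and>
    amortized_messages (mis_alg A T) n us \<le> 26496 * (avg_edges us powr (2/3) * real (T n))"
    by linarith
qed

end
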